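(* Let $V$ be a vertex operator algebra, $T\ge 1$ an integer, $g_1,g_2$ commuting automorphisms of $V$ with $g_1^T=g_2^T=1$, and let $M^1$ be a $g_1$-twisted $V$-module (as in the context). Then $A_{g_1g_2,g_2}(M^1)=M^1/O_{g_1g_2,g_2}(M^1)$ is an $A_{g_1g_2}(V)$-$A_{g_2}(V)$-bimodule, with left action of $A_{g_1g_2}(V)$ induced by $\ast_{g_1g_2,g_2}$ and right action of $A_{g_2}(V)$ induced by $\ast_{g_2,g_1g_2}$.
   Context: All vector spaces are over $\mathbb{C}$; $\mathbb N$ contains $0$. $V=\coprod_{n\in\mathbb Z}V_n$ is a vertex operator algebra (vacuum $\mathbf 1$, conformal vector $\omega$, $\dim V_n<\infty$, $V_n=0$ for $n\ll0$, $Y(\omega,z)=\sum L(n)z^{-n-2}$); $\mathrm{wt}\,u=n$ for $u\in V_n$. Automorphisms of $V$ satisfy $gY(u,z)g^{-1}=Y(gu,z)$ and $g\omega=\omega$. Powers such as $(z_2+z_0)^\alpha$ and $(1+z)^\alpha$ are expanded in nonnegative integer powers of the second variable; $\mathrm{Res}_z$ is the coefficient of $z^{-1}$; $\delta(x)=\sum_{n\in\mathbb Z}x^n$. Twisted modules. Let $g$ be an automorphism with $g^T=1$ and $V^r=\{v: gv=e^{2\pi i r/T}v\}$, $0\le r<T$. A weak $g$-twisted $V$-module is a vector space $M$ with a linear map $Y_M:V\to(\mathrm{End}\,M)\{z\}$ such that: for $u\in V^r$, $w\in M$, $Y_M(u,z)w=\sum_{n\in \frac rT+\mathbb Z}u_nwz^{-n-1}$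 with $u_nw=0$ for $n\gg0$; $Y_M(\mathbf 1,z)=\mathrm{id}$; and for $u\in V^r$, $v\in V$, $$z_0^{-1}\delta\Big(\frac{z_1-z_2}{z_0}\Big)Y_M(u,z_1)Y_M(v,z_2)-z_0^{-1}\delta\Big(\frac{-z_2+z_1}{z_0}\Big)Y_M(v,z_2)Y_M(u,z_1)=z_1^{-1}\delta\Big(\frac{z_2+z_0}{z_1}\Big)\Big(\frac{z_2+z_0}{z_1}\Big)^{\frac rT}Y_M(Y(u,z_0)v,z_2).$$ A $g$-twisted $V$-module is a weak one with $M=\oplus_{\lambda\in\mathbb C}M_\lambda$, $M_\lambda=\{w: L(0)w=\lambda w\}$, $\dim M_\lambda<\infty$, and $M_{\lambda+n/T}=0$ for all sufficiently negative integers $n$. Standing assumption: $M^1=\oplus_{n\in\mathbb N}M^1_{h_1+n/T}$ for some $h_1\in\mathbb C$, and $M^1$ is generated by $M^1_{h_1}$. The algebra $A_g(V)$. Put $\delta(r)=1$ if $r\equiv0\pmod T$, else $\delta(r)=0$. For homogeneous $u\in V^r$, $v\in V$ put $u\circ_g v=\mathrm{Res}_z\frac{(1+z)^{\mathrm{wt}u-1+\delta(r)+r/T}}{z^{1+\delta(r)}}Y(u,z)v$, and $u\ast_g v=\mathrm{Res}_z\frac{(1+z)^{\mathrm{wt}u}}{z}Y(u,z)v$ if $r=0$, $u\ast_g v=0$ if $r\ne0$; extend linearly in $u$. $O_g(V)$ is the span of all $u\circ_g v$ and all $(L(-1)+L(0))u$. $A_g(V)=V/O_g(V)$ is known to be an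 associative algebra under $\ast_g$ with identity $\mathbf 1+O_g(V)$. Products on $M^1$. $V=\oplus_{0\le j_1,j_2<T}V^{(j_1,j_2)}$, $V^{(j_1,j_2)}=\{v: g_kv=e^{2\pi i j_k/T}v,\ k=1,2\}$. Put $\delta(j_1,j_2)=1$ if $j_2=0$; $=1$ if $j_2\ne0$ and $j_1+j_2\ge T$; $=0$ if $j_2\neq0$ and $j_1+j_2<T$. For homogeneous $u\in V^{(j_1,j_2)}$ and $w_1\in M^1$ define (and extend linearly in $u$): $$u\circ_{g_1g_2,g_2}w_1=\mathrm{Res}_z\frac{(1+z)^{\mathrm{wt}u-1+\delta(j_2)+\frac{j_2}T}}{z^{1+\delta(j_1,j_2)-\frac{j_1}T}}Y_{M^1}(u,z)w_1;$$ $$u\ast_{g_1g_2,g_2}w_1=\mathrm{Res}_z\frac{(1+z)^{\mathrm{wt}u-1+\delta(j_2)+\frac{j_2}T}}{z^{1-\frac{j_1}T}}Y_{M^1}(u,z)w_1\ \text{ if } j_1+j_2\equiv0\ (\mathrm{mod}\ T),\text{ and }0\text{ otherwise};$$ $$w_1\ast_{g_2,g_1g_2}u=e^{-\frac{j_1}T\pi i}\,\mathrm{Res}_z\frac{(1+z)^{\mathrm{wt}u-1}}{z^{1-\frac{j_1}T}}Y_{M^1}(u,z)w_1\ \text{ if } j_2=0,\text{ and }0\text{ otherwise}.$$ $O'_{g_1g_2,g_2}(M^1)$ is the span of all $u\circ_{g_1g_2,g_2}w_1$. $O''_{g_1g_2,g_2}(M^1)$ is the span of all $(u\ast_{g_1g_2}v)\ast_{g_1g_2,g_2}w_1-u\ast_{g_1g_2,g_2}(v\ast_{g_1g_2,g_2}w_1)$,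 $w_1\ast_{g_2,g_1g_2}(v\ast_{g_2}u)-(w_1\ast_{g_2,g_1g_2}v)\ast_{g_2,g_1g_2}u$, $u'\ast_{g_1g_2,g_2}w_1$ and $w_1\ast_{g_2,g_1g_2}v'$, with $u,v\in V$, $u'\in O_{g_1g_2}(V)$, $v'\in O_{g_2}(V)$, $w_1\in M^1$. $O_{g_1g_2,g_2}(M^1)=O'_{g_1g_2,g_2}(M^1)+O''_{g_1g_2,g_2}(M^1)$ and $A_{g_1g_2,g_2}(M^1)=M^1/O_{g_1g_2,g_2}(M^1)$. *)

theory Defs
  imports
    Complex_Main
    "HOL-Algebra.Module"
    "HOL-Library.Groups_Big_Fun"
    "HOL-Library.Set_Algebras"
begin

section \<open>Direct sums and linear extension\<close>

text \<open>
  A complex vector space is a type of class \<open>ab_group_add\<close> with a scalar multiplication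
  satisfying \<^locale>\<open>vector_space\<close>; it is the whole type.
\<close>

definition is_decomp :: "'i set \<Rightarrow> ('i \<Rightarrow> 'a::comm_monoid_add set) \<Rightarrow> 'a \<Rightarrow> ('i \<Rightarrow> 'a) \<Rightarrow> bool" where
  "is_decomp I W v c \<longleftrightarrow>
     finite {i. c i \<noteq> 0} \<and> (\<forall>i. i \<notin> I \<longrightarrow> c i = 0) \<and> (\<forall>i\<in>I. c i \<in> W i) \<and>
     v = (\<Sum>i\<in>{i. c i \<noteq> 0}. c i)"

definition is_direct_sum ::
  "(complex \<Rightarrow> 'a::ab_group_add \<Rightarrow> 'a) \<Rightarrow> 'i set \<Rightarrow> ('i \<Rightarrow> 'a set) \<Rightarrow> bool" where
  "is_direct_sum s I W \<longleftrightarrow>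
     (\<forall>i\<in>I. module.subspace s (W i)) \<and> (\<forall>v. \<exists>!c. is_decomp I W v c)"

text \<open>Meaningful only when the space is the direct sum of the \<open>W i\<close>, \<open>i \<in> I\<close>.\<close>

definition component :: "'i set \<Rightarrow> ('i \<Rightarrow> 'a::comm_monoid_add set) \<Rightarrow> 'a \<Rightarrow> 'i \<Rightarrow> 'a" where
  "component I W v = (THE c. is_decomp I W v c)"

text \<open>The additive extension of maps \<open>f i\<close> that are prescribed on the summands \<open>W i\<close> only.\<close>

definition extend_sum ::
  "'i set \<Rightarrow> ('i \<Rightarrow> 'a::comm_monoid_add set) \<Rightarrow> ('i \<Rightarrow> 'a \<Rightarrow> 'b::comm_monoid_add) \<Rightarrow> 'a \<Rightarrow> 'b" where
  "extend_sum I W f v =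
     (\<Sum>i\<in>{i. component I W v i \<noteq> 0}. f i (component I W v i))"

definition fin_dim :: "(complex \<Rightarrow> 'a::ab_group_add \<Rightarrow> 'a) \<Rightarrow> 'a set \<Rightarrow> bool" where
  "fin_dim s W \<longleftrightarrow> (\<exists>B. finite B \<and> W = module.span s B)"


section \<open>Vertex operator algebras and their automorphisms\<close>

text \<open>
  \<open>vmode V u n\<close> is the endomorphism \<open>u\<^sub>n\<close> in \<open>Y(u,z) = \<Sum>n. u\<^sub>n z\<^bsup>-n-1\<^esup>\<close>, and \<open>vgr V n\<close> is the
  homogeneous subspace of weight \<open>n\<close>.
\<close>

record 'v voa =
  vscale :: "complex \<Rightarrow> 'v \<Rightarrow> 'v"
  vmode :: "'v \<Rightarrow> int \<Rightarrow> 'v \<Rightarrow> 'v"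
  vvac :: 'v
  vconf :: 'v
  vgr :: "int \<Rightarrow> 'v set"

text \<open>\<open>Y(\<omega>,z) = \<Sum>n. L(n) z\<^bsup>-n-2\<^esup>\<close>, so \<open>L(n)\<close> is the mode \<open>\<omega>\<^bsub>n+1\<^esub>\<close>.\<close>

definition Lop :: "'v voa \<Rightarrow> int \<Rightarrow> 'v \<Rightarrow> 'v" where
  "Lop V n = vmode V (vconf V) (n + 1)"

text \<open>
  In \<open>jacobi\<close>, the Jacobi identity
  \[
    z_0^{-1}\delta\Big(\frac{z_1-z_2}{z_0}\Big)Y(u,z_1)Y(v,z_2)w
    - z_0^{-1}\delta\Big(\frac{-z_2+z_1}{z_0}\Big)Y(v,z_2)Y(u,z_1)w
    = z_1^{-1}\delta\Big(\frac{z_2+z_0}{z_1}\Big)Y(Y(u,z_0)v,z_2)w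
  \]
  is written as the equality, for all integers \<open>l, m, n\<close>, of the coefficients of
  \<open>z\<^sub>0\<^bsup>-l-1\<^esup> z\<^sub>1\<^bsup>-m-1\<^esup> z\<^sub>2\<^bsup>-n-1\<^esup>\<close>. With \<open>\<delta>(x) = \<Sum>k. x\<^sup>k\<close>, only the powers \<open>(z\<^sub>1 - z\<^sub>2)\<^sup>l\<close>,
  \<open>(-z\<^sub>2 + z\<^sub>1)\<^sup>l\<close> and \<open>(z\<^sub>2 + z\<^sub>0)\<^sup>m\<close> contribute, each expanded in nonnegative powers of its second
  variable. By \<open>truncation\<close> the sums over \<open>i :: nat\<close> have finite support.
\<close>

locale vertex_operator_algebra = vector_space "vscale V"
  for V :: "'v::ab_group_add voa" +
  assumes gr_direct_sum: "is_direct_sum (vscale V) UNIV (vgr V)"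
    and gr_fin_dim: "\<And>n. fin_dim (vscale V) (vgr V n)"
    and gr_bounded_below: "\<exists>N. \<forall>n<N. vgr V n = {0}"
    and mode_linear_left:
      "\<And>n v. Vector_Spaces.linear (vscale V) (vscale V) (\<lambda>u. vmode V u n v)"
    and mode_linear_right:
      "\<And>u n. Vector_Spaces.linear (vscale V) (vscale V) (vmode V u n)"
    and truncation: "\<And>u v. \<exists>N. \<forall>n\<ge>N. vmode V u n v = 0"
    and vacuum: "\<And>n v. vmode V (vvac V) n v = (if n = -1 then v else 0)"
    and creation: "\<And>v. vmode V v (-1) (vvac V) = v"
      "\<And>v n. n \<ge> 0 \<Longrightarrow> vmode V v n (vvac V) = 0"
    and jacobi: "\<And>u v w l m n.
      Sum_any (\<lambda>i::nat. vscale V ((- 1) ^ i * (of_int l gchoose i))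
        (vmode V u (m + l - int i) (vmode V v (n + int i) w)))
      - Sum_any (\<lambda>i::nat. vscale V ((- 1) powi (l - int i) * (of_int l gchoose i))
        (vmode V v (n + l - int i) (vmode V u (m + int i) w)))
      = Sum_any (\<lambda>i::nat. vscale V (of_int m gchoose i)
        (vmode V (vmode V u (l + int i) v) (m + n - int i) w))"
    and vac_weight: "vvac V \<in> vgr V 0"
    and conf_weight: "vconf V \<in> vgr V 2"
    and virasoro: "\<exists>c::complex. \<forall>m n v.
      Lop V m (Lop V n v) - Lop V n (Lop V m v)
      = vscale V (of_int (m - n)) (Lop V (m + n) v)
        + (if m + n = 0 then vscale V (of_int (m ^ 3 - m) / 12 * c) v else 0)"
    and L0_weight: "\<And>n v. v \<in> vgr V n \<Longrightarrow> Lop V 0 v = vscale V (of_int n) v"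
    and L_minus_1_derivative:
      "\<And>u n v. vmode V (Lop V (-1) u) n v = vscale V (- of_int n) (vmode V u (n - 1) v)"

definition voa_automorphism :: "'v::ab_group_add voa \<Rightarrow> ('v \<Rightarrow> 'v) \<Rightarrow> bool" where
  "voa_automorphism V g \<longleftrightarrow>
     Vector_Spaces.linear (vscale V) (vscale V) g \<and> bij g \<and>
     (\<forall>u n. g \<circ> vmode V u n \<circ> inv_into UNIV g = vmode V (g u) n) \<and> g (vconf V) = vconf V"

definition eigen :: "'v voa \<Rightarrow> nat \<Rightarrow> ('v \<Rightarrow> 'v) \<Rightarrow> nat \<Rightarrow> 'v set" where
  "eigen V T g r = {v. g v = vscale V (exp (2 * of_real pi * \<i> * of_nat r / of_nat T)) v}"


section \<open>Twisted modules\<close>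

text \<open>
  \<open>mmode M u n\<close> is \<open>u\<^sub>n\<close> in \<open>Y\<^sub>M(u,z) = \<Sum>n. u\<^sub>n z\<^bsup>-n-1\<^esup>\<close>, an element of \<open>(End M){z}\<close>, so that \<open>n\<close>
  is a complex number.
\<close>

record ('v, 'm) voa_module =
  mscale :: "complex \<Rightarrow> 'm \<Rightarrow> 'm"
  mmode :: "'v \<Rightarrow> complex \<Rightarrow> 'm \<Rightarrow> 'm"

definition frac_ints :: "nat \<Rightarrow> nat \<Rightarrow> complex set" where
  "frac_ints T r = {of_nat r / of_nat T + of_int k | k. True}"

text \<open>
  The twisted Jacobi identity is again written as the equality of the coefficients of
  \<open>z\<^sub>0\<^bsup>-l-1\<^esup> z\<^sub>1\<^bsup>-m-1\<^esup> z\<^sub>2\<^bsup>-n-1\<^esup>\<close>. Here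
  \[
    z_1^{-1}\delta\Big(\frac{z_2+z_0}{z_1}\Big)\Big(\frac{z_2+z_0}{z_1}\Big)^{r/T}
    = \sum_{m \in r/T + \mathbb{Z}} (z_2+z_0)^m z_1^{-m-1},
  \]
  and for \<open>m\<close> outside \<open>r/T + \<int>\<close> all the coefficients vanish.
\<close>

locale weak_twisted_module = vertex_operator_algebra V + M: vector_space "mscale M"
  for V :: "'v::ab_group_add voa" and T :: nat and g :: "'v \<Rightarrow> 'v"
    and M :: "('v, 'm::ab_group_add) voa_module" +
  assumes T_pos: "T \<ge> 1"
    and automorphism: "voa_automorphism V g"
    and finite_order: "g ^^ T = id"
    and mmode_linear_left:
      "\<And>n w. Vector_Spaces.linear (vscale V) (mscale M) (\<lambda>u. mmode M u n w)"
    and mmode_linear_right: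
      "\<And>u n. Vector_Spaces.linear (mscale M) (mscale M) (mmode M u n)"
    and mmode_support:
      "\<And>r u n w. r < T \<Longrightarrow> u \<in> eigen V T g r \<Longrightarrow> n \<notin> frac_ints T r \<Longrightarrow> mmode M u n w = 0"
    and mmode_truncation:
      "\<And>r u w. r < T \<Longrightarrow> u \<in> eigen V T g r \<Longrightarrow>
        \<exists>N::real. \<forall>n\<in>frac_ints T r. Re n \<ge> N \<longrightarrow> mmode M u n w = 0"
    and mmode_vacuum: "\<And>n w. mmode M (vvac V) n w = (if n = -1 then w else 0)"
    and twisted_jacobi: "\<And>r u v w l m n. r < T \<Longrightarrow> u \<in> eigen V T g r \<Longrightarrow> m \<in> frac_ints T r \<Longrightarrow>
      Sum_any (\<lambda>i::nat. mscale M ((- 1) ^ i * (of_int l gchoose i))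
        (mmode M u (m + of_int l - of_nat i) (mmode M v (n + of_nat i) w)))
      - Sum_any (\<lambda>i::nat. mscale M ((- 1) powi (l - int i) * (of_int l gchoose i))
        (mmode M v (n + of_int l - of_nat i) (mmode M u (m + of_nat i) w)))
      = Sum_any (\<lambda>i::nat. mscale M (m gchoose i)
        (mmode M (vmode V u (l + int i) v) (m + n - of_nat i) w))"

definition L0_space :: "'v voa \<Rightarrow> ('v, 'm) voa_module \<Rightarrow> complex \<Rightarrow> 'm set" where
  "L0_space V M a = {w. mmode M (vconf V) 1 w = mscale M a w}"

locale twisted_module = weak_twisted_module V T g M
  for V :: "'v::ab_group_add voa" and T :: nat and g :: "'v \<Rightarrow> 'v"
    and M :: "('v, 'm::ab_group_add) voa_module" +
  assumes L0_direct_sum: "is_direct_sum (mscale M) UNIV (L0_space V M)"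
    and L0_fin_dim: "\<And>a. fin_dim (mscale M) (L0_space V M a)"
    and L0_bounded_below:
      "\<And>a. \<exists>N::int. \<forall>n<N. L0_space V M (a + of_int n / of_nat T) = {0}"

definition generated_by :: "('v, 'm::ab_group_add) voa_module \<Rightarrow> 'm set \<Rightarrow> bool" where
  "generated_by M S \<longleftrightarrow>
     (\<forall>W. module.subspace (mscale M) W \<and> S \<subseteq> W \<and> (\<forall>u n. \<forall>w\<in>W. mmode M u n w \<in> W) \<longrightarrow> W = UNIV)"

definition generated_in_lowest_degree ::
  "'v voa \<Rightarrow> nat \<Rightarrow> ('v, 'm::ab_group_add) voa_module \<Rightarrow> bool" where
  "generated_in_lowest_degree V T M \<longleftrightarrow>
     (\<exists>h::complex. is_direct_sum (mscale M) UNIV (\<lambda>n::nat. L0_space V M (h + of_nat n / of_nat T)) \<and>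
       generated_by M (L0_space V M h))"


section \<open>Residues\<close>

text \<open>
  \<open>res_binom s a b f\<close> is the residue of \<open>(1+z)\<^sup>a z\<^sup>b \<Sum>n. f n z\<^bsup>-n-1\<^esup>\<close>: in
  \<open>\<Sum>i. (a gchoose i) z\<^bsup>i+b\<^esup> \<Sum>n. f n z\<^bsup>-n-1\<^esup>\<close> the power \<open>z\<^bsup>-1\<^esup>\<close> occurs for \<open>n = b + i\<close>. The index
  type of \<open>f\<close> is \<open>int\<close> for \<open>V\<close> and \<open>complex\<close> for a twisted module.
\<close>

definition res_binom ::
  "(complex \<Rightarrow> 'a \<Rightarrow> 'a::comm_monoid_add) \<Rightarrow> complex \<Rightarrow> 'n::semiring_1 \<Rightarrow> ('n \<Rightarrow> 'a) \<Rightarrow> 'a" where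
  "res_binom s a b f = Sum_any (\<lambda>i::nat. s (a gchoose i) (f (b + of_nat i)))"


section \<open>Quotients, associative algebras and bimodules\<close>

text \<open>
  The map on cosets induced by a binary map \<open>f\<close>. If \<open>f\<close> is well defined modulo the given
  subspaces, all the cosets \<open>f x y +o O'\<close> in the union coincide.
\<close>

definition induced_op ::
  "'c::plus set \<Rightarrow> ('a \<Rightarrow> 'b \<Rightarrow> 'c) \<Rightarrow> 'a set \<Rightarrow> 'b set \<Rightarrow> 'c set" where
  "induced_op O' f X Y = (\<Union>x\<in>X. \<Union>y\<in>Y. f x y +o O')"

text \<open>
  The record type of modules has multiplicative fields, which
  \<^locale>\<open>Module.module\<close> ignores; here they are left undefined.
\<close>

definition quotient_space ::
  "(complex \<Rightarrow> 'a::ab_group_add \<Rightarrow> 'a) \<Rightarrow> 'a set \<Rightarrow> (complex, 'a set) Module.module" where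
  "quotient_space s O' =
     \<lparr> carrier = {x +o O' | x. True}, monoid.mult = undefined, one = undefined,
       ring.zero = 0 +o O', add = (\<lambda>X Y. X + Y),
       smult = (\<lambda>c X. \<Union>x\<in>X. s c x +o O') \<rparr>"

definition quotient_algebra ::
  "(complex \<Rightarrow> 'a::ab_group_add \<Rightarrow> 'a) \<Rightarrow> 'a set \<Rightarrow> ('a \<Rightarrow> 'a \<Rightarrow> 'a) \<Rightarrow> 'a
    \<Rightarrow> (complex, 'a set) Module.module" where
  "quotient_algebra s O' m e =
     (quotient_space s O') \<lparr> monoid.mult := induced_op O' m, one := e +o O' \<rparr>"

definition complex_ring :: "complex ring" where
  "complex_ring =
     \<lparr> carrier = UNIV, monoid.mult = (*), one = 1, ring.zero = 0, add = (+) \<rparr>"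

text \<open>Unlike in \<^locale>\<open>algebra\<close>, the ring \<open>A\<close> need not be commutative.\<close>

locale assoc_algebra = Module.module R A + A: ring A
  for R :: "('r, 'x) ring_scheme" and A :: "('r, 'a, 'y) module_scheme" +
  assumes smult_mult_left: "\<And>c x y. c \<in> carrier R \<Longrightarrow> x \<in> carrier A \<Longrightarrow> y \<in> carrier A \<Longrightarrow>
      (c \<odot>\<^bsub>A\<^esub> x) \<otimes>\<^bsub>A\<^esub> y = c \<odot>\<^bsub>A\<^esub> (x \<otimes>\<^bsub>A\<^esub> y)"
    and smult_mult_right: "\<And>c x y. c \<in> carrier R \<Longrightarrow> x \<in> carrier A \<Longrightarrow> y \<in> carrier A \<Longrightarrow>
      x \<otimes>\<^bsub>A\<^esub> (c \<odot>\<^bsub>A\<^esub> y) = c \<odot>\<^bsub>A\<^esub> (x \<otimes>\<^bsub>A\<^esub> y)"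

text \<open>\<open>lact a x\<close> is \<open>a\<cdot>x\<close> and \<open>ract x b\<close> is \<open>x\<cdot>b\<close>.\<close>

locale algebra_bimodule =
  A: assoc_algebra R A + B: assoc_algebra R B + X: Module.module R X
  for R :: "('r, 'x) ring_scheme"
    and A :: "('r, 'a, 'y) module_scheme" and B :: "('r, 'b, 'z) module_scheme"
    and X :: "('r, 'm, 'w) module_scheme"
    and lact :: "'a \<Rightarrow> 'm \<Rightarrow> 'm" and ract :: "'m \<Rightarrow> 'b \<Rightarrow> 'm" +
  assumes lact_closed: "\<And>a x. a \<in> carrier A \<Longrightarrow> x \<in> carrier X \<Longrightarrow> lact a x \<in> carrier X"
    and lact_add_left: "\<And>a a' x. a \<in> carrier A \<Longrightarrow> a' \<in> carrier A \<Longrightarrow> x \<in> carrier X \<Longrightarrow>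
      lact (a \<oplus>\<^bsub>A\<^esub> a') x = lact a x \<oplus>\<^bsub>X\<^esub> lact a' x"
    and lact_add_right: "\<And>a x x'. a \<in> carrier A \<Longrightarrow> x \<in> carrier X \<Longrightarrow> x' \<in> carrier X \<Longrightarrow>
      lact a (x \<oplus>\<^bsub>X\<^esub> x') = lact a x \<oplus>\<^bsub>X\<^esub> lact a x'"
    and lact_smult_left: "\<And>c a x. c \<in> carrier R \<Longrightarrow> a \<in> carrier A \<Longrightarrow> x \<in> carrier X \<Longrightarrow>
      lact (c \<odot>\<^bsub>A\<^esub> a) x = c \<odot>\<^bsub>X\<^esub> lact a x"
    and lact_smult_right: "\<And>c a x. c \<in> carrier R \<Longrightarrow> a \<in> carrier A \<Longrightarrow> x \<in> carrier X \<Longrightarrow>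
      lact a (c \<odot>\<^bsub>X\<^esub> x) = c \<odot>\<^bsub>X\<^esub> lact a x"
    and lact_mult: "\<And>a a' x. a \<in> carrier A \<Longrightarrow> a' \<in> carrier A \<Longrightarrow> x \<in> carrier X \<Longrightarrow>
      lact (a \<otimes>\<^bsub>A\<^esub> a') x = lact a (lact a' x)"
    and lact_one: "\<And>x. x \<in> carrier X \<Longrightarrow> lact \<one>\<^bsub>A\<^esub> x = x"
    and ract_closed: "\<And>x b. x \<in> carrier X \<Longrightarrow> b \<in> carrier B \<Longrightarrow> ract x b \<in> carrier X"
    and ract_add_left: "\<And>x x' b. x \<in> carrier X \<Longrightarrow> x' \<in> carrier X \<Longrightarrow> b \<in> carrier B \<Longrightarrow>
      ract (x \<oplus>\<^bsub>X\<^esub> x') b = ract x b \<oplus>\<^bsub>X\<^esub> ract x' b"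
    and ract_add_right: "\<And>x b b'. x \<in> carrier X \<Longrightarrow> b \<in> carrier B \<Longrightarrow> b' \<in> carrier B \<Longrightarrow>
      ract x (b \<oplus>\<^bsub>B\<^esub> b') = ract x b \<oplus>\<^bsub>X\<^esub> ract x b'"
    and ract_smult_left: "\<And>c x b. c \<in> carrier R \<Longrightarrow> x \<in> carrier X \<Longrightarrow> b \<in> carrier B \<Longrightarrow>
      ract (c \<odot>\<^bsub>X\<^esub> x) b = c \<odot>\<^bsub>X\<^esub> ract x b"
    and ract_smult_right: "\<And>c x b. c \<in> carrier R \<Longrightarrow> x \<in> carrier X \<Longrightarrow> b \<in> carrier B \<Longrightarrow>
      ract x (c \<odot>\<^bsub>B\<^esub> b) = c \<odot>\<^bsub>X\<^esub> ract x b"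
    and ract_mult: "\<And>x b b'. x \<in> carrier X \<Longrightarrow> b \<in> carrier B \<Longrightarrow> b' \<in> carrier B \<Longrightarrow>
      ract x (b \<otimes>\<^bsub>B\<^esub> b') = ract (ract x b) b'"
    and ract_one: "\<And>x. x \<in> carrier X \<Longrightarrow> ract x \<one>\<^bsub>B\<^esub> = x"
    and lact_ract: "\<And>a x b. a \<in> carrier A \<Longrightarrow> x \<in> carrier X \<Longrightarrow> b \<in> carrier B \<Longrightarrow>
      ract (lact a x) b = lact a (ract x b)"


section \<open>The twisted Zhu algebra\<close>

definition delta1 :: "nat \<Rightarrow> nat \<Rightarrow> nat" where
  "delta1 T r = (if r mod T = 0 then 1 else 0)"

definition bigr_index :: "nat \<Rightarrow> (int \<times> nat) set" where
  "bigr_index T = UNIV \<times> {..<T}"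

definition bigr :: "'v voa \<Rightarrow> nat \<Rightarrow> ('v \<Rightarrow> 'v) \<Rightarrow> int \<times> nat \<Rightarrow> 'v set" where
  "bigr V T g = (\<lambda>(n, r). vgr V n \<inter> eigen V T g r)"

definition zhu_circ ::
  "'v::ab_group_add voa \<Rightarrow> nat \<Rightarrow> ('v \<Rightarrow> 'v) \<Rightarrow> 'v \<Rightarrow> 'v \<Rightarrow> 'v" where
  "zhu_circ V T g u v = extend_sum (bigr_index T) (bigr V T g)
     (\<lambda>(n, r) u. res_binom (vscale V)
        (of_int n - 1 + of_nat (delta1 T r) + of_nat r / of_nat T)
        (- (1 + int (delta1 T r))) (\<lambda>k. vmode V u k v)) u"

definition zhu_star ::
  "'v::ab_group_add voa \<Rightarrow> nat \<Rightarrow> ('v \<Rightarrow> 'v) \<Rightarrow> 'v \<Rightarrow> 'v \<Rightarrow> 'v" where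
  "zhu_star V T g u v = extend_sum (bigr_index T) (bigr V T g)
     (\<lambda>(n, r) u. if r = 0
        then res_binom (vscale V) (of_int n) (- 1 :: int) (\<lambda>k. vmode V u k v) else 0) u"

definition zhu_O :: "'v::ab_group_add voa \<Rightarrow> nat \<Rightarrow> ('v \<Rightarrow> 'v) \<Rightarrow> 'v set" where
  "zhu_O V T g = module.span (vscale V)
     ({zhu_circ V T g u v | u v. True} \<union> {Lop V (- 1) u + Lop V 0 u | u. True})"

definition zhu_algebra ::
  "'v::ab_group_add voa \<Rightarrow> nat \<Rightarrow> ('v \<Rightarrow> 'v) \<Rightarrow> (complex, 'v set) Module.module" where
  "zhu_algebra V T g = quotient_algebra (vscale V) (zhu_O V T g) (zhu_star V T g) (vvac V)"


section \<open>The bimodule of a twisted module\<close>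

definition delta2 :: "nat \<Rightarrow> nat \<Rightarrow> nat \<Rightarrow> nat" where
  "delta2 T j1 j2 = (if j2 = 0 then 1 else if j1 + j2 \<ge> T then 1 else 0)"

definition trigr_index :: "nat \<Rightarrow> (int \<times> nat \<times> nat) set" where
  "trigr_index T = UNIV \<times> {..<T} \<times> {..<T}"

definition trigr ::
  "'v voa \<Rightarrow> nat \<Rightarrow> ('v \<Rightarrow> 'v) \<Rightarrow> ('v \<Rightarrow> 'v) \<Rightarrow> int \<times> nat \<times> nat \<Rightarrow> 'v set" where
  "trigr V T g1 g2 = (\<lambda>(n, j1, j2). vgr V n \<inter> eigen V T g1 j1 \<inter> eigen V T g2 j2)"

text \<open>
  \<open>bimod_circ V T g1 g2 M u w\<close>, \<open>bimod_left V T g1 g2 M u w\<close> and \<open>bimod_right V T g1 g2 M w u\<close> are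
  the products written \<open>u \<circ> w\<close> and \<open>u * w\<close> (both with subscript \<open>g\<^sub>1g\<^sub>2,g\<^sub>2\<close>) and
  \<open>w * u\<close> (with subscript \<open>g\<^sub>2,g\<^sub>1g\<^sub>2\<close>).
\<close>

definition bimod_circ ::
  "'v::ab_group_add voa \<Rightarrow> nat \<Rightarrow> ('v \<Rightarrow> 'v) \<Rightarrow> ('v \<Rightarrow> 'v)
    \<Rightarrow> ('v, 'm::ab_group_add) voa_module \<Rightarrow> 'v \<Rightarrow> 'm \<Rightarrow> 'm" where
  "bimod_circ V T g1 g2 M u w = extend_sum (trigr_index T) (trigr V T g1 g2)
     (\<lambda>(n, j1, j2) u. res_binom (mscale M)
        (of_int n - 1 + of_nat (delta1 T j2) + of_nat j2 / of_nat T)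
        (- (1 + of_nat (delta2 T j1 j2) - of_nat j1 / of_nat T)) (\<lambda>k. mmode M u k w)) u"

definition bimod_left ::
  "'v::ab_group_add voa \<Rightarrow> nat \<Rightarrow> ('v \<Rightarrow> 'v) \<Rightarrow> ('v \<Rightarrow> 'v)
    \<Rightarrow> ('v, 'm::ab_group_add) voa_module \<Rightarrow> 'v \<Rightarrow> 'm \<Rightarrow> 'm" where
  "bimod_left V T g1 g2 M u w = extend_sum (trigr_index T) (trigr V T g1 g2)
     (\<lambda>(n, j1, j2) u. if (j1 + j2) mod T = 0
        then res_binom (mscale M)
          (of_int n - 1 + of_nat (delta1 T j2) + of_nat j2 / of_nat T)
          (- (1 - of_nat j1 / of_nat T)) (\<lambda>k. mmode M u k w)
        else 0) u"

definition bimod_right ::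
  "'v::ab_group_add voa \<Rightarrow> nat \<Rightarrow> ('v \<Rightarrow> 'v) \<Rightarrow> ('v \<Rightarrow> 'v)
    \<Rightarrow> ('v, 'm::ab_group_add) voa_module \<Rightarrow> 'm \<Rightarrow> 'v \<Rightarrow> 'm" where
  "bimod_right V T g1 g2 M w u = extend_sum (trigr_index T) (trigr V T g1 g2)
     (\<lambda>(n, j1, j2) u. if j2 = 0
        then mscale M (exp (- (of_nat j1 / of_nat T) * of_real pi * \<i>))
          (res_binom (mscale M) (of_int n - 1) (- (1 - of_nat j1 / of_nat T)) (\<lambda>k. mmode M u k w))
        else 0) u"

definition bimod_O' ::
  "'v::ab_group_add voa \<Rightarrow> nat \<Rightarrow> ('v \<Rightarrow> 'v) \<Rightarrow> ('v \<Rightarrow> 'v)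
    \<Rightarrow> ('v, 'm::ab_group_add) voa_module \<Rightarrow> 'm set" where
  "bimod_O' V T g1 g2 M =
     module.span (mscale M) {bimod_circ V T g1 g2 M u w | u w. True}"

definition bimod_O'' ::
  "'v::ab_group_add voa \<Rightarrow> nat \<Rightarrow> ('v \<Rightarrow> 'v) \<Rightarrow> ('v \<Rightarrow> 'v)
    \<Rightarrow> ('v, 'm::ab_group_add) voa_module \<Rightarrow> 'm set" where
  "bimod_O'' V T g1 g2 M = module.span (mscale M)
     ({bimod_left V T g1 g2 M (zhu_star V T (g1 \<circ> g2) u v) w
         - bimod_left V T g1 g2 M u (bimod_left V T g1 g2 M v w) | u v w. True}
      \<union> {bimod_right V T g1 g2 M w (zhu_star V T g2 v u)
         - bimod_right V T g1 g2 M (bimod_right V T g1 g2 M w v) u | u v w. True}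
      \<union> {bimod_left V T g1 g2 M u' w | u' w. u' \<in> zhu_O V T (g1 \<circ> g2)}
      \<union> {bimod_right V T g1 g2 M w v' | v' w. v' \<in> zhu_O V T g2})"

definition bimod_O ::
  "'v::ab_group_add voa \<Rightarrow> nat \<Rightarrow> ('v \<Rightarrow> 'v) \<Rightarrow> ('v \<Rightarrow> 'v)
    \<Rightarrow> ('v, 'm::ab_group_add) voa_module \<Rightarrow> 'm set" where
  "bimod_O V T g1 g2 M = bimod_O' V T g1 g2 M + bimod_O'' V T g1 g2 M"

definition bimod_quotient ::
  "'v::ab_group_add voa \<Rightarrow> nat \<Rightarrow> ('v \<Rightarrow> 'v) \<Rightarrow> ('v \<Rightarrow> 'v)
    \<Rightarrow> ('v, 'm::ab_group_add) voa_module \<Rightarrow> (complex, 'm set) Module.module" where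
  "bimod_quotient V T g1 g2 M = quotient_space (mscale M) (bimod_O V T g1 g2 M)"

end

(*
Every product is a residue of (1+z)^a z^b Y(u,z)w.  Since L(-1)u acts by d/dz, O' contains all the
residues obtained from a generator by raising a by k and lowering b by m, 0 <= k <= m.  The
commutator of two residues is a sum of such residues of the vectors u_s v, and comparing exponents
shows that O' is stable under the left and the right product and that these two products commute
modulo O'.  Given this, the relations divided out in O'' are permuted by both products as soon as
A_g(V) is known to be an associative algebra.  That is the same computation for M = V and g_1 = id:
then O' = O_g(V), and by skew symmetry the left product x * u and the right product of u on x agree
modulo O', so that associativity is the commutation of left and right products.
*)

theory Submission
  imports Defs "HOL-Computational_Algebra.Formal_Power_Series"
begin

section \<open>Direct sums\<close>

text \<open>On M only the coefficient l = 0 of the Jacobi identity is needed to compare products. It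
  requires the z-exponent of the first operator to lie in p/T + Z, and both one-sided products use
  p/T - 1. The obstacle is carrying: if u and v have eigenvalue indices (p, q) and (p', q'), then
  u_s v has indices ((p + p') mod T, (q + q') mod T), and each overflow past T moves one integer
  power into the exponent of z or of 1+z. The values of \<open>delta2\<close> are such that the
  bound k \<le> m survives these carries. The mode number s does not interfere: the weight of u_s v
  drops by s + 1, and if t of the s powers of z0 are taken from (1+z1)^a and s - t from z1^b, then
  the surplus in 1+z and the lowering in z both grow by s - t. So k \<le> m is one inequality per
  quadruple of indices. On V, skew symmetry has to be worked out only for g-fixed vectors: an
  eigenvector u with another eigenvalue satisfies u o 1 = u and so lies in O' itself.\<close>

lemma is_decomp_iff_Sum_any:
  "is_decomp I W v c \<longleftrightarrow>
     finite {i. c i \<noteq> 0} \<and> (\<forall>i. i \<notin> I \<longrightarrow> c i = 0) \<and> (\<forall>i\<in>I. c i \<in> W i) \<and> v = Sum_any c"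
  by (auto simp: is_decomp_def Sum_any.expand_set)

text \<open>F may exceed the support, so a decomposition can be verified over any convenient finite
  set, whereas \<open>is_decomp\<close> sums over the exact support.\<close>

lemma is_decompI:
  assumes "finite F" "F \<subseteq> I" "\<And>i. i \<notin> F \<Longrightarrow> c i = 0" "\<And>i. i \<in> I \<Longrightarrow> c i \<in> W i" "v = sum c F"
  shows "is_decomp I W v c"
proof -
  have "{i. c i \<noteq> 0} \<subseteq> F" using assms(3) by auto
  moreover have "sum c {i. c i \<noteq> 0} = sum c F"
    by (rule sum.mono_neutral_left) (use assms calculation in auto)
  ultimately show ?thesis
    using assms finite_subset[of _ F] unfolding is_decomp_def by (metis subsetD)
qed

lemma component_eqI:
  assumes "is_direct_sum s I W" "is_decomp I W v c"
  shows "component I W v = c"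
  using assms unfolding is_direct_sum_def component_def by (metis the_equality)

lemma is_decomp_component:
  assumes "is_direct_sum s I W"
  shows "is_decomp I W v (component I W v)"
  using assms component_eqI unfolding is_direct_sum_def by metis

lemma direct_sum_induct:
  assumes ds: "is_direct_sum s I W"
    and zero: "P 0" and add: "\<And>v w. P v \<Longrightarrow> P w \<Longrightarrow> P (v + w)"
    and hom: "\<And>i v. i \<in> I \<Longrightarrow> v \<in> W i \<Longrightarrow> P v"
  shows "P v"
proof -
  let ?c = "component I W v"
  have d: "is_decomp I W v ?c" by (rule is_decomp_component[OF ds])
  have "P (sum ?c F)" if "finite F" for F
    using that
  proof (induction F)
    case (insert i F)
    have "P (?c i)"
      using d hom zero by (cases "i \<in> I") (auto simp: is_decomp_def)
    with insert show ?case by (simp add: add)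
  qed (simp add: zero)
  with d show ?thesis unfolding is_decomp_def by metis
qed

locale complex_space = vector_space scale
  for scale :: "complex \<Rightarrow> 'a::ab_group_add \<Rightarrow> 'a"
begin

lemma component_homogeneous:
  assumes ds: "is_direct_sum scale I W" and "i \<in> I" "v \<in> W i"
  shows "component I W v = (\<lambda>j. if j = i then v else 0)"
proof (rule component_eqI[OF ds])
  have "0 \<in> W j" if "j \<in> I" for j
    using ds that subspace_0 unfolding is_direct_sum_def by blast
  then show "is_decomp I W v (\<lambda>j. if j = i then v else 0)"
    using assms by (intro is_decompI[of "{i}"]) auto
qed

lemma component_add:
  assumes ds: "is_direct_sum scale I W"
  shows "component I W (v + w) = (\<lambda>i. component I W v i + component I W w i)"
proof (rule component_eqI[OF ds])
  let ?a = "component I W v" and ?b = "component I W w"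
  have a: "is_decomp I W v ?a" and b: "is_decomp I W w ?b"
    by (rule is_decomp_component[OF ds])+
  have fin: "finite {i. ?a i + ?b i \<noteq> 0}"
    by (rule finite_subset[of _ "{i. ?a i \<noteq> 0} \<union> {i. ?b i \<noteq> 0}"])
      (use a b in \<open>auto simp: is_decomp_def\<close>)
  have "?a i + ?b i \<in> W i" if "i \<in> I" for i
    using ds that a b subspace_add unfolding is_direct_sum_def is_decomp_def by metis
  then show "is_decomp I W (v + w) (\<lambda>i. ?a i + ?b i)"
    using a b fin unfolding is_decomp_iff_Sum_any by (auto simp: Sum_any.distrib)
qed

lemma component_scale:
  assumes ds: "is_direct_sum scale I W"
  shows "component I W (scale k v) = (\<lambda>i. scale k (component I W v i))"
proof (rule component_eqI[OF ds])
  let ?a = "component I W v"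
  have a: "is_decomp I W v ?a"
    by (rule is_decomp_component[OF ds])
  have "scale k (?a i) \<in> W i" if "i \<in> I" for i
    using ds that a subspace_scale unfolding is_direct_sum_def is_decomp_def by metis
  moreover have "{i. ?a i \<noteq> 0} \<subseteq> I" using a unfolding is_decomp_def by blast
  moreover have "scale k v = (\<Sum>i | ?a i \<noteq> 0. scale k (?a i))"
    using a unfolding is_decomp_def by (metis scale_sum_right)
  ultimately show "is_decomp I W (scale k v) (\<lambda>i. scale k (?a i))"
    using a by (intro is_decompI[of "{i. ?a i \<noteq> 0}"]) (auto simp: is_decomp_def)
qed

text \<open>Applying the additive maps \<open>P i\<close> to a decomposition recovers its entries,
  which gives uniqueness; existence is \<open>P_sum\<close>. A direct sum is thus established by
  exhibiting its projections.\<close>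

lemma direct_sum_projectionsI:
  assumes sub: "\<And>i. i \<in> I \<Longrightarrow> subspace (W i)"
    and P_in: "\<And>i v. i \<in> I \<Longrightarrow> P i v \<in> W i"
    and P_0: "\<And>i. i \<in> I \<Longrightarrow> P i 0 = 0"
    and P_add: "\<And>i v w. i \<in> I \<Longrightarrow> P i (v + w) = P i v + P i w"
    and P_on: "\<And>i j v. i \<in> I \<Longrightarrow> j \<in> I \<Longrightarrow> v \<in> W j \<Longrightarrow> P i v = (if i = j then v else 0)"
    and P_sum: "\<And>v. \<exists>F. finite F \<and> F \<subseteq> I \<and> (\<forall>i\<in>I - F. P i v = 0) \<and> v = (\<Sum>i\<in>F. P i v)"
  shows "is_direct_sum scale I W"
proof -
  have "\<exists>!c. is_decomp I W v c" for v
  proof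
    obtain F where F: "finite F" "F \<subseteq> I" "\<forall>i\<in>I - F. P i v = 0" "v = (\<Sum>i\<in>F. P i v)"
      using P_sum by blast
    show "is_decomp I W v (\<lambda>i. if i \<in> I then P i v else 0)"
    proof (rule is_decompI[OF F(1,2)])
      show "v = (\<Sum>i\<in>F. if i \<in> I then P i v else 0)"
        by (subst F(4), rule sum.cong) (use F(2) in auto)
    qed (use F P_in in auto)
  next
    fix c assume c: "is_decomp I W v c"
    have I: "{i. c i \<noteq> 0} \<subseteq> I" using c unfolding is_decomp_def by blast
    have "P i v = c i" if i: "i \<in> I" for i
    proof -
      have "P i (sum c F) = (if i \<in> F then c i else 0)" if "finite F" "F \<subseteq> I" for F
        using that
      proof (induction F)
        case (insert j F)
        then have "P i (c j) = (if i = j then c j else 0)"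
          using c i P_on[of i j "c j"] unfolding is_decomp_def by blast
        then show ?case using insert i by (auto simp: P_add)
      qed (simp add: P_0 i)
      from this[of "{i. c i \<noteq> 0}"] show ?thesis
        using c I unfolding is_decomp_def by auto
    qed
    then show "c = (\<lambda>i. if i \<in> I then P i v else 0)"
      using c unfolding is_decomp_def by auto
  qed
  then show ?thesis using sub unfolding is_direct_sum_def by blast
qed

end

section \<open>Linear extension of maps prescribed on the summands\<close>

locale complex_space_pair = V1: complex_space s1 + V2: complex_space s2
  for s1 :: "complex \<Rightarrow> 'a::ab_group_add \<Rightarrow> 'a" and s2 :: "complex \<Rightarrow> 'b::ab_group_add \<Rightarrow> 'b"
begin

sublocale vector_space_pair s1 s2 ..

text \<open>Lets two vectors and their sum share one finite index set, which additivity of the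
  extension requires.\<close>

lemma extend_sum_superset:
  assumes "\<And>i. i \<in> I \<Longrightarrow> Vector_Spaces.linear s1 s2 (f i)" "is_direct_sum s1 I W"
    and "finite F" "{i. component I W v i \<noteq> 0} \<subseteq> F" "F \<subseteq> I"
  shows "extend_sum I W f v = (\<Sum>i\<in>F. f i (component I W v i))"
  unfolding extend_sum_def
proof (rule sum.mono_neutral_left[OF assms(3,4)], rule ballI)
  fix i assume "i \<in> F - {i. component I W v i \<noteq> 0}"
  then have "component I W v i = 0" "i \<in> I" using assms(5) by auto
  then show "f i (component I W v i) = 0" by (simp add: linear_0[OF assms(1)])
qed

lemma extend_sum_homogeneous:
  assumes "is_direct_sum s1 I W" "i \<in> I" "v \<in> W i" "Vector_Spaces.linear s1 s2 (f i)"
  shows "extend_sum I W f v = f i v"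
proof -
  have "{j. (if j = i then v else 0) \<noteq> 0} = (if v = 0 then {} else {i})" by auto
  then show ?thesis
    unfolding extend_sum_def V1.component_homogeneous[OF assms(1-3)]
    using linear_0[OF assms(4)] by auto
qed

lemma linear_extend_sum:
  assumes lin: "\<And>i. i \<in> I \<Longrightarrow> Vector_Spaces.linear s1 s2 (f i)"
    and ds: "is_direct_sum s1 I W"
  shows "Vector_Spaces.linear s1 s2 (extend_sum I W f)"
proof -
  have supp: "finite {i. component I W v i \<noteq> 0}" "{i. component I W v i \<noteq> 0} \<subseteq> I" for v
    using is_decomp_component[OF ds, of v] unfolding is_decomp_def by auto
  have "extend_sum I W f (v + w) = extend_sum I W f v + extend_sum I W f w" for v w
  proof -
    let ?F = "{i. component I W v i \<noteq> 0} \<union> {i. component I W w i \<noteq> 0}"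
    have fin: "finite ?F" "?F \<subseteq> I" using supp by auto
    have "extend_sum I W f x = (\<Sum>i\<in>?F. f i (component I W x i))"
      if "x \<in> {v, w, v + w}" for x
      using that by (intro extend_sum_superset[OF lin ds fin(1) _ fin(2)])
        (auto simp: V1.component_add[OF ds])
    then show ?thesis
      using fin(2) by (auto simp: V1.component_add[OF ds] linear_add[OF lin] subset_iff
          simp flip: sum.distrib intro!: sum.cong)
  qed
  moreover have "extend_sum I W f (s1 k v) = s2 k (extend_sum I W f v)" for k v
  proof -
    let ?F = "{i. component I W v i \<noteq> 0}"
    have "extend_sum I W f x = (\<Sum>i\<in>?F. f i (component I W x i))"
      if "x \<in> {v, s1 k v}" for x
      using that by (intro extend_sum_superset[OF lin ds supp(1) _ supp(2)])
        (auto simp: V1.component_scale[OF ds])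
    then show ?thesis
      using supp(2)[of v] by (auto simp: V1.component_scale[OF ds] linear_scale[OF lin] subset_iff
          V2.scale_sum_right intro!: sum.cong)
  qed
  ultimately show ?thesis
    by (simp add: Vector_Spaces.linear_iff V1.vector_space_axioms V2.vector_space_axioms)
qed

end


section \<open>Eigenspaces of operators of finite order\<close>

definition unity_root :: "nat \<Rightarrow> nat \<Rightarrow> complex" where
  "unity_root T r = exp (2 * of_real pi * \<i> * of_nat r / of_nat T)"

lemma unity_root_cis: "unity_root T r = cis (2 * pi * real r / real T)"
  by (simp add: unity_root_def cis_conv_exp mult_ac)

lemma unity_root_nonzero [simp]: "unity_root T r \<noteq> 0"
  by (simp add: unity_root_def)

lemma unity_root_0 [simp]: "unity_root T 0 = 1"
  by (simp add: unity_root_def)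

lemma unity_root_power: "T \<ge> 1 \<Longrightarrow> unity_root T r ^ T = 1"
  using bij_betw_roots_unity[of T] by (auto simp: unity_root_cis DeMoivre)

lemma unity_root_add: "unity_root T (p + q) = unity_root T p * unity_root T q"
  by (simp add: unity_root_def add_divide_distrib ring_distribs flip: exp_add)

lemma unity_root_mod:
  assumes "T \<ge> 1"
  shows "unity_root T (r mod T) = unity_root T r"
proof -
  have "unity_root T (T * k) = 1" for k
    using assms cis_multiple_2pi[of "real k"] by (simp add: unity_root_cis mult_ac)
  then show ?thesis
    by (metis div_mult_mod_eq mult.commute mult_1 unity_root_add)
qed

lemma unity_root_inj:
  assumes "r < T" "s < T" "unity_root T r = unity_root T s"
  shows "r = s"
  using bij_betw_imp_inj_on[OF bij_betw_roots_unity[of T]] assms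
  by (auto simp: unity_root_cis inj_on_def)

text \<open>Geometric sum of a T-th root of unity: orthogonality of the characters of Z/T.\<close>

lemma sum_unity_root:
  assumes "r < T" "s < T"
  shows "(\<Sum>k<T. (unity_root T s / unity_root T r) ^ k) = (if r = s then of_nat T else 0)"
proof (cases "r = s")
  case False
  let ?z = "unity_root T s / unity_root T r"
  have "?z \<noteq> 1" using unity_root_inj assms False by auto
  moreover have "?z ^ T = 1"
    using assms by (simp add: power_divide unity_root_power)
  ultimately show ?thesis using False by (simp add: geometric_sum)
qed simp

context complex_space
begin

text \<open>Fourier projection onto the eigenvalue \<open>unity_root T r\<close>, for the action of
  Z/T through the powers of g.\<close>

definition eigen_proj :: "nat \<Rightarrow> ('a \<Rightarrow> 'a) \<Rightarrow> nat \<Rightarrow> 'a \<Rightarrow> 'a" where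
  "eigen_proj T g r v = scale (1 / of_nat T) (\<Sum>k<T. scale (inverse (unity_root T r) ^ k) ((g ^^ k) v))"

context
  fixes T :: nat and g :: "'a \<Rightarrow> 'a"
  assumes T: "T \<ge> 1" and g: "Vector_Spaces.linear scale scale g" and gT: "g ^^ T = id"
begin

lemma operator_add: "g (v + w) = g v + g w" and operator_scale: "g (scale c v) = scale c (g v)" and operator_0: "g 0 = 0"
  using g unfolding Vector_Spaces.linear_iff by (blast, blast) (metis add_cancel_right_right g Vector_Spaces.linear_iff)

lemma operator_sum: "g (sum f F) = (\<Sum>x\<in>F. g (f x))"
  by (induction F rule: infinite_finite_induct) (auto simp: operator_add operator_0)

lemma operator_funpow_add: "(g ^^ k) (v + w) = (g ^^ k) v + (g ^^ k) w"
  by (induction k) (auto simp: operator_add)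

lemma eigen_proj_add: "eigen_proj T g r (v + w) = eigen_proj T g r v + eigen_proj T g r w"
  by (simp add: eigen_proj_def operator_funpow_add scale_right_distrib sum.distrib)

lemma eigen_proj_0: "eigen_proj T g r 0 = 0"
  using eigen_proj_add[of r 0 0] by simp

lemma eigen_proj_eigen: "g (eigen_proj T g r v) = scale (unity_root T r) (eigen_proj T g r v)"
proof -
  let ?x = "inverse (unity_root T r)"
  let ?f = "\<lambda>k. scale (?x ^ k) ((g ^^ k) v)"
  have cancel: "unity_root T r * (?x * y) = y" for y
    by (metis mult.assoc mult_1 right_inverse unity_root_nonzero)
  have "g (\<Sum>k<T. ?f k) = (\<Sum>k<T. scale (unity_root T r) (?f (Suc k)))"
    by (simp add: operator_sum operator_scale cancel)
  also have "\<dots> = scale (unity_root T r) (\<Sum>k<T. ?f (Suc k))"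
    by (simp add: scale_sum_right)
  \<comment> \<open>Cyclic shift of the index: the terms for k = T and k = 0 agree, since
    \<open>g ^^ T\<close> and the T-th power of the root are both trivial.\<close>
  also have "(\<Sum>k<T. ?f (Suc k)) = (\<Sum>k<T. ?f k)"
  proof -
    have "?f 0 + (\<Sum>k<T. ?f (Suc k)) = (\<Sum>k<T. ?f k) + ?f T"
      using sum.lessThan_Suc_shift[of ?f T] sum.lessThan_Suc[of ?f T] by (rule trans[OF sym])
    moreover have "?f T = ?f 0"
      using T gT by (simp add: power_inverse unity_root_power)
    ultimately show ?thesis by simp
  qed
  finally show ?thesis
    by (simp add: eigen_proj_def operator_scale mult.commute)
qed

lemma operator_funpow_eigen:
  assumes "g v = scale (unity_root T s) v"
  shows "(g ^^ k) v = scale (unity_root T s ^ k) v"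
  by (induction k) (auto simp: operator_scale assms mult.commute)

lemma eigen_proj_on:
  assumes "r < T" "s < T" "g v = scale (unity_root T s) v"
  shows "eigen_proj T g r v = (if r = s then v else 0)"
proof -
  have "(\<Sum>k<T. scale (inverse (unity_root T r) ^ k) ((g ^^ k) v))
      = scale (\<Sum>k<T. (unity_root T s / unity_root T r) ^ k) v"
    by (simp add: operator_funpow_eigen[OF assms(3)] scale_sum_left divide_inverse power_mult_distrib mult.commute)
  then show ?thesis
    using T by (simp add: eigen_proj_def sum_unity_root[OF assms(1,2)])
qed

lemma eigen_proj_sum: "(\<Sum>r<T. eigen_proj T g r v) = v"
proof -
  \<comment> \<open>Exchanging the roles of r and k turns the sum over r into the orthogonality
    relation with index 0, so only k = 0 survives.\<close>
  have z: "inverse (unity_root T r) ^ k = (unity_root T 0 / unity_root T k) ^ r" for r k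
  proof -
    have "unity_root T r ^ k = unity_root T (r * k)" for r k
      by (induction k) (auto simp: unity_root_add add.commute)
    then show ?thesis by (simp add: power_inverse power_divide divide_inverse mult.commute)
  qed
  have "(\<Sum>r<T. eigen_proj T g r v)
      = scale (1 / of_nat T) (\<Sum>k<T. \<Sum>r<T. scale (inverse (unity_root T r) ^ k) ((g ^^ k) v))"
    unfolding eigen_proj_def by (subst sum.swap) (simp add: scale_sum_right)
  also have "(\<Sum>k<T. \<Sum>r<T. scale (inverse (unity_root T r) ^ k) ((g ^^ k) v))
      = (\<Sum>k<T. scale (\<Sum>r<T. (unity_root T 0 / unity_root T k) ^ r) ((g ^^ k) v))"
    unfolding z by (simp add: scale_sum_left)
  also have "\<dots> = (\<Sum>k<T. if k = 0 then scale (of_nat T) v else 0)"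
    by (rule sum.cong[OF refl], subst sum_unity_root) (use T in auto)
  also have "\<dots> = scale (of_nat T) v"
    using T by simp
  finally show ?thesis using T by simp
qed

lemma eigen_proj_closed:
  assumes W: "subspace W" "\<And>v. v \<in> W \<Longrightarrow> g v \<in> W" and "v \<in> W"
  shows "eigen_proj T g r v \<in> W"
proof -
  have "(g ^^ k) v \<in> W" for k by (induction k) (auto simp: assms)
  then show ?thesis
    unfolding eigen_proj_def by (intro subspace_scale subspace_sum W(1)) auto
qed

text \<open>The projections are the eigenprojections of the components. An arbitrary direct sum is
  allowed so that the step can be iterated: the weights are refined by \<open>g1\<close>, and the
  result by \<open>g2\<close>.\<close>

lemma direct_sum_refine_eigen:
  assumes ds: "is_direct_sum scale I W" and inv: "\<And>i v. i \<in> I \<Longrightarrow> v \<in> W i \<Longrightarrow> g v \<in> W i"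
  shows "is_direct_sum scale (I \<times> {..<T}) (\<lambda>(i, r). W i \<inter> {v. g v = scale (unity_root T r) v})"
proof (rule direct_sum_projectionsI[where P = "\<lambda>(i, r) v. eigen_proj T g r (component I W v i)"])
  have W: "subspace (W i)" if "i \<in> I" for i
    using ds that unfolding is_direct_sum_def by blast
  have "subspace {v. g v = scale (unity_root T r) v}" for r
    by (rule subspaceI) (auto simp: operator_0 operator_add operator_scale scale_right_distrib mult.commute)
  then show "subspace ((\<lambda>(i, r). W i \<inter> {v. g v = scale (unity_root T r) v}) i)" if "i \<in> I \<times> {..<T}" for i
    using that by (auto intro!: subspace_inter W)
  show "(\<lambda>(i, r) v. eigen_proj T g r (component I W v i)) i v
      \<in> (\<lambda>(i, r). W i \<inter> {v. g v = scale (unity_root T r) v}) i" if "i \<in> I \<times> {..<T}" for i v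
    using that is_decomp_component[OF ds, of v]
    by (auto simp: eigen_proj_eigen is_decomp_def intro!: eigen_proj_closed W inv)
  show "(\<lambda>(i, r) v. eigen_proj T g r (component I W v i)) i 0 = 0" if "i \<in> I \<times> {..<T}" for i
    using component_scale[OF ds, of 0 0] by (auto simp: eigen_proj_0 split: prod.splits)
  show "(\<lambda>(i, r) v. eigen_proj T g r (component I W v i)) i (v + w) =
    (\<lambda>(i, r) v. eigen_proj T g r (component I W v i)) i v +
    (\<lambda>(i, r) v. eigen_proj T g r (component I W v i)) i w" for i v w
    by (auto simp: component_add[OF ds] eigen_proj_add split: prod.splits)
  show "(\<lambda>(i, r) v. eigen_proj T g r (component I W v i)) i v = (if i = j then v else 0)"
    if "i \<in> I \<times> {..<T}" "j \<in> I \<times> {..<T}" "v \<in> (\<lambda>(i, r). W i \<inter> {v. g v = scale (unity_root T r) v}) j"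
    for i j v
  proof -
    obtain a r b s where ij: "i = (a, r)" "j = (b, s)" "a \<in> I" "b \<in> I" "r < T" "s < T"
      using \<open>i \<in> _\<close> \<open>j \<in> _\<close> by auto
    then have "v \<in> W b" and v: "g v = scale (unity_root T s) v" using \<open>v \<in> _\<close> by auto
    with ij show ?thesis
      by (cases "a = b") (auto simp: component_homogeneous[OF ds] eigen_proj_0 eigen_proj_on[OF _ _ v])
  qed
  show "\<exists>F. finite F \<and> F \<subseteq> I \<times> {..<T}
      \<and> (\<forall>i\<in>I \<times> {..<T} - F. (\<lambda>(i, r) v. eigen_proj T g r (component I W v i)) i v = 0)
      \<and> v = (\<Sum>i\<in>F. (\<lambda>(i, r) v. eigen_proj T g r (component I W v i)) i v)" for v
  proof (intro exI conjI)
    let ?S = "{i. component I W v i \<noteq> 0}"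
    have S: "finite ?S" "?S \<subseteq> I" "v = (\<Sum>i\<in>?S. component I W v i)"
      using is_decomp_component[OF ds, of v] unfolding is_decomp_def by auto
    show "finite (?S \<times> {..<T})" "?S \<times> {..<T} \<subseteq> I \<times> {..<T}" using S by auto
    show "\<forall>i\<in>I \<times> {..<T} - ?S \<times> {..<T}. (\<lambda>(i, r) v. eigen_proj T g r (component I W v i)) i v = 0"
      by (auto simp: eigen_proj_0)
    have "(\<Sum>i\<in>?S \<times> {..<T}. (\<lambda>(i, r) v. eigen_proj T g r (component I W v i)) i v)
        = (\<Sum>i\<in>?S. \<Sum>r<T. eigen_proj T g r (component I W v i))"
      by (simp add: sum.cartesian_product split_beta)
    then show "v = (\<Sum>i\<in>?S \<times> {..<T}. (\<lambda>(i, r) v. eigen_proj T g r (component I W v i)) i v)"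
      using S(3) by (simp add: eigen_proj_sum)
  qed
qed

end

text \<open>Turns the nested indices ((n, p), q) of an iterated refinement into the triples (n, p,
  q) of \<open>trigr_index\<close>.\<close>

lemma direct_sum_reindex:
  assumes ds: "is_direct_sum scale I W" and h: "bij_betw h K I"
  shows "is_direct_sum scale K (W \<circ> h)"
proof (rule direct_sum_projectionsI[where P = "\<lambda>k v. component I W v (h k)"])
  have hK: "h k \<in> I" if "k \<in> K" for k using that h by (auto simp: bij_betw_def)
  show "subspace ((W \<circ> h) k)" if "k \<in> K" for k
    using hK[OF that] ds unfolding is_direct_sum_def by auto
  show "component I W v (h k) \<in> (W \<circ> h) k" if "k \<in> K" for k v
    using hK[OF that] is_decomp_component[OF ds, of v] unfolding is_decomp_def by auto
  show "component I W 0 (h k) = 0" for k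
    using component_scale[OF ds, of 0 0] by simp
  show "component I W (v + w) (h k) = component I W v (h k) + component I W w (h k)" for k v w
    by (simp add: component_add[OF ds])
  show "component I W v (h i) = (if i = j then v else 0)"
    if "i \<in> K" "j \<in> K" "v \<in> (W \<circ> h) j" for i j v
  proof -
    have "component I W v = (\<lambda>l. if l = h j then v else 0)"
      using that hK by (intro component_homogeneous[OF ds]) auto
    then show ?thesis using that h by (auto simp: bij_betw_def inj_on_def)
  qed
  show "\<exists>F. finite F \<and> F \<subseteq> K \<and> (\<forall>k\<in>K - F. component I W v (h k) = 0)
      \<and> v = (\<Sum>k\<in>F. component I W v (h k))" for v
  proof (intro exI conjI)
    let ?S = "{i. component I W v i \<noteq> 0}"
    let ?F = "{k \<in> K. component I W v (h k) \<noteq> 0}"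
    have S: "finite ?S" "?S \<subseteq> I" "v = (\<Sum>i\<in>?S. component I W v i)"
      using is_decomp_component[OF ds, of v] unfolding is_decomp_def by auto
    have inj: "inj_on h ?F" using h by (auto simp: bij_betw_def inj_on_def)
    have img: "h ` ?F = ?S" using S(2) h by (auto simp: bij_betw_def image_iff)
    show "finite ?F" using finite_imageD[OF _ inj] S(1) img by simp
    show "v = (\<Sum>k\<in>?F. component I W v (h k))"
      using S(3) img sum.reindex[OF inj, of "component I W v"] by simp
  qed auto
qed

end


section \<open>Grading and eigenspaces of a vertex operator algebra\<close>

lemma eigen_iff: "v \<in> eigen V T g r \<longleftrightarrow> g v = vscale V (unity_root T r) v"
  by (simp add: eigen_def unity_root_def)

lemma Sum_any_eq_sum:
  fixes f :: "nat \<Rightarrow> 'a::comm_monoid_add"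
  assumes "\<And>i. i \<ge> N \<Longrightarrow> f i = 0"
  shows "Sum_any f = sum f {..<N}"
  by (rule Sum_any.expand_superset) (use assms not_less in auto)

context vertex_operator_algebra
begin

sublocale complex_space "vscale V" ..

lemma mode_add_left: "vmode V (u + u') n v = vmode V u n v + vmode V u' n v"
  and mode_scale_left: "vmode V (vscale V c u) n v = vscale V c (vmode V u n v)"
  and mode_add_right: "vmode V u n (v + v') = vmode V u n v + vmode V u n v'"
  and mode_scale_right: "vmode V u n (vscale V c v) = vscale V c (vmode V u n v)"
  using mode_linear_left[of n v] mode_linear_right[of u n]
  unfolding Vector_Spaces.linear_iff by blast+

lemma mode_0_left [simp]: "vmode V 0 n v = 0"
  and mode_0_right [simp]: "vmode V u n 0 = 0"
  using mode_scale_left[of 0 0 n v] mode_scale_right[of u n 0 0] by simp_all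

lemma weight_subspace: "subspace (vgr V n)"
  using gr_direct_sum unfolding is_direct_sum_def by blast

lemma L0_add: "Lop V 0 (u + v) = Lop V 0 u + Lop V 0 v"
  by (simp add: Lop_def mode_add_right)

text \<open>L(0) multiplies the k-th component by k, so for an eigenvector with eigenvalue n the
  k-th component is annihilated by k - n. Recognising weights by L(0) makes them computable from
  commutators and visibly preserved by automorphisms, which fix \<omega>.\<close>

lemma weight_iff: "v \<in> vgr V n \<longleftrightarrow> Lop V 0 v = vscale V (of_int n) v"
proof
  assume v: "Lop V 0 v = vscale V (of_int n) v"
  let ?c = "component UNIV (vgr V) v"
  have c: "is_decomp UNIV (vgr V) v ?c"
    by (rule is_decomp_component[OF gr_direct_sum])
  have comp: "component UNIV (vgr V) (Lop V 0 v) k = vscale V (of_int k) (?c k)" for k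
  proof -
    have "component UNIV (vgr V) (Lop V 0 x) k = vscale V (of_int k) (component UNIV (vgr V) x k)" for x
    proof (induction x rule: direct_sum_induct[OF gr_direct_sum])
      case 1
      show ?case using component_scale[OF gr_direct_sum, of 0 0] by (simp add: Lop_def)
    next
      case (2 v w)
      then show ?case by (simp add: L0_add component_add[OF gr_direct_sum] scale_right_distrib)
    next
      case (3 i v)
      then show ?case
        by (simp add: L0_weight component_scale[OF gr_direct_sum] component_homogeneous[OF gr_direct_sum])
    qed
    then show ?thesis .
  qed
  have "?c k = 0" if "k \<noteq> n" for k
  proof -
    have "vscale V (of_int k) (?c k) = vscale V (of_int n) (?c k)"
      using comp[of k] unfolding v component_scale[OF gr_direct_sum] by (rule sym)
    then show ?thesis using that by auto
  qed
  then have "{i. ?c i \<noteq> 0} \<subseteq> {n}" by auto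
  moreover have "sum ?c {i. ?c i \<noteq> 0} = sum ?c {n}"
    by (rule sum.mono_neutral_left) (use calculation in auto)
  moreover have "v = sum ?c {i. ?c i \<noteq> 0}" "?c n \<in> vgr V n"
    using c unfolding is_decomp_def by blast+
  ultimately have "v = ?c n" "?c n \<in> vgr V n" by simp_all
  then show "v \<in> vgr V n" by metis
qed (rule L0_weight)

text \<open>For l = 0 the binomials \<open>0 gchoose i\<close> kill all but the first term of both
  sums on the left of the Jacobi identity; this is its residue in z0.\<close>

lemma commutator:
  "vmode V u m (vmode V v n w) - vmode V v n (vmode V u m w)
    = Sum_any (\<lambda>i. vscale V (of_int m gchoose i) (vmode V (vmode V u (int i) v) (m + n - int i) w))"
proof -
  have "Sum_any (\<lambda>i::nat. vscale V (c i * (0 gchoose i)) (f i)) = vscale V (c 0) (f 0)" for c f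
  proof -
    have "Sum_any (\<lambda>i::nat. vscale V (c i * (0 gchoose i)) (f i))
        = (\<Sum>i<1. vscale V (c i * (0 gchoose i)) (f i))"
      by (rule Sum_any_eq_sum) (auto simp: gbinomial_0_left)
    then show ?thesis by simp
  qed
  from this[of "\<lambda>i. (- 1) ^ i"] this[of "\<lambda>i. (- 1) powi (- int i)"] show ?thesis
    using jacobi[where l = 0 and u = u and v = v and m = m and n = n and w = w] by simp
qed

text \<open>The commutator of L(0), the mode 1 of \<omega>, with u_k has only the terms i = 0, 1,
  namely (L(-1)u)_{k+1} + (L(0)u)_k, which add up to (m - k - 1) u_k.\<close>

lemma weight_mode:
  assumes u: "u \<in> vgr V m" and v: "v \<in> vgr V n"
  shows "vmode V u k v \<in> vgr V (m + n - k - 1)"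
proof -
  have "Lop V 0 (vmode V u k v) - vmode V u k (Lop V 0 v)
      = Sum_any (\<lambda>i. vscale V (1 gchoose i) (vmode V (vmode V (vconf V) (int i) u) (1 + k - int i) v))"
    using commutator[of "vconf V" 1 u k v] by (simp add: Lop_def)
  also have "\<dots> = (\<Sum>i<2. vscale V (1 gchoose i) (vmode V (vmode V (vconf V) (int i) u) (1 + k - int i) v))"
  proof (rule Sum_any_eq_sum)
    fix i :: nat assume "i \<ge> 2"
    then have "(1 :: complex) gchoose i = 0"
      using binomial_gbinomial[of 1 i, where 'a = complex] by (simp add: binomial_eq_0)
    then show "vscale V (1 gchoose i) (vmode V (vmode V (vconf V) (int i) u) (1 + k - int i) v) = 0"
      by simp
  qed
  also have "\<dots> = vmode V (Lop V (-1) u) (1 + k) v + vmode V (Lop V 0 u) k v"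
    by (simp add: Lop_def numeral_2_eq_2)
  also have "\<dots> = vscale V (of_int (m - k - 1)) (vmode V u k v)"
    by (simp add: L_minus_1_derivative L0_weight[OF u] mode_scale_left
        scale_left_diff_distrib scale_left_distrib)
  finally show ?thesis
    by (simp add: weight_iff L0_weight[OF v] mode_scale_right diff_eq_eq flip: scale_left_distrib)
qed

lemma weight_L_minus_1: "v \<in> vgr V n \<Longrightarrow> Lop V (-1) v \<in> vgr V (n + 1)"
  using weight_mode[OF conf_weight, of v n 0] by (simp add: Lop_def add.commute)

lemma L_minus_1_creation: "Lop V (-1) u = vmode V u (-2) (vvac V)"
  using L_minus_1_derivative[of u "-1" "vvac V"] by (simp add: creation)

text \<open>This is Y(v,z)u = e^{zL(-1)} Y(u,-z)v, with e^{zL(-1)}y written as Y(y,z)1. It is the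
  Jacobi identity on the vacuum with m = -1 and n = 0: creation removes the first sum and leaves one
  term of the second, and the inner signs are (-1 choose i).\<close>

lemma skew_symmetry:
  "vmode V v l u
    = vscale V (- ((- 1) powi l)) (Sum_any (\<lambda>i. vscale V ((- 1) ^ i) (vmode V (vmode V u (l + int i) v) (- 1 - int i) (vvac V))))"
proof -
  let ?w = "vvac V"
  have minus_1: "(-1 :: complex) gchoose i = (- 1) ^ i" for i
    using gbinomial_minus[of "1 :: complex" i] by (simp add: binomial_gbinomial[symmetric])
  have 1: "Sum_any (\<lambda>i::nat. vscale V ((- 1) ^ i * (of_int l gchoose i))
        (vmode V u (- 1 + l - int i) (vmode V v (0 + int i) ?w))) = 0"
    by (simp add: creation)
  have "Sum_any (\<lambda>i::nat. vscale V ((- 1) powi (l - int i) * (of_int l gchoose i))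
        (vmode V v (0 + l - int i) (vmode V u (- 1 + int i) ?w)))
     = (\<Sum>i<1. vscale V ((- 1) powi (l - int i) * (of_int l gchoose i))
        (vmode V v (0 + l - int i) (vmode V u (- 1 + int i) ?w)))"
    by (rule Sum_any_eq_sum) (simp add: creation)
  also have "\<dots> = vscale V ((- 1) powi l) (vmode V v l u)"
    by (simp add: creation)
  finally have "- vscale V ((- 1) powi l) (vmode V v l u)
     = Sum_any (\<lambda>i. vscale V ((- 1) ^ i) (vmode V (vmode V u (l + int i) v) (- 1 - int i) ?w))"
    using jacobi[where l = l and u = u and v = v and m = "-1" and n = 0 and w = ?w] 1
    by (simp add: minus_1)
  moreover have "vscale V ((- 1) powi l) (vscale V ((- 1) powi l) x) = x" for x
    by (simp flip: power_int_mult_distrib)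
  ultimately show ?thesis
    by (metis scale_minus_left scale_minus_right minus_minus)
qed

end

section \<open>Automorphisms of finite order and the joint grading\<close>

locale voa_finite_automorphism = vertex_operator_algebra V
  for V :: "'v::ab_group_add voa" +
  fixes T :: nat and g :: "'v \<Rightarrow> 'v"
  assumes period_pos: "T \<ge> 1" and voa_auto: "voa_automorphism V g" and period: "g ^^ T = id"
begin

lemma auto_linear: "Vector_Spaces.linear (vscale V) (vscale V) g"
  using voa_auto by (simp add: voa_automorphism_def)

lemma auto_mode: "g (vmode V u n v) = vmode V (g u) n (g v)"
proof -
  have "(g \<circ> vmode V u n \<circ> inv_into UNIV g) (g v) = vmode V (g u) n (g v)"
    using voa_auto by (simp add: voa_automorphism_def)
  then show ?thesis
    using voa_auto by (simp add: voa_automorphism_def bij_def)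
qed

lemma auto_conf: "g (vconf V) = vconf V"
  using voa_auto by (simp add: voa_automorphism_def)

lemma auto_scale: "g (vscale V c v) = vscale V c (g v)"
  using auto_linear unfolding Vector_Spaces.linear_iff by blast

text \<open>Compatibility with modes forces this: applying g to the mode -1 of the vacuum acting on
  the preimage of the vacuum gives the vacuum on one side and g(1)_{-1} 1 = g(1) on the
  other.\<close>

lemma auto_vac: "g (vvac V) = vvac V"
  using auto_mode[of "vvac V" "-1" "inv_into UNIV g (vvac V)"] voa_auto creation(1)[of "g (vvac V)"]
  by (simp add: vacuum voa_automorphism_def bij_def surj_f_inv_f)

lemma eigen_mode:
  assumes "u \<in> eigen V T g p" "v \<in> eigen V T g q"
  shows "vmode V u n v \<in> eigen V T g ((p + q) mod T)"
  using assms period_pos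
  by (simp add: eigen_iff auto_mode mode_scale_left mode_scale_right unity_root_mod unity_root_add
      mult.commute)

lemma eigen_L_minus_1: "v \<in> eigen V T g p \<Longrightarrow> Lop V (-1) v \<in> eigen V T g p"
  by (simp add: eigen_iff Lop_def auto_mode auto_conf mode_scale_right)

lemma auto_weight: "v \<in> vgr V n \<Longrightarrow> g v \<in> vgr V n"
  by (metis Lop_def auto_conf auto_mode auto_scale weight_iff)

lemma bigr_direct_sum: "is_direct_sum (vscale V) (bigr_index T) (bigr V T g)"
proof -
  have "bigr V T g = (\<lambda>(i, r). vgr V i \<inter> {v. g v = vscale V (unity_root T r) v})"
    by (auto simp: bigr_def eigen_iff fun_eq_iff)
  then show ?thesis
    unfolding bigr_index_def
    using direct_sum_refine_eigen[OF period_pos auto_linear period gr_direct_sum auto_weight] by simp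
qed

end

locale voa_automorphism_pair =
  G1: voa_finite_automorphism V T g1 + G2: voa_finite_automorphism V T g2
  for V :: "'v::ab_group_add voa" and T :: nat and g1 g2 :: "'v \<Rightarrow> 'v" +
  assumes commute: "g1 \<circ> g2 = g2 \<circ> g1"
begin

text \<open>Since g1 and g2 commute, g2 preserves the eigenspaces of g1, so the decomposition for g1
  can be refined by g2.\<close>

lemma trigr_direct_sum: "is_direct_sum (vscale V) (trigr_index T) (trigr V T g1 g2)"
proof -
  have inv: "g2 v \<in> bigr V T g1 i" if "v \<in> bigr V T g1 i" for i v
  proof -
    have "g1 (g2 v) = g2 (g1 v)" using fun_cong[OF commute, of v] by simp
    with that show ?thesis
      by (auto simp: bigr_def eigen_iff G2.auto_weight G2.auto_scale)
  qed
  have "is_direct_sum (vscale V) (bigr_index T \<times> {..<T})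
      (\<lambda>(i, r). bigr V T g1 i \<inter> {v. g2 v = vscale V (unity_root T r) v})"
    by (rule G1.direct_sum_refine_eigen[OF G2.period_pos G2.auto_linear G2.period G1.bigr_direct_sum inv])
  moreover have "bij_betw (\<lambda>(n, p, q). ((n, p), q)) (trigr_index T) (bigr_index T \<times> {..<T})"
    by (rule bij_betwI[where g = "\<lambda>((n, p), q). (n, p, q)"])
      (auto simp: trigr_index_def bigr_index_def)
  ultimately have "is_direct_sum (vscale V) (trigr_index T)
      ((\<lambda>(i, r). bigr V T g1 i \<inter> {v. g2 v = vscale V (unity_root T r) v}) \<circ> (\<lambda>(n, p, q). ((n, p), q)))"
    by (rule G1.direct_sum_reindex)
  moreover have "(\<lambda>(i, r). bigr V T g1 i \<inter> {v. g2 v = vscale V (unity_root T r) v}) \<circ> (\<lambda>(n, p, q). ((n, p), q))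
      = trigr V T g1 g2"
    by (auto simp: fun_eq_iff bigr_def trigr_def eigen_iff)
  ultimately show ?thesis by simp
qed

lemma trigr_mode:
  assumes "u \<in> trigr V T g1 g2 (m, p, q)" "v \<in> trigr V T g1 g2 (n, p', q')"
  shows "vmode V u k v \<in> trigr V T g1 g2 (m + n - k - 1, (p + p') mod T, (q + q') mod T)"
  using assms G1.weight_mode G1.eigen_mode G2.eigen_mode by (simp add: trigr_def)

lemma trigr_L_minus_1:
  "u \<in> trigr V T g1 g2 (n, p, q) \<Longrightarrow> Lop V (-1) u \<in> trigr V T g1 g2 (n + 1, p, q)"
  using G1.weight_L_minus_1 G1.eigen_L_minus_1 G2.eigen_L_minus_1 by (simp add: trigr_def)

lemma comp_automorphism: "voa_finite_automorphism V T (g1 \<circ> g2)"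
proof
  have g: "voa_automorphism V g1" "voa_automorphism V g2" by (fact G1.voa_auto G2.voa_auto)+
  show "voa_automorphism V (g1 \<circ> g2)"
    unfolding voa_automorphism_def
  proof (intro conjI allI)
    show "Vector_Spaces.linear (vscale V) (vscale V) (g1 \<circ> g2)"
      using G1.auto_linear G2.auto_linear by (rule Vector_Spaces.linear_compose[rotated])
    show bij: "bij (g1 \<circ> g2)" using g by (auto simp: voa_automorphism_def intro: bij_comp)
    show "g1 \<circ> g2 \<circ> vmode V u n \<circ> inv_into UNIV (g1 \<circ> g2) = vmode V ((g1 \<circ> g2) u) n" for u n
    proof
      fix v
      obtain w where "v = (g1 \<circ> g2) w" using bij by (metis bij_pointE)
      moreover have "inv_into UNIV (g1 \<circ> g2) ((g1 \<circ> g2) w) = w" by (rule inv_f_f) (use bij in \<open>simp add: bij_def\<close>)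
      ultimately show "(g1 \<circ> g2 \<circ> vmode V u n \<circ> inv_into UNIV (g1 \<circ> g2)) v = vmode V ((g1 \<circ> g2) u) n v"
        by (simp add: G1.auto_mode G2.auto_mode)
    qed
    show "(g1 \<circ> g2) (vconf V) = vconf V" by (simp add: G1.auto_conf G2.auto_conf)
  qed
  \<comment> \<open>Commutation separates the powers, so the period T of the factors is a period of
    the product.\<close>
  have "(g1 \<circ> g2) ^^ k = g1 ^^ k \<circ> g2 ^^ k" for k
  proof (induction k)
    case (Suc k)
    have "g2 \<circ> g1 ^^ k = g1 ^^ k \<circ> g2"
      by (induction k) (auto simp: fun_eq_iff, metis commute comp_apply)
    with Suc show ?case by (metis comp_assoc funpow.simps(2))
  qed simp
  then show "(g1 \<circ> g2) ^^ T = id" by (simp add: G1.period G2.period)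
qed (rule G1.period_pos)

end

lemma voa_finite_automorphism_id:
  assumes "vertex_operator_algebra V" "T \<ge> 1"
  shows "voa_finite_automorphism V T id"
proof -
  interpret vertex_operator_algebra V by fact
  show ?thesis
    by unfold_locales
      (use assms(2) in \<open>auto simp: voa_automorphism_def linear_id simp flip: id_def\<close>)
qed


section \<open>Residues of vertex operators\<close>

lemma gbinomial_revision_Vandermonde:
  fixes a c :: "'a::field_char_0"
  shows "(\<Sum>x\<le>k. (a gchoose x) * (c gchoose (k - x)) * (of_nat x gchoose t))
    = (if t \<le> k then (a gchoose t) * ((a + c - of_nat t) gchoose (k - t)) else 0)"
proof (cases "t \<le> k")
  case True
  have "(\<Sum>x\<le>k. (a gchoose x) * (c gchoose (k - x)) * (of_nat x gchoose t))
      = (\<Sum>x\<in>{t..k}. (a gchoose x) * (c gchoose (k - x)) * (of_nat x gchoose t))"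
    by (rule sum.mono_neutral_right) (auto simp flip: binomial_gbinomial)
  also have "\<dots> = (\<Sum>y\<in>{0..k - t}. (a gchoose (y + t)) * (c gchoose (k - (y + t))) * (of_nat (y + t) gchoose t))"
    using sum.shift_bounds_cl_nat_ivl[of "\<lambda>x. (a gchoose x) * (c gchoose (k - x)) * (of_nat x gchoose t)" 0 t "k - t"]
      True by simp
  \<comment> \<open>Trinomial revision pulls out (a choose t) and leaves a Vandermonde sum in
    y.\<close>
  also have "\<dots> = (\<Sum>y\<in>{0..k - t}. (a gchoose t) * ((a - of_nat t gchoose y) * (c gchoose (k - t - y))))"
  proof (rule sum.cong[OF refl])
    fix y
    have "(a gchoose (y + t)) * (of_nat (y + t) gchoose t) = (a gchoose t) * (a - of_nat t gchoose y)"
      using gbinomial_trinomial_revision[of t "y + t" a] by simp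
    moreover have "k - (y + t) = k - t - y" by simp
    moreover have "A * B * C = (A * C) * B" for A B C :: 'a by (simp only: mult_ac)
    ultimately show "(a gchoose (y + t)) * (c gchoose (k - (y + t))) * (of_nat (y + t) gchoose t)
        = (a gchoose t) * ((a - of_nat t gchoose y) * (c gchoose (k - t - y)))"
      by (metis mult.assoc)
  qed
  also have "\<dots> = (a gchoose t) * ((a - of_nat t + c) gchoose (k - t))"
    unfolding sum_distrib_left[symmetric] gbinomial_Vandermonde ..
  finally show ?thesis using True by (simp add: algebra_simps)
qed (auto simp flip: binomial_gbinomial intro!: sum.neutral)

lemma gbinomial_convolution:
  fixes a b c :: "'a::field_char_0"
  shows "(\<Sum>x\<le>k. (a gchoose x) * (c gchoose (k - x)) * ((b + of_nat x) gchoose s))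
    = (\<Sum>t\<le>s. if t \<le> k then (a gchoose t) * (b gchoose (s - t)) * ((a + c - of_nat t) gchoose (k - t)) else 0)"
proof -
  have "(b + of_nat x) gchoose s = (\<Sum>t\<le>s. (of_nat x gchoose t) * (b gchoose (s - t)))" for x
    using gbinomial_Vandermonde[of "of_nat x" b s] by (simp add: atLeast0AtMost add.commute)
  then have "(\<Sum>x\<le>k. (a gchoose x) * (c gchoose (k - x)) * ((b + of_nat x) gchoose s))
     = (\<Sum>x\<le>k. \<Sum>t\<le>s. (b gchoose (s - t)) * ((a gchoose x) * (c gchoose (k - x)) * (of_nat x gchoose t)))"
    by (simp add: sum_distrib_left mult_ac)
  also have "\<dots> = (\<Sum>t\<le>s. (b gchoose (s - t)) * (\<Sum>x\<le>k. (a gchoose x) * (c gchoose (k - x)) * (of_nat x gchoose t)))"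
    by (subst sum.swap) (simp only: sum_distrib_left)
  also have "\<dots> = (\<Sum>t\<le>s. if t \<le> k then (a gchoose t) * (b gchoose (s - t)) * ((a + c - of_nat t) gchoose (k - t)) else 0)"
    unfolding gbinomial_revision_Vandermonde by (intro sum.cong refl) simp
  finally show ?thesis .
qed

context complex_space
begin

text \<open>Coefficient form of a substitution. On the left x and y index the terms of (1+z1)^a
  (1+z2)^c, and (b + x choose s) is the coefficient of z0^s in z1^{b+x} with z1 = z2 + z0. On the
  right t of the s powers of z0 come from (1+z1)^a and s - t from z1^b.\<close>

lemma gbinomial_double_sum:
  fixes F :: "nat \<Rightarrow> 'a"
  assumes F: "\<And>k. k \<ge> N \<Longrightarrow> F k = 0"
  shows "(\<Sum>x<N. \<Sum>y<N. scale ((a gchoose x) * (c gchoose y) * ((b + of_nat x) gchoose s)) (F (x + y)))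
    = (\<Sum>t\<le>s. scale ((a gchoose t) * (b gchoose (s - t)))
        (\<Sum>j<N. scale ((a + c - of_nat t) gchoose j) (F (j + t))))"
proof -
  let ?G = "\<lambda>x y. scale ((a gchoose x) * (c gchoose y) * ((b + of_nat x) gchoose s)) (F (x + y))"
  have "(\<Sum>x<N. \<Sum>y<N. ?G x y) = (\<Sum>(x, y)\<in>{..<N} \<times> {..<N}. ?G x y)"
    by (rule sum.cartesian_product)
  also have "\<dots> = (\<Sum>(x, y)\<in>{(x, y). x + y < N}. ?G x y)"
  proof (rule sum.mono_neutral_right)
    have "F k \<noteq> 0 \<Longrightarrow> k < N" for k using F not_less by blast
    then show "\<forall>p\<in>{..<N} \<times> {..<N} - {(x, y). x + y < N}. (case p of (x, y) \<Rightarrow> ?G x y) = 0"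
      by auto
  qed auto
  also have "\<dots> = (\<Sum>k<N. \<Sum>x\<le>k. ?G x (k - x))"
    by (rule sum.triangle_reindex)
  also have "\<dots> = (\<Sum>k<N. scale (\<Sum>x\<le>k. (a gchoose x) * (c gchoose (k - x)) * ((b + of_nat x) gchoose s)) (F k))"
    by (simp add: scale_sum_left)
  also have "\<dots> = (\<Sum>t\<le>s. \<Sum>k<N. if t \<le> k then scale ((a gchoose t) * (b gchoose (s - t)))
        (scale ((a + c - of_nat t) gchoose (k - t)) (F k)) else 0)"
    unfolding gbinomial_convolution scale_sum_left
    by (subst sum.swap) (intro sum.cong refl, simp add: if_distrib)
  also have "\<dots> = (\<Sum>t\<le>s. scale ((a gchoose t) * (b gchoose (s - t)))
        (\<Sum>j<N. scale ((a + c - of_nat t) gchoose j) (F (j + t))))"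
  proof (rule sum.cong[OF refl])
    fix t
    let ?H = "\<lambda>k. scale ((a + c - of_nat t) gchoose (k - t)) (F k)"
    let ?c = "(a gchoose t) * (b gchoose (s - t))"
    have "(\<Sum>k<N. if t \<le> k then scale ?c (?H k) else 0) = (\<Sum>k<N + t. if t \<le> k then scale ?c (?H k) else 0)"
      by (rule sum.mono_neutral_left) (auto simp: F)
    also have "\<dots> = (\<Sum>k\<in>{0 + t..<N + t}. scale ?c (?H k))"
      by (rule sum.mono_neutral_cong_right) auto
    also have "\<dots> = (\<Sum>j<N. scale ?c (scale ((a + c - of_nat t) gchoose j) (F (j + t))))"
      by (subst sum.shift_bounds_nat_ivl) (simp add: atLeast0LessThan)
    finally show "(\<Sum>k<N. if t \<le> k then scale ?c (?H k) else 0)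
        = scale ?c (\<Sum>j<N. scale ((a + c - of_nat t) gchoose j) (F (j + t)))"
      by (simp add: scale_sum_right)
  qed
  finally show ?thesis .
qed

end

abbreviation mode_res ::
  "('v, 'm::ab_group_add) voa_module \<Rightarrow> complex \<Rightarrow> complex \<Rightarrow> 'v \<Rightarrow> 'm \<Rightarrow> 'm" where
  "mode_res M a b u w \<equiv> res_binom (mscale M) a b (\<lambda>k. mmode M u k w)"

lemma frac_ints_add_int: "n \<in> frac_ints T r \<Longrightarrow> n + of_int k \<in> frac_ints T r"
  unfolding frac_ints_def by (auto simp: add.assoc simp flip: of_int_add)

lemma frac_ints_add_nat: "n \<in> frac_ints T r \<Longrightarrow> n + of_nat k \<in> frac_ints T r"
  using frac_ints_add_int[of n T r "int k"] by simp

section \<open>Modes and residues on a twisted module\<close>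

context weak_twisted_module
begin

sublocale voa_finite_automorphism V T g
  by unfold_locales (fact T_pos automorphism finite_order)+

sublocale M: complex_space "mscale M" ..

sublocale complex_space_pair "vscale V" "mscale M" ..

lemma mmode_add_left: "mmode M (u + u') n w = mmode M u n w + mmode M u' n w"
  and mmode_scale_left: "mmode M (vscale V c u) n w = mscale M c (mmode M u n w)"
  and mmode_add_right: "mmode M u n (w + w') = mmode M u n w + mmode M u n w'"
  and mmode_scale_right: "mmode M u n (mscale M c w) = mscale M c (mmode M u n w)"
  using mmode_linear_left[of n w] mmode_linear_right[of u n]
  unfolding Vector_Spaces.linear_iff by blast+

lemma mmode_0_left [simp]: "mmode M 0 n w = 0"
  and mmode_0_right [simp]: "mmode M u n 0 = 0"
  using mmode_scale_left[of 0 0 n w] mmode_scale_right[of u n 0 0] by simp_all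

lemma mmode_sum_right: "mmode M u n (sum f F) = (\<Sum>x\<in>F. mmode M u n (f x))"
  by (induction F rule: infinite_finite_induct) (auto simp: mmode_add_right)

text \<open>Outside r/T + Z a mode vanishes by support, inside by truncation; hence b may be any
  complex number, and by additivity u any vector.\<close>

lemma mmode_bounded: "\<exists>N. \<forall>i\<ge>N. mmode M u (b + of_nat i) w = 0"
proof (induction u rule: direct_sum_induct[OF bigr_direct_sum])
  case (2 u u')
  then obtain N N' where "\<forall>i\<ge>N. mmode M u (b + of_nat i) w = 0" "\<forall>i\<ge>N'. mmode M u' (b + of_nat i) w = 0"
    by blast
  then have "\<forall>i\<ge>max N N'. mmode M (u + u') (b + of_nat i) w = 0"
    by (simp add: mmode_add_left)
  then show ?case by blast
next
  case (3 i u)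
  then obtain r where r: "r < T" "u \<in> eigen V T g r"
    by (auto simp: bigr_index_def bigr_def)
  obtain N :: real where N: "\<forall>n\<in>frac_ints T r. Re n \<ge> N \<longrightarrow> mmode M u n w = 0"
    using mmode_truncation[OF r] by blast
  obtain K :: nat where K: "N - Re b \<le> real K" using real_arch_simple by blast
  have "mmode M u (b + of_nat i) w = 0" if "i \<ge> K" for i
  proof (cases "b + of_nat i \<in> frac_ints T r")
    case True
    moreover have "N \<le> Re (b + of_nat i)" using K that by simp
    ultimately show ?thesis using N by blast
  qed (simp add: mmode_support[OF r])
  then show ?case by blast
qed simp

text \<open>The cutoff is a free choice, so residues with different supports can be compared over a
  common finite range.\<close>

lemma mode_res_eq_sum:
  assumes "\<And>i. i \<ge> N \<Longrightarrow> mmode M u (b + of_nat i) w = 0"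
  shows "mode_res M a b u w = (\<Sum>i<N. mscale M (a gchoose i) (mmode M u (b + of_nat i) w))"
  unfolding res_binom_def by (rule Sum_any_eq_sum) (simp add: assms)

lemma mode_res_add_left: "mode_res M a b (u + u') w = mode_res M a b u w + mode_res M a b u' w"
proof -
  obtain N N' where N: "\<forall>i\<ge>N. mmode M u (b + of_nat i) w = 0" "\<forall>i\<ge>N'. mmode M u' (b + of_nat i) w = 0"
    using mmode_bounded by meson
  then show ?thesis
    using mode_res_eq_sum[of "max N N'" u b w a] mode_res_eq_sum[of "max N N'" u' b w a]
      mode_res_eq_sum[of "max N N'" "u + u'" b w a]
    by (simp add: mmode_add_left M.scale_right_distrib sum.distrib)
qed

lemma mode_res_add_right: "mode_res M a b u (w + w') = mode_res M a b u w + mode_res M a b u w'"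
proof -
  obtain N N' where N: "\<forall>i\<ge>N. mmode M u (b + of_nat i) w = 0" "\<forall>i\<ge>N'. mmode M u (b + of_nat i) w' = 0"
    using mmode_bounded by meson
  then show ?thesis
    using mode_res_eq_sum[of "max N N'" u b w a] mode_res_eq_sum[of "max N N'" u b w' a]
      mode_res_eq_sum[of "max N N'" u b "w + w'" a]
    by (simp add: mmode_add_right M.scale_right_distrib sum.distrib)
qed

lemma mode_res_scale_left: "mode_res M a b (vscale V c u) w = mscale M c (mode_res M a b u w)"
proof -
  obtain N where N: "\<forall>i\<ge>N. mmode M u (b + of_nat i) w = 0"
    using mmode_bounded by meson
  then show ?thesis
    using mode_res_eq_sum[of N u b w a] mode_res_eq_sum[of N "vscale V c u" b w a]
    by (simp add: mmode_scale_left M.scale_sum_right mult.commute)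
qed

lemma mode_res_scale_right: "mode_res M a b u (mscale M c w) = mscale M c (mode_res M a b u w)"
proof -
  obtain N where N: "\<forall>i\<ge>N. mmode M u (b + of_nat i) w = 0"
    using mmode_bounded by meson
  then show ?thesis
    using mode_res_eq_sum[of N u b w a] mode_res_eq_sum[of N u b "mscale M c w" a]
    by (simp add: mmode_scale_right M.scale_sum_right mult.commute)
qed

lemma linear_mode_res_left: "Vector_Spaces.linear (vscale V) (mscale M) (\<lambda>u. mode_res M a b u w)"
  by (simp add: Vector_Spaces.linear_iff mode_res_add_left mode_res_scale_left
      vector_space_axioms M.vector_space_axioms)

lemma res_binom_zero [simp]: "res_binom (mscale M) a b (\<lambda>k. 0) = 0"
  by (simp add: res_binom_def)

text \<open>Expands one factor 1+z under the residue. Read backwards, it trades a lower exponent of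
  z for a higher exponent of 1+z.\<close>

lemma mode_res_Pascal: "mode_res M (a + 1) b u w = mode_res M a b u w + mode_res M a (b + 1) u w"
proof -
  obtain N where N: "\<forall>i\<ge>N. mmode M u (b + of_nat i) w = 0"
    using mmode_bounded by meson
  let ?f = "\<lambda>i. mmode M u (b + of_nat i) w"
  have "mode_res M (a + 1) b u w = (\<Sum>i<Suc N. mscale M ((a + 1) gchoose i) (?f i))"
    by (rule mode_res_eq_sum) (use N in auto)
  also have "\<dots> = ?f 0 + (\<Sum>i<N. mscale M (a gchoose Suc i) (?f (Suc i)))
      + (\<Sum>i<N. mscale M (a gchoose i) (?f (Suc i)))"
    unfolding sum.lessThan_Suc_shift
    by (simp add: gbinomial_Suc_Suc M.scale_left_distrib sum.distrib del: of_nat_Suc)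
  also have "?f 0 + (\<Sum>i<N. mscale M (a gchoose Suc i) (?f (Suc i))) = mode_res M a b u w"
  proof -
    have "mode_res M a b u w = (\<Sum>i<Suc N. mscale M (a gchoose i) (?f i))"
      by (rule mode_res_eq_sum) (use N in auto)
    then show ?thesis unfolding sum.lessThan_Suc_shift by simp
  qed
  also have "(\<Sum>i<N. mscale M (a gchoose i) (?f (Suc i))) = mode_res M a (b + 1) u w"
  proof -
    have f: "?f (Suc i) = mmode M u (b + 1 + of_nat i) w" for i by (simp add: add_ac)
    have "mmode M u (b + 1 + of_nat i) w = 0" if "i \<ge> N" for i
      using N[rule_format, of "Suc i"] that unfolding f by simp
    then show ?thesis
      unfolding f by (rule mode_res_eq_sum[symmetric])
  qed
  finally show ?thesis .
qed

lemma twisted_commutator: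
  assumes "r < T" "u \<in> eigen V T g r" "m \<in> frac_ints T r"
  shows "mmode M u m (mmode M v n w) - mmode M v n (mmode M u m w)
    = Sum_any (\<lambda>i. mscale M (m gchoose i) (mmode M (vmode V u (int i) v) (m + n - of_nat i) w))"
proof -
  have "Sum_any (\<lambda>i::nat. mscale M (c i * (0 gchoose i)) (f i)) = mscale M (c 0) (f 0)" for c f
  proof -
    have "Sum_any (\<lambda>i::nat. mscale M (c i * (0 gchoose i)) (f i))
        = (\<Sum>i<1. mscale M (c i * (0 gchoose i)) (f i))"
      by (rule Sum_any_eq_sum) (auto simp: gbinomial_0_left)
    then show ?thesis by simp
  qed
  from this[of "\<lambda>i. (- 1) ^ i"] this[of "\<lambda>i. (- 1) powi (- int i)"] show ?thesis
    using twisted_jacobi[OF assms, where l = 0 and v = v and n = n and w = w] by simp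
qed

text \<open>The derivative property is derived from the twisted Jacobi identity with the vacuum as
  second vector, l = -2 and n = 0. On the left the vacuum modes have index i or -2 - i, never -1, so
  everything vanishes; on the right creation leaves (u_{-2}1)_n + n (u_{-1}1)_{n-1}.\<close>

lemma mmode_L_minus_1: "mmode M (Lop V (-1) u) n w = mscale M (- n) (mmode M u (n - 1) w)"
proof (induction u rule: direct_sum_induct[OF bigr_direct_sum])
  case 1
  show ?case by (simp add: Lop_def)
next
  case (2 u u')
  then show ?case by (simp add: Lop_def mode_add_right mmode_add_left M.scale_right_distrib)
next
  case (3 i u)
  then obtain r where r: "r < T" "u \<in> eigen V T g r"
    by (auto simp: bigr_index_def bigr_def)
  show ?case
  proof (cases "n \<in> frac_ints T r")
    case False
    have "n - 1 \<notin> frac_ints T r"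
      using frac_ints_add_int[of "n - 1" T r 1] False by auto
    then show ?thesis
      using False r by (simp add: mmode_support[OF r(1)] eigen_L_minus_1)
  next
    case True
    let ?f = "\<lambda>i. mscale M (n gchoose i) (mmode M (vmode V u (-2 + int i) (vvac V)) (n + 0 - of_nat i) w)"
    have "Sum_any ?f = (\<Sum>i<2. ?f i)"
      by (rule Sum_any_eq_sum) (simp add: creation)
    moreover have "Sum_any ?f = 0"
    proof -
      have "mmode M (vvac V) (0 + of_nat i) x = 0" for i x
      proof -
        have "(0 + of_nat i :: complex) = of_int (int i)" by simp
        also have "\<dots> \<noteq> of_int (-1)" unfolding of_int_eq_iff by simp
        finally show ?thesis by (simp add: mmode_vacuum)
      qed
      moreover have "mmode M (vvac V) (0 + of_int (-2) - of_nat i) x = 0" for i x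
      proof -
        have "(0 + of_int (-2) - of_nat i :: complex) = of_int (- 2 - int i)" by simp
        also have "\<dots> \<noteq> of_int (-1)" unfolding of_int_eq_iff by simp
        finally show ?thesis by (simp add: mmode_vacuum)
      qed
      ultimately show ?thesis
        using twisted_jacobi[OF r True, where l = "-2" and v = "vvac V" and n = 0 and w = w] by simp
    qed
    ultimately show ?thesis
      by (simp add: numeral_2_eq_2 creation L_minus_1_creation add_eq_0_iff)
  qed
qed

text \<open>Integration by parts: the residue of the derivative of (1+z)^{a+1} z^b Y(u,z)w is
  0.\<close>

lemma mode_res_derivative:
  "mode_res M (a + 1) b (Lop V (-1) u) w
    = mscale M (- (a + 1)) (mode_res M a b u w) + mscale M (- b) (mode_res M (a + 1) (b - 1) u w)"
proof -
  obtain N where N: "\<forall>i\<ge>N. mmode M u (b - 1 + of_nat i) w = 0"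
    using mmode_bounded by meson
  let ?f = "\<lambda>i. mmode M u (b - 1 + of_nat i) w"
  have L: "mmode M (Lop V (-1) u) (b + of_nat i) w = mscale M (- (b + of_nat i)) (?f i)" for i
    by (simp add: mmode_L_minus_1 algebra_simps)
  have "mode_res M (a + 1) b (Lop V (-1) u) w
      = (\<Sum>i<Suc N. mscale M ((a + 1) gchoose i) (mscale M (- (b + of_nat i)) (?f i)))"
    by (subst mode_res_eq_sum[of "Suc N"]) (use N in \<open>auto simp: L\<close>)
  also have "\<dots> = (\<Sum>i<Suc N. mscale M (- of_nat i * ((a + 1) gchoose i)) (?f i))
      + mscale M (- b) (\<Sum>i<Suc N. mscale M ((a + 1) gchoose i) (?f i))"
    unfolding M.scale_sum_right sum.distrib[symmetric]
    by (intro sum.cong refl) (simp add: algebra_simps flip: M.scale_left_distrib M.scale_left_diff_distrib)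
  also have "(\<Sum>i<Suc N. mscale M ((a + 1) gchoose i) (?f i)) = mode_res M (a + 1) (b - 1) u w"
    by (rule mode_res_eq_sum[symmetric]) (use N in auto)
  also have "(\<Sum>i<Suc N. mscale M (- of_nat i * ((a + 1) gchoose i)) (?f i))
      = (\<Sum>i<N. mscale M (- (a + 1)) (mscale M (a gchoose i) (?f (Suc i))))"
    unfolding sum.lessThan_Suc_shift
    by (simp add: Suc_times_gbinomial del: of_nat_Suc minus_add_distrib)
  also have "\<dots> = mscale M (- (a + 1)) (mode_res M a b u w)"
  proof -
    have f: "?f (Suc i) = mmode M u (b + of_nat i) w" for i by simp
    have "mmode M u (b + of_nat i) w = 0" if "i \<ge> N" for i
      using N[rule_format, of "Suc i"] that unfolding f by simp
    then show ?thesis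
      unfolding f by (simp add: mode_res_eq_sum[of N u b w a] M.scale_sum_right)
  qed
  finally show ?thesis .
qed

text \<open>
  Both sides are residues of \<open>(1+z\<^sub>1)\<^sup>a z\<^sub>1\<^sup>b (1+z\<^sub>2)\<^sup>c z\<^sub>2\<^sup>d\<close> against the commutator of \<open>Y(u,z\<^sub>1)\<close> and \<open>Y(v,z\<^sub>2)\<close>; on
  the right, \<open>z\<^sub>1 = z\<^sub>2 + z\<^sub>0\<close> and \<open>s\<close> is the power of \<open>z\<^sub>0\<close> that is extracted.
\<close>

lemma mode_res_commutator:
  assumes r: "r < T" "u \<in> eigen V T g r" and b: "b \<in> frac_ints T r"
    and S: "\<And>s. s \<ge> S \<Longrightarrow> vmode V u (int s) v = 0"
  shows "mode_res M a b u (mode_res M c d v w) - mode_res M c d v (mode_res M a b u w)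
    = (\<Sum>s<S. \<Sum>t\<le>s. mscale M ((a gchoose t) * (b gchoose (s - t)))
        (mode_res M (a + c - of_nat t) (b + d - of_nat (s - t)) (vmode V u (int s) v) w))"
proof -
  \<comment> \<open>A composite needs a cutoff for the outer mode that is independent of the inner
    index. Only finitely many inner values are nonzero, so a maximum exists; \<open>insert 0\<close>
    keeps it meaningful when K = 0.\<close>
  have uniform: "\<exists>N. \<forall>i\<ge>N. \<forall>y. mmode M u1 (b1 + of_nat i) (f y) = 0"
    if f: "\<And>y. y \<ge> K \<Longrightarrow> f y = 0" for u1 b1 and f :: "nat \<Rightarrow> 'm" and K
  proof -
    have "\<forall>y. \<exists>n. \<forall>i\<ge>n. mmode M u1 (b1 + of_nat i) (f y) = 0"
      using mmode_bounded by blast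
    from choice[OF this] obtain n where n: "\<forall>y. \<forall>i\<ge>n y. mmode M u1 (b1 + of_nat i) (f y) = 0" ..
    have "mmode M u1 (b1 + of_nat i) (f y) = 0" if "i \<ge> Max (insert 0 (n ` {..<K}))" for i y
      using that n f[of y] by (cases "y < K") (auto simp: not_less)
    then show ?thesis by blast
  qed
  obtain N1 where N1: "\<forall>i\<ge>N1. mmode M u (b + of_nat i) w = 0"
    using mmode_bounded by meson
  obtain N2 where N2: "\<forall>i\<ge>N2. mmode M v (d + of_nat i) w = 0"
    using mmode_bounded by meson
  obtain N3 where N3: "\<forall>i\<ge>N3. \<forall>y. mmode M u (b + of_nat i) (mmode M v (d + of_nat y) w) = 0"
    using uniform[of N2 "\<lambda>y. mmode M v (d + of_nat y) w"] N2 by blast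
  obtain N4 where N4: "\<forall>i\<ge>N4. \<forall>y. mmode M v (d + of_nat i) (mmode M u (b + of_nat y) w) = 0"
    using uniform[of N1 "\<lambda>y. mmode M u (b + of_nat y) w"] N1 by blast
  let ?F = "\<lambda>s k. mmode M (vmode V u (int s) v) (b + d - of_nat s + of_nat k) w"
  have "\<forall>s. \<exists>n. \<forall>k\<ge>n. ?F s k = 0"
    using mmode_bounded by blast
  from choice[OF this] obtain n where n: "\<forall>s. \<forall>k\<ge>n s. ?F s k = 0" ..
  define N where "N = Max ({N1, N2, N3, N4} \<union> n ` {..<S})"
  have N: "N1 \<le> N" "N2 \<le> N" "N3 \<le> N" "N4 \<le> N" "\<And>s. s < S \<Longrightarrow> n s \<le> N"
    unfolding N_def by (rule Max_ge; simp)+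
  let ?A = "\<lambda>x y. mmode M u (b + of_nat x) (mmode M v (d + of_nat y) w)"
  let ?B = "\<lambda>x y. mmode M v (d + of_nat y) (mmode M u (b + of_nat x) w)"
  have F0: "?F s k = 0" if "s < S" "k \<ge> N" for s k
    using n N(5)[OF that(1)] that(2) by auto
  have v_res: "mode_res M c d v w = (\<Sum>y<N. mscale M (c gchoose y) (mmode M v (d + of_nat y) w))"
    using N2 N by (intro mode_res_eq_sum) auto
  have u_res: "mode_res M a b u w = (\<Sum>x<N. mscale M (a gchoose x) (mmode M u (b + of_nat x) w))"
    using N1 N by (intro mode_res_eq_sum) auto
  have "mode_res M a b u (mode_res M c d v w)
      = (\<Sum>x<N. mscale M (a gchoose x) (mmode M u (b + of_nat x) (mode_res M c d v w)))"
    using N3 N by (intro mode_res_eq_sum) (auto simp: v_res mmode_sum_right mmode_scale_right)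
  also have "\<dots> = (\<Sum>x<N. \<Sum>y<N. mscale M ((a gchoose x) * (c gchoose y)) (?A x y))"
    unfolding v_res by (simp add: mmode_sum_right mmode_scale_right M.scale_sum_right)
  finally have 1: "mode_res M a b u (mode_res M c d v w) = \<dots>" .
  have "mode_res M c d v (mode_res M a b u w)
      = (\<Sum>y<N. mscale M (c gchoose y) (mmode M v (d + of_nat y) (mode_res M a b u w)))"
    using N4 N by (intro mode_res_eq_sum) (auto simp: u_res mmode_sum_right mmode_scale_right)
  also have "\<dots> = (\<Sum>y<N. \<Sum>x<N. mscale M ((a gchoose x) * (c gchoose y)) (?B x y))"
    unfolding u_res by (simp add: mmode_sum_right mmode_scale_right M.scale_sum_right mult.commute)
  also have "\<dots> = (\<Sum>x<N. \<Sum>y<N. mscale M ((a gchoose x) * (c gchoose y)) (?B x y))"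
    by (rule sum.swap)
  finally have 2: "mode_res M c d v (mode_res M a b u w) = \<dots>" .
  \<comment> \<open>Adding x keeps b + x in r/T + Z, so the commutator formula applies. Apart from
    the binomial, its terms depend on x and y only through x + y, the shape
    \<open>gbinomial_double_sum\<close> asks for.\<close>
  have AB: "?A x y - ?B x y = (\<Sum>s<S. mscale M ((b + of_nat x) gchoose s) (?F s (x + y)))" for x y
  proof -
    have "?A x y - ?B x y = Sum_any (\<lambda>s. mscale M ((b + of_nat x) gchoose s)
        (mmode M (vmode V u (int s) v) ((b + of_nat x) + (d + of_nat y) - of_nat s) w))"
      by (rule twisted_commutator[OF r frac_ints_add_nat[OF b]])
    also have "\<dots> = (\<Sum>s<S. mscale M ((b + of_nat x) gchoose s)
        (mmode M (vmode V u (int s) v) ((b + of_nat x) + (d + of_nat y) - of_nat s) w))"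
      by (rule Sum_any_eq_sum) (simp add: S)
    finally show ?thesis by (simp add: algebra_simps)
  qed
  have "mode_res M a b u (mode_res M c d v w) - mode_res M c d v (mode_res M a b u w)
      = (\<Sum>x<N. \<Sum>y<N. mscale M ((a gchoose x) * (c gchoose y)) (?A x y - ?B x y))"
    unfolding 1 2 by (simp add: M.scale_right_diff_distrib sum_subtractf)
  also have "\<dots> = (\<Sum>s<S. \<Sum>x<N. \<Sum>y<N.
      mscale M ((a gchoose x) * (c gchoose y) * ((b + of_nat x) gchoose s)) (?F s (x + y)))"
    unfolding AB M.scale_sum_right M.scale_scale
    by (rule trans[OF sum.cong[OF refl sum.swap] sum.swap])
  also have "\<dots> = (\<Sum>s<S. \<Sum>t\<le>s. mscale M ((a gchoose t) * (b gchoose (s - t)))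
        (\<Sum>j<N. mscale M ((a + c - of_nat t) gchoose j) (?F s (j + t))))"
    by (rule sum.cong[OF refl], rule M.gbinomial_double_sum) (use F0 in auto)
  also have "\<dots> = (\<Sum>s<S. \<Sum>t\<le>s. mscale M ((a gchoose t) * (b gchoose (s - t)))
        (mode_res M (a + c - of_nat t) (b + d - of_nat (s - t)) (vmode V u (int s) v) w))"
  proof (intro sum.cong refl arg_cong[where f = "mscale M _"])
    fix s t assume "s \<in> {..<S}" "t \<in> {..s}"
    then have F: "?F s (j + t) = mmode M (vmode V u (int s) v) (b + d - of_nat (s - t) + of_nat j) w" for j
      by (simp add: of_nat_diff algebra_simps)
    show "(\<Sum>j<N. mscale M ((a + c - of_nat t) gchoose j) (?F s (j + t)))
       = mode_res M (a + c - of_nat t) (b + d - of_nat (s - t)) (vmode V u (int s) v) w"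
      unfolding F using F0[of s "_ + t"] \<open>s \<in> _\<close>
      by (intro mode_res_eq_sum[symmetric]) (simp flip: F)
  qed
  finally show ?thesis .
qed

end


section \<open>Products on a twisted module\<close>

text \<open>The circle product and the left product share this exponent of 1+z; their exponents of
  z, \<open>circ_pole T p q\<close> and p/T - 1, differ by \<open>delta2 T p q\<close>.\<close>

definition circ_exp :: "nat \<Rightarrow> int \<Rightarrow> nat \<Rightarrow> complex" where
  "circ_exp T n q = of_int n - 1 + of_nat (delta1 T q) + of_nat q / of_nat T"

definition circ_pole :: "nat \<Rightarrow> nat \<Rightarrow> nat \<Rightarrow> complex" where
  "circ_pole T p q = - (1 + of_nat (delta2 T p q) - of_nat p / of_nat T)"

lemma add_mod_less:
  fixes x y T :: nat
  assumes "x < T" "y < T"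
  shows "(x + y) mod T = (if x + y < T then x + y else x + y - T)"
    and "(x + y) div T = (if x + y < T then 0 else 1)"
  using assms by (auto simp: mod_if div_if)

lemma delta1_less: "q < T \<Longrightarrow> delta1 T q = (if q = 0 then 1 else 0)"
  by (simp add: delta1_def)

locale twisted_module_pair = weak_twisted_module V T g1 M + voa_automorphism_pair V T g1 g2
  for V :: "'v::ab_group_add voa" and T :: nat and g1 g2 :: "'v \<Rightarrow> 'v"
    and M :: "('v, 'm::ab_group_add) voa_module"
begin

abbreviation circ (infixl \<open>\<circ>\<^sub>M\<close> 70) where "u \<circ>\<^sub>M w \<equiv> bimod_circ V T g1 g2 M u w"
abbreviation left (infixr \<open>\<rhd>\<close> 70) where "u \<rhd> w \<equiv> bimod_left V T g1 g2 M u w"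
abbreviation right (infixl \<open>\<lhd>\<^sub>M\<close> 70) where "w \<lhd>\<^sub>M u \<equiv> bimod_right V T g1 g2 M w u"
abbreviation O' where "O' \<equiv> bimod_O' V T g1 g2 M"

lemma linear_if:
  "Vector_Spaces.linear (vscale V) (mscale M) f \<Longrightarrow>
    Vector_Spaces.linear (vscale V) (mscale M) (\<lambda>u. if b then f u else 0)"
  by (cases b) (simp_all add: linear_zero)

lemma linear_circ: "Vector_Spaces.linear (vscale V) (mscale M) (\<lambda>u. u \<circ>\<^sub>M w)"
  unfolding bimod_circ_def
  by (rule linear_extend_sum[OF _ trigr_direct_sum])
    (auto simp: linear_mode_res_left split: prod.splits)

lemma linear_left: "Vector_Spaces.linear (vscale V) (mscale M) (\<lambda>u. u \<rhd> w)"
  unfolding bimod_left_def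
  by (rule linear_extend_sum[OF _ trigr_direct_sum])
    (auto simp: linear_mode_res_left intro!: linear_if split: prod.splits)

lemma linear_right: "Vector_Spaces.linear (vscale V) (mscale M) (\<lambda>u. w \<lhd>\<^sub>M u)"
  unfolding bimod_right_def
  by (rule linear_extend_sum[OF _ trigr_direct_sum])
    (auto simp: linear_mode_res_left intro!: linear_if linear_compose_scale_right split: prod.splits)

lemma circ_homogeneous:
  assumes "u \<in> trigr V T g1 g2 (n, p, q)" "p < T" "q < T"
  shows "u \<circ>\<^sub>M w = mode_res M (circ_exp T n q) (circ_pole T p q) u w"
  unfolding bimod_circ_def circ_exp_def circ_pole_def
  by (subst extend_sum_homogeneous[OF trigr_direct_sum, of "(n, p, q)"])
    (use assms in \<open>auto simp: trigr_index_def linear_mode_res_left\<close>)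

lemma left_homogeneous:
  assumes "u \<in> trigr V T g1 g2 (n, p, q)" "p < T" "q < T"
  shows "u \<rhd> w = (if (p + q) mod T = 0
    then mode_res M (circ_exp T n q) (of_nat p / of_nat T - 1) u w else 0)"
  unfolding bimod_left_def circ_exp_def
  by (subst extend_sum_homogeneous[OF trigr_direct_sum, of "(n, p, q)"])
    (use assms in \<open>auto simp: trigr_index_def linear_mode_res_left intro!: linear_if\<close>)

lemma right_homogeneous:
  assumes "u \<in> trigr V T g1 g2 (n, p, q)" "p < T" "q < T"
  shows "w \<lhd>\<^sub>M u = (if q = 0
    then mscale M (exp (- (of_nat p / of_nat T) * of_real pi * \<i>))
      (mode_res M (of_int n - 1) (of_nat p / of_nat T - 1) u w) else 0)"
  unfolding bimod_right_def
  by (subst extend_sum_homogeneous[OF trigr_direct_sum, of "(n, p, q)"])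
    (use assms in \<open>auto simp: trigr_index_def linear_mode_res_left intro!: linear_if linear_compose_scale_right\<close>)

lemma homogeneous_induct [case_names zero add homogeneous]:
  assumes "P 0" "\<And>u v. P u \<Longrightarrow> P v \<Longrightarrow> P (u + v)"
    and "\<And>n p q u. p < T \<Longrightarrow> q < T \<Longrightarrow> u \<in> trigr V T g1 g2 (n, p, q) \<Longrightarrow> P u"
  shows "P u"
proof (rule direct_sum_induct[OF trigr_direct_sum])
  fix i v assume "i \<in> trigr_index T" "v \<in> trigr V T g1 g2 i"
  then show "P v" using assms(3) by (cases i) (auto simp: trigr_index_def)
qed (fact assms)+

lemmas product_add_left =
  linear_add[OF linear_circ] linear_add[OF linear_left] linear_add[OF linear_right]

lemmas product_0_left =
  linear_0[OF linear_circ] linear_0[OF linear_left] linear_0[OF linear_right]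

lemma product_add_right:
  "u \<circ>\<^sub>M (w + w') = u \<circ>\<^sub>M w + u \<circ>\<^sub>M w'"
  "u \<rhd> (w + w') = u \<rhd> w + u \<rhd> w'"
  "(w + w') \<lhd>\<^sub>M u = w \<lhd>\<^sub>M u + w' \<lhd>\<^sub>M u"
  by (induction u rule: homogeneous_induct;
      simp add: product_0_left product_add_left circ_homogeneous left_homogeneous right_homogeneous
        mode_res_add_right M.scale_right_distrib algebra_simps)+

lemma product_scale_right:
  "u \<circ>\<^sub>M (mscale M c w) = mscale M c (u \<circ>\<^sub>M w)"
  "u \<rhd> (mscale M c w) = mscale M c (u \<rhd> w)"
  "(mscale M c w) \<lhd>\<^sub>M u = mscale M c (w \<lhd>\<^sub>M u)"
  by (induction u rule: homogeneous_induct;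
      simp add: product_0_left product_add_left circ_homogeneous left_homogeneous right_homogeneous
        mode_res_scale_right M.scale_right_distrib mult.commute)+

lemma product_0_right: "u \<circ>\<^sub>M 0 = 0" "u \<rhd> 0 = 0" "0 \<lhd>\<^sub>M u = 0"
  using product_scale_right(1)[of u 0 0] product_scale_right(2)[of u 0 0] product_scale_right(3)[of 0 0 u]
  by simp_all

lemma linear_left_right: "Vector_Spaces.linear (mscale M) (mscale M) (\<lambda>w. u \<rhd> w)"
  and linear_right_left: "Vector_Spaces.linear (mscale M) (mscale M) (\<lambda>w. w \<lhd>\<^sub>M u)"
  by (simp_all add: Vector_Spaces.linear_iff product_add_right product_scale_right M.vector_space_axioms)

lemma vac_trigr: "vvac V \<in> trigr V T g1 g2 (0, 0, 0)"
  using auto_vac G2.auto_vac vac_weight by (simp add: trigr_def eigen_iff)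

lemma mode_res_vac: "mode_res M a (-1) (vvac V) w = w"
proof -
  have "(- 1 + of_nat i :: complex) = - 1 \<longleftrightarrow> i = 0" for i by simp
  then have "mode_res M a (-1) (vvac V) w = (\<Sum>i<1. mscale M (a gchoose i) (mmode M (vvac V) (- 1 + of_nat i) w))"
    by (intro mode_res_eq_sum) (simp add: mmode_vacuum)
  then show ?thesis by (simp add: mmode_vacuum)
qed

lemma left_vac: "vvac V \<rhd> w = w" and right_vac: "w \<lhd>\<^sub>M vvac V = w"
  using T_pos left_homogeneous[OF vac_trigr] right_homogeneous[OF vac_trigr]
  by (simp_all add: mode_res_vac)

section \<open>Residues lying in \<open>O'\<close>\<close>

lemma O'_subspace: "M.subspace O'"
  unfolding bimod_O'_def by (rule M.subspace_span)

lemma circ_in_O': "u \<circ>\<^sub>M w \<in> O'"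
  unfolding bimod_O'_def by (rule M.span_base) blast

text \<open>The induction that lowers the pole divides by this exponent; p < T makes its real part
  negative.\<close>

lemma circ_pole_nonzero:
  assumes "p < T"
  shows "circ_pole T p q - of_nat m \<noteq> 0"
proof -
  have "real p / real T < 1" using assms by simp
  then have "Re (circ_pole T p q - of_nat m) < 0"
    by (simp add: circ_pole_def)
  then show ?thesis by auto
qed

text \<open>
  The residue of a total derivative vanishes, so the element for \<open>m + 1\<close> is obtained from those
  of \<open>L(-1)u\<close> and \<open>u\<close> for \<open>m\<close>.
\<close>

lemma mode_res_diagonal_in_O':
  assumes "u \<in> trigr V T g1 g2 (n, p, q)" "p < T" "q < T"
  shows "mode_res M (circ_exp T n q + of_nat m) (circ_pole T p q - of_nat m) u w \<in> O'"
  using assms(1)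
proof (induction m arbitrary: n u)
  case 0
  then show ?case using circ_in_O'[of u w] by (simp add: circ_homogeneous[OF _ assms(2,3)])
next
  case (Suc m)
  let ?a = "circ_exp T n q + of_nat m" and ?b = "circ_pole T p q - of_nat m"
  \<comment> \<open>L(-1) raises the weight, hence the exponent of 1+z, by 1; this is why n and u
    vary in the induction.\<close>
  have "circ_exp T (n + 1) q + of_nat m = ?a + 1"
    by (simp add: circ_exp_def)
  then have "mode_res M (?a + 1) ?b (Lop V (-1) u) w \<in> O'"
    using Suc.IH[OF trigr_L_minus_1[OF Suc.prems]] by (simp add: add_ac)
  moreover have "mode_res M ?a ?b u w \<in> O'" by (rule Suc.IH[OF Suc.prems])
  ultimately have "mode_res M (?a + 1) ?b (Lop V (-1) u) w - mscale M (- (?a + 1)) (mode_res M ?a ?b u w) \<in> O'"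
    by (intro M.subspace_diff M.subspace_scale O'_subspace)
  then have "mscale M (- ?b) (mode_res M (?a + 1) (?b - 1) u w) \<in> O'"
    unfolding mode_res_derivative by simp
  then have "mscale M (inverse (- ?b)) (mscale M (- ?b) (mode_res M (?a + 1) (?b - 1) u w)) \<in> O'"
    by (rule M.subspace_scale[OF O'_subspace])
  moreover have "inverse (- ?b) * (- ?b) = 1"
    using circ_pole_nonzero[OF assms(2), of q m] by (intro left_inverse) auto
  ultimately have "mode_res M (?a + 1) (?b - 1) u w \<in> O'"
    by (simp only: M.scale_scale M.scale_one)
  then show ?case
    by (simp add: algebra_simps)
qed

text \<open>By Pascal a residue off the diagonal k = m is a difference of the residues for (k + 1,
  m) and (k, m - 1), both one step closer to the diagonal.\<close>

lemma mode_res_in_O':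
  assumes "u \<in> trigr V T g1 g2 (n, p, q)" "p < T" "q < T" and "k \<le> m"
  shows "mode_res M (circ_exp T n q + of_nat k) (circ_pole T p q - of_nat m) u w \<in> O'"
proof -
  have "mode_res M (circ_exp T n q + of_nat k) (circ_pole T p q - of_nat (k + j)) u w \<in> O'" for j
  proof (induction j arbitrary: k)
    case 0
    then show ?case using mode_res_diagonal_in_O'[OF assms(1-3)] by simp
  next
    case (Suc j)
    let ?a = "circ_exp T n q + of_nat k" and ?b = "circ_pole T p q - of_nat (k + Suc j)"
    have "mode_res M (?a + 1) ?b u w - mode_res M ?a (?b + 1) u w \<in> O'"
      using Suc.IH[of "Suc k"] Suc.IH[of k]
      by (intro M.subspace_diff O'_subspace) (simp_all add: algebra_simps)
    then show ?case by (simp add: mode_res_Pascal)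
  qed
  from this[of "m - k"] assms(4) show ?thesis by simp
qed

text \<open>Common source of the three commutations below. \<alpha> and \<gamma> are the parts of
  the exponents of 1+z beyond weight minus 1, and \<beta> is the integral pole order of the second
  operator. K is the surplus of 1+z left after u_s v has taken its own share; \<open>pole\<close>
  says that \<beta> pays for the carry in p + p', for \<open>delta2\<close> and for K.\<close>

lemma mode_res_commutator_in_O':
  assumes u: "u \<in> trigr V T g1 g2 (n, p, q)" "p < T" "q < T"
    and v: "v \<in> trigr V T g1 g2 (n', p', q')" "p' < T" "q' < T"
    and PQ: "P = (p + p') mod T" "Q = (q + q') mod T"
    and exp: "\<alpha> + \<gamma> = of_nat (delta1 T Q) + of_nat Q / of_nat T + of_nat K"
    and pole: "(p + p') div T + delta2 T P Q + K \<le> \<beta>"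
  shows "mode_res M (of_int n - 1 + \<alpha>) (of_nat p / of_nat T - 1) u
      (mode_res M (of_int n' - 1 + \<gamma>) (of_nat p' / of_nat T - of_nat \<beta>) v w)
    - mode_res M (of_int n' - 1 + \<gamma>) (of_nat p' / of_nat T - of_nat \<beta>) v
      (mode_res M (of_int n - 1 + \<alpha>) (of_nat p / of_nat T - 1) u w) \<in> O'"
proof -
  let ?a = "of_int n - 1 + \<alpha>" and ?b = "of_nat p / of_nat T - 1 :: complex"
  let ?c = "of_int n' - 1 + \<gamma>" and ?d = "of_nat p' / of_nat T - of_nat \<beta> :: complex"
  obtain N :: int where N: "\<forall>s\<ge>N. vmode V u s v = 0" using truncation by blast
  have eig: "u \<in> eigen V T g1 p" using u(1) by (simp add: trigr_def)
  have "?b = of_nat p / of_nat T + of_int (-1)" by simp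
  then have b: "?b \<in> frac_ints T p" unfolding frac_ints_def by blast
  \<comment> \<open>Adding the fractional parts carries (p + p') div T into the integral part of the
    exponent of z.\<close>
  have sum_p: "of_nat p / of_nat T + of_nat p' / of_nat T
      = of_nat P / of_nat T + (of_nat ((p + p') div T) :: complex)"
  proof -
    have "of_nat (p + p') = (of_nat (T * ((p + p') div T) + P) :: complex)" by (simp add: PQ)
    then show ?thesis using T_pos by (simp add: field_simps)
  qed
  have "mode_res M ?a ?b u (mode_res M ?c ?d v w) - mode_res M ?c ?d v (mode_res M ?a ?b u w)
    = (\<Sum>s<nat N. \<Sum>t\<le>s. mscale M ((?a gchoose t) * (?b gchoose (s - t)))
        (mode_res M (?a + ?c - of_nat t) (?b + ?d - of_nat (s - t)) (vmode V u (int s) v) w))"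
    by (rule mode_res_commutator[OF u(2) eig b]) (use N in auto)
  also have "\<dots> \<in> O'"
  proof (intro M.subspace_sum M.subspace_scale O'_subspace)
    fix s t :: nat assume "t \<in> {..s}"
    then have t: "t \<le> s" by simp
    \<comment> \<open>The exponent of 1+z is raised by s - t + K and that of z lowered by m; s - t
      cancels from the comparison, which reduces to \<open>pole\<close>.\<close>
    let ?N = "n + n' - int s - 1" and ?m = "\<beta> - (p + p') div T - delta2 T P Q + (s - t)"
    have y: "vmode V u (int s) v \<in> trigr V T g1 g2 (?N, P, Q)"
      using trigr_mode[OF u(1) v(1)] by (simp add: PQ)
    have exponent: "?a + ?c - of_nat t = circ_exp T ?N Q + of_nat (s - t + K)"
      using exp t by (simp add: circ_exp_def algebra_simps)
    have order: "?b + ?d - of_nat (s - t) = circ_pole T P Q - of_nat ?m"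
    proof -
      have "of_nat (\<beta> - (p + p') div T - delta2 T P Q)
          = (of_nat \<beta> - of_nat ((p + p') div T) - of_nat (delta2 T P Q) :: complex)"
        using pole by (simp add: of_nat_diff)
      then have "of_nat ?m = (of_nat \<beta> - of_nat ((p + p') div T) - of_nat (delta2 T P Q) + of_nat (s - t) :: complex)"
        by (simp only: of_nat_add)
      then show ?thesis using sum_p unfolding circ_pole_def by (simp add: algebra_simps)
    qed
    show "mode_res M (?a + ?c - of_nat t) (?b + ?d - of_nat (s - t)) (vmode V u (int s) v) w \<in> O'"
      unfolding exponent order
      by (rule mode_res_in_O'[OF y]) (use T_pos pole in \<open>auto simp: PQ\<close>)
  qed
  finally show ?thesis .
qed

lemma left_circ_homogeneous:
  assumes u: "u \<in> trigr V T g1 g2 (n, p, q)" "p < T" "q < T"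
    and v: "v \<in> trigr V T g1 g2 (n', p', q')" "p' < T" "q' < T"
  shows "u \<rhd> (v \<circ>\<^sub>M w) \<in> O'"
proof (cases "(p + q) mod T = 0")
  case True
  define P Q where "P = (p + p') mod T" and "Q = (q + q') mod T"
  \<comment> \<open>What remains in the exponent of 1+z after \<open>delta1 T Q\<close> is taken
    out; the truncated subtraction is exact, as the fact \<open>K\<close> shows.\<close>
  define K where "K = delta1 T q + delta1 T q' + (q + q') div T - delta1 T Q"
  have Q: "Q < T" "P < T" using T_pos by (simp_all add: P_def Q_def)
  have pq: "p = 0 \<and> q = 0 \<or> q \<noteq> 0 \<and> p + q = T"
    using True add_mod_less[OF u(2,3)] u(2,3) by (auto split: if_splits)
  note arith = add_mod_less[OF u(2) v(2)] add_mod_less[OF u(3) v(3)]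
    delta1_less[OF u(3)] delta1_less[OF v(3)] delta1_less[OF Q(1)]
  have K: "delta1 T Q + K = delta1 T q + delta1 T q' + (q + q') div T"
    using u(2,3) v(2,3) unfolding K_def arith unfolding Q_def arith by auto
  \<comment> \<open>For p = q = 0 both sides are equal. For p + q = T with q' and Q nonzero, P + Q =
    p' + q' + T - cT, where c counts the overflows of p + p' and q + q'; so the carries are
    compensated through the test P + Q \<ge> T in \<open>delta2\<close>. The cases q' = 0 and Q = 0
    use its value 1 there.\<close>
  have pole: "(p + p') div T + delta2 T P Q + K \<le> 1 + delta2 T p' q'"
    using pq u(2,3) v(2,3) unfolding K_def arith delta2_def unfolding P_def Q_def arith
    by (auto split: if_splits)
  have sum_q: "of_nat q / of_nat T + of_nat q' / of_nat T
      = of_nat Q / of_nat T + (of_nat ((q + q') div T) :: complex)"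
  proof -
    have "of_nat (q + q') = (of_nat (T * ((q + q') div T) + Q) :: complex)" by (simp add: Q_def)
    then show ?thesis using T_pos by (simp add: field_simps)
  qed
  have exp: "(of_nat (delta1 T q) + of_nat q / of_nat T) + (of_nat (delta1 T q') + of_nat q' / of_nat T)
      = of_nat (delta1 T Q) + of_nat Q / of_nat T + (of_nat K :: complex)"
  proof -
    have "of_nat (delta1 T Q) + (of_nat K :: complex)
        = of_nat (delta1 T q) + of_nat (delta1 T q') + of_nat ((q + q') div T)"
      using K by (metis of_nat_add)
    then show ?thesis using sum_q by (simp add: algebra_simps)
  qed
  have "circ_pole T p' q' = of_nat p' / of_nat T - of_nat (1 + delta2 T p' q')"
    by (simp add: circ_pole_def)
  then have "u \<rhd> (v \<circ>\<^sub>M w) - v \<circ>\<^sub>M (u \<rhd> w) \<in> O'"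
    using mode_res_commutator_in_O'[OF u v P_def Q_def exp pole, of w] True
    by (simp only: circ_homogeneous[OF v] left_homogeneous[OF u] circ_exp_def add.assoc if_True simp_thms)
  \<comment> \<open>The second term of the commutator is a circle product, hence already in
    \<open>O'\<close>.\<close>
  then show ?thesis
    using M.subspace_add[OF O'_subspace _ circ_in_O', of "u \<rhd> (v \<circ>\<^sub>M w) - v \<circ>\<^sub>M (u \<rhd> w)" v "u \<rhd> w"] by simp
qed (simp add: left_homogeneous[OF u] M.subspace_0[OF O'_subspace])

lemma right_circ_homogeneous:
  assumes u: "u \<in> trigr V T g1 g2 (n, p, q)" "p < T" "q < T"
    and v: "v \<in> trigr V T g1 g2 (n', p', q')" "p' < T" "q' < T"
  shows "(v \<circ>\<^sub>M w) \<lhd>\<^sub>M u \<in> O'"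
proof (cases "q = 0")
  case True
  define P where "P = (p + p') mod T"
  have Q: "q' = (q + q') mod T" using True v(3) by simp
  \<comment> \<open>Without a carry the left side is at most 1. With a carry P < p', and
    \<open>delta2\<close> cannot grow when its first argument shrinks.\<close>
  have pole: "(p + p') div T + delta2 T P q' + 0 \<le> 1 + delta2 T p' q'"
    using u(2) v(2) unfolding P_def delta2_def add_mod_less[OF u(2) v(2)] by auto
  have exp: "0 + (of_nat (delta1 T q') + of_nat q' / of_nat T)
      = of_nat (delta1 T q') + of_nat q' / of_nat T + (of_nat 0 :: complex)"
    by simp
  let ?R = "mode_res M (of_int n - 1) (of_nat p / of_nat T - 1) u"
  have "circ_pole T p' q' = of_nat p' / of_nat T - of_nat (1 + delta2 T p' q')"
    by (simp add: circ_pole_def)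
  then have "?R (v \<circ>\<^sub>M w) - v \<circ>\<^sub>M (?R w) \<in> O'"
    using mode_res_commutator_in_O'[OF u v P_def Q exp pole, of w]
    by (simp only: circ_homogeneous[OF v] circ_exp_def add.assoc add_0_right)
  then have "?R (v \<circ>\<^sub>M w) \<in> O'"
    using M.subspace_add[OF O'_subspace _ circ_in_O', of "?R (v \<circ>\<^sub>M w) - v \<circ>\<^sub>M (?R w)" v "?R w"] by simp
  \<comment> \<open>The phase in the right product is a scalar and is absorbed by the
    subspace.\<close>
  then show ?thesis
    using True by (simp add: right_homogeneous[OF u] M.subspace_scale[OF O'_subspace])
qed (simp add: right_homogeneous[OF u] M.subspace_0[OF O'_subspace])

lemma left_right_homogeneous:
  assumes u: "u \<in> trigr V T g1 g2 (n, p, q)" "p < T" "q < T"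
    and v: "v \<in> trigr V T g1 g2 (n', p', q')" "p' < T" "q' < T"
  shows "u \<rhd> (w \<lhd>\<^sub>M v) - (u \<rhd> w) \<lhd>\<^sub>M v \<in> O'"
proof (cases "(p + q) mod T = 0 \<and> q' = 0")
  case True
  define P where "P = (p + p') mod T"
  have Q: "q = (q + q') mod T" using True u(3) by simp
  have "p = 0 \<and> q = 0 \<or> q \<noteq> 0 \<and> p + q = T"
    using True add_mod_less[OF u(2,3)] u(2,3) by (auto split: if_splits)
  \<comment> \<open>If p + q = T, an overflow of p + p' gives P + q = p' < T, so the carry and
    \<open>delta2\<close> never both contribute. If p = q = 0 there is no carry.\<close>
  then have pole: "(p + p') div T + delta2 T P q + 0 \<le> 1"
    using u(2) v(2) unfolding P_def delta2_def add_mod_less[OF u(2) v(2)] by auto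
  have exp: "(of_nat (delta1 T q) + of_nat q / of_nat T) + 0
      = of_nat (delta1 T q) + of_nat q / of_nat T + (of_nat 0 :: complex)"
    by simp
  let ?R = "mode_res M (of_int n' - 1) (of_nat p' / of_nat T - 1) v"
  have "u \<rhd> (?R w) - ?R (u \<rhd> w) \<in> O'"
    using mode_res_commutator_in_O'[OF u v P_def Q exp pole, of w] True
    by (simp only: left_homogeneous[OF u] circ_exp_def add.assoc add_0_right if_True of_nat_1 simp_thms)
  then show ?thesis
    using True by (simp add: right_homogeneous[OF v] product_scale_right M.subspace_scale[OF O'_subspace]
        flip: M.scale_right_diff_distrib)
qed (auto simp: left_homogeneous[OF u] right_homogeneous[OF v] product_0_right M.subspace_0[OF O'_subspace])

lemma left_circ_in_O': "u \<rhd> (v \<circ>\<^sub>M w) \<in> O'"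
proof (induction u rule: homogeneous_induct)
  case (homogeneous n p q u)
  note u = this
  show ?case
  proof (induction v rule: homogeneous_induct)
    case (homogeneous n' p' q' v)
    with u show ?case by (intro left_circ_homogeneous)
  qed (simp_all add: product_0_left product_0_right product_add_left product_add_right
      M.subspace_0[OF O'_subspace] M.subspace_add[OF O'_subspace])
qed (simp_all add: product_0_left product_add_left M.subspace_0[OF O'_subspace] M.subspace_add[OF O'_subspace])

lemma right_circ_in_O': "(v \<circ>\<^sub>M w) \<lhd>\<^sub>M u \<in> O'"
proof (induction u rule: homogeneous_induct)
  case (homogeneous n p q u)
  note u = this
  show ?case
  proof (induction v rule: homogeneous_induct)
    case (homogeneous n' p' q' v)
    with u show ?case by (intro right_circ_homogeneous)
  qed (simp_all add: product_0_left product_0_right product_add_left product_add_right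
      M.subspace_0[OF O'_subspace] M.subspace_add[OF O'_subspace])
qed (simp_all add: product_0_left product_add_left M.subspace_0[OF O'_subspace] M.subspace_add[OF O'_subspace])

lemma O'_induct [consumes 1, case_names circ zero add scale]:
  assumes "x \<in> O'" and "\<And>u w. P (u \<circ>\<^sub>M w)" and "P 0" and "\<And>x y. P x \<Longrightarrow> P y \<Longrightarrow> P (x + y)"
    and "\<And>c x. P x \<Longrightarrow> P (mscale M c x)"
  shows "P x"
proof -
  have "x \<in> M.span {u \<circ>\<^sub>M w | u w. True}" using assms(1) by (simp add: bimod_O'_def)
  then show ?thesis
    by (rule M.span_induct) (use assms(2-) in \<open>auto intro!: M.subspaceI\<close>)
qed

lemma left_O': "x \<in> O' \<Longrightarrow> u \<rhd> x \<in> O'"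
  by (induction rule: O'_induct)
    (simp_all add: left_circ_in_O' product_0_right product_add_right product_scale_right
      M.subspace_0[OF O'_subspace] M.subspace_add[OF O'_subspace] M.subspace_scale[OF O'_subspace])

lemma right_O': "x \<in> O' \<Longrightarrow> x \<lhd>\<^sub>M u \<in> O'"
  by (induction rule: O'_induct)
    (simp_all add: right_circ_in_O' product_0_right product_add_right product_scale_right
      M.subspace_0[OF O'_subspace] M.subspace_add[OF O'_subspace] M.subspace_scale[OF O'_subspace])

lemma left_right_assoc: "u \<rhd> (w \<lhd>\<^sub>M v) - (u \<rhd> w) \<lhd>\<^sub>M v \<in> O'"
proof (induction u rule: homogeneous_induct)
  case (homogeneous n p q u)
  note u = this
  show ?case
  proof (induction v rule: homogeneous_induct)
    case (add v v')
    from M.subspace_add[OF O'_subspace this] show ?case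
      by (simp add: product_add_left product_add_right algebra_simps)
  next
    case (homogeneous n' p' q' v)
    with u show ?case by (intro left_right_homogeneous)
  qed (simp add: product_0_left product_0_right M.subspace_0[OF O'_subspace])
next
  case (add u u')
  from M.subspace_add[OF O'_subspace this] show ?case
    by (simp add: product_add_left product_add_right algebra_simps)
qed (simp add: product_0_left product_0_right M.subspace_0[OF O'_subspace])

end


section \<open>The twisted Zhu algebra\<close>

text \<open>\<open>V\<close> as a module over itself, twisted by the identity; the modes at non-integers are \<open>0\<close>.\<close>

definition adjoint_module :: "('v::ab_group_add) voa \<Rightarrow> ('v, 'v) voa_module" where
  "adjoint_module V = \<lparr> mscale = vscale V,
     mmode = (\<lambda>u n v. if n \<in> \<int> then vmode V u \<lfloor>Re n\<rfloor> v else 0) \<rparr>"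

lemma mscale_adjoint [simp]: "mscale (adjoint_module V) = vscale V"
  by (simp add: adjoint_module_def)

lemma mmode_adjoint_int [simp]: "mmode (adjoint_module V) u (of_int n) v = vmode V u n v"
  by (simp add: adjoint_module_def)

lemma mmode_adjoint_nonint: "n \<notin> \<int> \<Longrightarrow> mmode (adjoint_module V) u n v = 0"
  by (simp add: adjoint_module_def)

lemma res_binom_adjoint:
  "res_binom s a (of_int b) (\<lambda>k. mmode (adjoint_module V) u k v) = res_binom s a b (\<lambda>k. vmode V u k v)"
proof -
  have "mmode (adjoint_module V) u (of_int b + of_nat i) v = vmode V u (b + int i) v" for i
    using mmode_adjoint_int[of V u "b + int i" v] by simp
  then show ?thesis by (simp add: res_binom_def)
qed

lemma frac_ints_0: "frac_ints T 0 = \<int>"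
  by (auto simp: frac_ints_def Ints_def)

text \<open>With the identity as first automorphism only p = 0 carries nonzero vectors. The zero
  vector still lies in every summand with p > 0, hence the recurring case u = 0 below.\<close>

lemma (in vertex_operator_algebra) eigen_id:
  assumes "u \<in> eigen V T id r" "r < T"
  shows "r = 0 \<or> u = 0"
proof -
  have "vscale V (unity_root T r) u = vscale V 1 u" using assms(1) by (simp add: eigen_iff)
  then have "u = 0 \<or> unity_root T r = unity_root T 0"
    by (simp only: scale_cancel_right unity_root_0) blast
  then show ?thesis using unity_root_inj[of r T 0] assms(2) by auto
qed

lemma weak_twisted_module_adjoint:
  fixes V :: "'v::ab_group_add voa"
  assumes "vertex_operator_algebra V" "T \<ge> 1"
  shows "weak_twisted_module V T id (adjoint_module V)"
proof -
  interpret voa_finite_automorphism V T id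
    by (rule voa_finite_automorphism_id[OF assms])
  let ?A = "adjoint_module V"
  have left: "Vector_Spaces.linear (vscale V) (vscale V) (\<lambda>u. mmode ?A u n w)" for n w
    by (cases "n \<in> \<int>")
      (auto simp: adjoint_module_def Vector_Spaces.linear_iff vector_space_axioms mode_add_left mode_scale_left)
  have right: "Vector_Spaces.linear (vscale V) (vscale V) (mmode ?A u n)" for u n
    by (cases "n \<in> \<int>")
      (auto simp: adjoint_module_def Vector_Spaces.linear_iff vector_space_axioms mode_add_right mode_scale_right)
  have zero: "mmode ?A 0 n w = 0" "mmode ?A u n 0 = 0" for u n w
    by (simp_all add: adjoint_module_def)
  show ?thesis
  proof (intro weak_twisted_module.intro weak_twisted_module_axioms.intro)
    show "T \<ge> 1" "voa_automorphism V id" "id ^^ T = (id :: 'v \<Rightarrow> 'v)" by (fact period_pos voa_auto period)+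
    show "Vector_Spaces.linear (vscale V) (mscale ?A) (\<lambda>u. mmode ?A u n w)" for n w
      using left by simp
    show "Vector_Spaces.linear (mscale ?A) (mscale ?A) (mmode ?A u n)" for u n
      using right by simp
    show "mmode ?A u n w = 0" if "r < T" "u \<in> eigen V T id r" "n \<notin> frac_ints T r" for r u n w
      using eigen_id[OF that(2,1)] that(3) by (auto simp: frac_ints_0 zero mmode_adjoint_nonint)
    show "\<exists>N::real. \<forall>n\<in>frac_ints T r. Re n \<ge> N \<longrightarrow> mmode ?A u n w = 0"
      if "r < T" "u \<in> eigen V T id r" for r u w
    proof -
      obtain N :: int where N: "\<forall>n\<ge>N. vmode V u n w = 0" using truncation by blast
      have "mmode ?A u n w = 0" if "Re n \<ge> of_int N" for n
        using N that by (auto simp: adjoint_module_def le_floor_iff)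
      then show ?thesis by blast
    qed
    show "mmode ?A (vvac V) n w = (if n = -1 then w else 0)" for n w
    proof (cases "n \<in> \<int>")
      case True
      then obtain k where k: "n = of_int k" by (auto elim: Ints_cases)
      have "(of_int k = (- 1 :: complex)) \<longleftrightarrow> k = -1"
        using of_int_eq_iff[of k "-1", where 'a = complex] by simp
      then show ?thesis by (simp add: k vacuum)
    qed (auto simp: mmode_adjoint_nonint)
    fix r u v w and l :: int and m n :: complex
    assume r: "r < T" "u \<in> eigen V T id r" and m: "m \<in> frac_ints T r"
    show "Sum_any (\<lambda>i::nat. mscale ?A ((- 1) ^ i * (of_int l gchoose i))
        (mmode ?A u (m + of_int l - of_nat i) (mmode ?A v (n + of_nat i) w)))
      - Sum_any (\<lambda>i::nat. mscale ?A ((- 1) powi (l - int i) * (of_int l gchoose i))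
        (mmode ?A v (n + of_int l - of_nat i) (mmode ?A u (m + of_nat i) w)))
      = Sum_any (\<lambda>i::nat. mscale ?A (m gchoose i)
        (mmode ?A (vmode V u (l + int i) v) (m + n - of_nat i) w))" (is "?lhs = ?rhs")
    proof (cases "u = 0")
      case True
      then show ?thesis by (simp add: zero)
    next
      case False
      with eigen_id[OF r(2,1)] m have "m \<in> \<int>" by (simp add: frac_ints_0)
      then obtain m' where m': "m = of_int m'" by (auto elim: Ints_cases)
      show ?thesis
      proof (cases "n \<in> \<int>")
        case True
        then obtain n' where n': "n = of_int n'" by (auto elim: Ints_cases)
        have *: "m + of_int l - of_nat i = of_int (m' + l - int i)" "n + of_nat i = of_int (n' + int i)"
          "n + of_int l - of_nat i = of_int (n' + l - int i)" "m + of_nat i = of_int (m' + int i)"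
          "m + n - of_nat i = of_int (m' + n' - int i)" for i
          by (simp_all add: m' n')
        show ?thesis
          unfolding * mmode_adjoint_int mscale_adjoint unfolding m' by (rule jacobi)
      next
        case False
        \<comment> \<open>All these indices differ from n by an integer, so a non-integral n makes
          every term zero.\<close>
        have "n + of_nat i \<notin> \<int>" "n + of_int l - of_nat i \<notin> \<int>" "m + n - of_nat i \<notin> \<int>" for i
        proof -
          have "n \<in> \<int>" if "n + k \<in> \<int>" "k \<in> \<int>" for k
            using Ints_diff[OF that] by simp
          from this[of "of_nat i"] this[of "of_int l - of_nat i"] this[of "m - of_nat i"] False m'
          show "n + of_nat i \<notin> \<int>" "n + of_int l - of_nat i \<notin> \<int>" "m + n - of_nat i \<notin> \<int>"
            by (auto simp: algebra_simps)
        qed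
        then show ?thesis by (simp add: mmode_adjoint_nonint zero)
      qed
    qed
  qed (simp_all add: vector_space_axioms vertex_operator_algebra_axioms)
qed

section \<open>The Zhu algebra as the case M = V, g1 = id\<close>

locale twisted_zhu = voa_finite_automorphism V T g
  for V :: "'v::ab_group_add voa" and T :: nat and g :: "'v \<Rightarrow> 'v"
begin

sublocale adj: twisted_module_pair V T id g "adjoint_module V"
proof -
  interpret W: weak_twisted_module V T id "adjoint_module V"
    by (rule weak_twisted_module_adjoint[OF vertex_operator_algebra_axioms period_pos])
  show "twisted_module_pair V T id g (adjoint_module V)"
    by unfold_locales simp
qed

lemma trigr_id:
  assumes "u \<in> trigr V T id g (n, p, q)" "p < T"
  shows "u \<in> bigr V T g (n, q)" "p = 0 \<or> u = 0"
  using assms eigen_id[of u T p] by (auto simp: trigr_def bigr_def)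

lemma linear_res_binom:
  "Vector_Spaces.linear (vscale V) (vscale V) (\<lambda>u. res_binom (vscale V) a (b :: int) (\<lambda>k. vmode V u k v))"
  using adj.linear_mode_res_left[of a "of_int b" v] by (simp add: res_binom_adjoint)

text \<open>For p = 0 the condition p + q \<ge> T never holds, so \<open>delta2 T 0 q\<close> is
  \<open>delta1 T q\<close> and the circle product of V is recovered.\<close>

lemma adj_exponents:
  assumes "q < T"
  shows "circ_exp T n q = of_int n - 1 + of_nat (delta1 T q) + of_nat q / of_nat T"
    and "circ_pole T 0 q = of_int (- (1 + int (delta1 T q)))"
  using assms by (simp_all add: circ_exp_def circ_pole_def delta2_def delta1_less)

lemma linear_zhu_circ: "Vector_Spaces.linear (vscale V) (vscale V) (\<lambda>u. zhu_circ V T g u v)"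
  unfolding zhu_circ_def
  by (rule adj.linear_extend_sum[simplified, OF _ bigr_direct_sum])
    (auto simp: linear_res_binom split: prod.splits)

lemma linear_zhu_star: "Vector_Spaces.linear (vscale V) (vscale V) (\<lambda>u. zhu_star V T g u v)"
  unfolding zhu_star_def
  by (rule adj.linear_extend_sum[simplified, OF _ bigr_direct_sum])
    (auto intro!: adj.linear_if[simplified] simp: linear_res_binom split: prod.splits)

lemmas zhu_0_left = adj.linear_0[simplified, OF linear_zhu_circ] adj.linear_0[simplified, OF linear_zhu_star]

lemmas zhu_add_left = adj.linear_add[simplified, OF linear_zhu_circ] adj.linear_add[simplified, OF linear_zhu_star]

lemma zhu_homogeneous:
  assumes u: "u \<in> bigr V T g (n, q)" and q: "q < T"
  shows "zhu_circ V T g u v = mode_res (adjoint_module V) (circ_exp T n q) (circ_pole T 0 q) u v"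
    and "zhu_star V T g u v = (if q = 0 then mode_res (adjoint_module V) (of_int n) (-1) u v else 0)"
proof -
  have "zhu_circ V T g u v = res_binom (vscale V)
    (of_int n - 1 + of_nat (delta1 T q) + of_nat q / of_nat T)
    (- (1 + int (delta1 T q))) (\<lambda>k. vmode V u k v)"
    unfolding zhu_circ_def
    by (subst adj.extend_sum_homogeneous[simplified, OF bigr_direct_sum, of "(n, q)"])
      (use u q in \<open>auto simp: bigr_index_def linear_res_binom\<close>)
  then show "zhu_circ V T g u v = mode_res (adjoint_module V) (circ_exp T n q) (circ_pole T 0 q) u v"
    unfolding adj_exponents[OF q] by (simp only: res_binom_adjoint mscale_adjoint)
  have "zhu_star V T g u v = (if q = 0 then res_binom (vscale V)
    (of_int n) (- 1 :: int) (\<lambda>k. vmode V u k v) else 0)"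
    unfolding zhu_star_def
    by (subst adj.extend_sum_homogeneous[simplified, OF bigr_direct_sum, of "(n, q)"])
      (use u q in \<open>auto intro!: adj.linear_if[simplified] simp: bigr_index_def linear_res_binom\<close>)
  then show "zhu_star V T g u v = (if q = 0 then mode_res (adjoint_module V) (of_int n) (-1) u v else 0)"
    using res_binom_adjoint[of "vscale V" "of_int n" "-1" V u v] by simp
qed

lemma zhu_circ_eq: "zhu_circ V T g u v = bimod_circ V T id g (adjoint_module V) u v"
proof (induction u rule: adj.homogeneous_induct)
  case (homogeneous n p q u)
  show ?case
  proof (cases "u = 0")
    case False
    with trigr_id[OF homogeneous(3,1)] have u: "u \<in> bigr V T g (n, q)" "p = 0" by auto
    then show ?thesis
      unfolding adj.circ_homogeneous[OF homogeneous(3,1,2)] by (simp add: zhu_homogeneous[OF _ homogeneous(2)])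
  qed (simp only: adj.product_0_left zhu_0_left)
qed (simp_all only: adj.product_0_left adj.product_add_left zhu_0_left zhu_add_left)

lemma zhu_star_eq: "zhu_star V T g u v = bimod_left V T id g (adjoint_module V) u v"
proof (induction u rule: adj.homogeneous_induct)
  case (homogeneous n p q u)
  show ?case
  proof (cases "u = 0")
    case False
    with trigr_id[OF homogeneous(3,1)] have u: "u \<in> bigr V T g (n, q)" "p = 0" by auto
    then show ?thesis
      unfolding adj.left_homogeneous[OF homogeneous(3,1,2)] using homogeneous(2)
      by (simp add: zhu_homogeneous[OF _ homogeneous(2)] adj_exponents delta1_less)
  qed (simp only: adj.product_0_left zhu_0_left)
qed (simp_all only: adj.product_0_left adj.product_add_left zhu_0_left zhu_add_left)

lemma trigr_graded_0:
  assumes "x \<in> trigr V T id g (n, p, 0)" "p < T"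
  shows "x \<in> trigr V T id g (n, 0, 0)"
proof (cases "p = 0")
  case False
  then have "x = 0" using trigr_id(2)[OF assms] by simp
  then show ?thesis
    using assms weight_subspace subspace_0 by (auto simp: trigr_def eigen_iff)
qed (use assms in simp)

lemma left_graded_0:
  assumes "x \<in> trigr V T id g (n, 0, 0)"
  shows "adj.left x v = mode_res (adjoint_module V) (of_int n) (-1) x v"
  using adj.left_homogeneous[OF assms, of v] period_pos by (simp add: circ_exp_def delta1_def)

lemma right_graded_0:
  assumes "u \<in> trigr V T id g (n, 0, 0)"
  shows "adj.right v u = mode_res (adjoint_module V) (of_int n - 1) (-1) u v"
  using adj.right_homogeneous[OF assms, of v] period_pos by simp

text \<open>For q \<noteq> 0 the factor is z^{-1}, so by creation u o 1 = u. Such eigenvectors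
  vanish in the Zhu algebra.\<close>

lemma nonzero_eigen_in_O':
  assumes u: "u \<in> trigr V T id g (n, p, q)" "p < T" "q < T" and q: "q \<noteq> 0"
  shows "u \<in> adj.O'"
proof (cases "u = 0")
  case False
  then have p: "p = 0" using trigr_id[OF u(1,2)] by simp
  have "adj.circ u (vvac V) = mode_res (adjoint_module V) (circ_exp T n q) (of_int (-1)) u (vvac V)"
    using adj.circ_homogeneous[OF u] p adj_exponents(2)[OF u(3)] q u(3) by (simp add: delta1_less)
  also have "\<dots> = res_binom (vscale V) (circ_exp T n q) (- 1) (\<lambda>k. vmode V u k (vvac V))"
    by (simp only: res_binom_adjoint mscale_adjoint)
  also have "\<dots> = (\<Sum>i<1. vscale V (circ_exp T n q gchoose i) (vmode V u (- 1 + int i) (vvac V)))"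
    unfolding res_binom_def of_nat_eq_id id_def
    by (subst Sum_any_eq_sum[of 1]) (auto simp: creation)
  also have "\<dots> = u" by (simp add: creation)
  finally show ?thesis using adj.circ_in_O'[of u "vvac V"] by simp
qed (use adj.M.subspace_0[OF adj.O'_subspace] in simp)

lemma O'_subspace: "subspace adj.O'"
  using adj.O'_subspace by (simp only: mscale_adjoint)

text \<open>For fixed u of weight n the factor is z^{-2} and u o 1 = u_{-2}1 + n u_{-1}1, which is
  L(-1)u + L(0)u. For the other eigenvectors both summands lie in \<open>O'\<close> separately.
  Hence the second family of generators of O_g(V) adds nothing to \<open>O'\<close>.\<close>

lemma L_minus_1_L0_in_O': "Lop V (-1) u + Lop V 0 u \<in> adj.O'"
proof (induction u rule: adj.homogeneous_induct)
  case zero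
  have "Lop V (-1) 0 + Lop V 0 0 = 0" by (simp add: Lop_def)
  then show ?case by (simp only: adj.M.subspace_0[OF adj.O'_subspace])
next
  case (add u v)
  from adj.M.subspace_add[OF adj.O'_subspace this] show ?case
    by (simp add: Lop_def mode_add_right algebra_simps)
next
  case (homogeneous n p q u)
  show ?case
  proof (cases "q = 0")
    case False
    have L0: "Lop V 0 u = vscale V (of_int n) u"
      using homogeneous(3) by (simp add: trigr_def L0_weight)
    have "Lop V (-1) u \<in> adj.O'"
      using nonzero_eigen_in_O'[OF adj.trigr_L_minus_1[OF homogeneous(3)] homogeneous(1,2) False] .
    moreover have "u \<in> adj.O'"
      using nonzero_eigen_in_O'[OF homogeneous(3,1,2) False] .
    ultimately show ?thesis
      unfolding L0 by (rule subspace_add[OF O'_subspace _ subspace_scale[OF O'_subspace]])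
  next
    case True
    then have u: "u \<in> trigr V T id g (n, 0, 0)" using trigr_graded_0 homogeneous by simp
    have "adj.circ u (vvac V) = mode_res (adjoint_module V) (of_int n) (of_int (-2)) u (vvac V)"
      using adj.circ_homogeneous[OF u] period_pos by (simp add: circ_exp_def circ_pole_def delta1_def delta2_def)
    also have "\<dots> = res_binom (vscale V) (of_int n) (- 2) (\<lambda>k. vmode V u k (vvac V))"
      by (simp only: res_binom_adjoint mscale_adjoint)
    also have "\<dots> = (\<Sum>i<2. vscale V (of_int n gchoose i) (vmode V u (- 2 + int i) (vvac V)))"
      unfolding res_binom_def of_nat_eq_id id_def
      by (subst Sum_any_eq_sum[of 2]) (auto simp: creation)
    also have "\<dots> = Lop V (-1) u + Lop V 0 u"
      using u by (simp add: creation numeral_2_eq_2 L_minus_1_creation trigr_def L0_weight[of u n])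
    finally show ?thesis using adj.circ_in_O'[of u "vvac V"] by (simp only:)
  qed
qed

lemma zhu_O_eq: "zhu_O V T g = adj.O'"
proof
  have "{zhu_circ V T g u v | u v. True} \<union> {Lop V (- 1) u + Lop V 0 u | u. True} \<subseteq> adj.O'"
    using adj.circ_in_O' L_minus_1_L0_in_O' by (auto simp only: zhu_circ_eq)
  then show "zhu_O V T g \<subseteq> adj.O'"
    unfolding zhu_O_def by (rule span_minimal) (use adj.O'_subspace in simp)
  show "adj.O' \<subseteq> zhu_O V T g"
    unfolding zhu_O_def bimod_O'_def zhu_circ_eq mscale_adjoint by (rule span_mono) blast
qed

text \<open>Modulo \<open>O'\<close>, \<open>L(-1)\<close> acts as \<open>-L(0)\<close>, and \<open>y\<^bsub>-1-i\<^esub>\<one> = L(-1)\<^sup>i y / i!\<close>.\<close>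

lemma descendant_cong:
  assumes "y \<in> trigr V T id g (n, 0, 0)"
  shows "vmode V y (- 1 - int i) (vvac V) - vscale V (- of_int n gchoose i) y \<in> adj.O'"
  using assms
proof (induction i arbitrary: n y)
  case 0
  have "vmode V y (- 1 - int 0) (vvac V) - vscale V (- of_int n gchoose 0) y = 0"
    by (simp add: creation)
  then show ?case by (simp only: adj.M.subspace_0[OF adj.O'_subspace])
next
  case (Suc i)
  let ?k = "1 / of_nat (Suc i) :: complex" and ?m = "- of_int (n + 1) :: complex"
  let ?L = "Lop V (-1) y"
  have "vmode V ?L (- 1 - int i) (vvac V) = vscale V (of_nat (Suc i)) (vmode V y (- 1 - int (Suc i)) (vvac V))"
    by (simp add: L_minus_1_derivative algebra_simps)
  then have y: "vmode V y (- 1 - int (Suc i)) (vvac V) = vscale V ?k (vmode V ?L (- 1 - int i) (vvac V))"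
    by (simp del: of_nat_Suc)
  \<comment> \<open>(i+1)(-n choose i+1) = -n (-n-1 choose i), where n + 1 is the weight of
    L(-1)y.\<close>
  have coeff: "(- of_int n gchoose Suc i) = - (?k * (?m gchoose i) * of_int n)"
    using Suc_times_gbinomial[of i ?m] by (simp add: field_simps del: of_nat_Suc)
  have L0: "Lop V 0 y = vscale V (of_int n) y"
    using Suc.prems by (simp add: trigr_def L0_weight)
  have "vscale V ?k (vmode V ?L (- 1 - int i) (vvac V) - vscale V (?m gchoose i) ?L)
      + vscale V (?k * (?m gchoose i)) (?L + Lop V 0 y) \<in> adj.O'"
    by (rule subspace_add[OF O'_subspace subspace_scale[OF O'_subspace Suc.IH[OF adj.trigr_L_minus_1[OF Suc.prems]]]
          subspace_scale[OF O'_subspace L_minus_1_L0_in_O']])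
  also have "vscale V ?k (vmode V ?L (- 1 - int i) (vvac V) - vscale V (?m gchoose i) ?L)
      + vscale V (?k * (?m gchoose i)) (?L + Lop V 0 y)
      = vmode V y (- 1 - int (Suc i)) (vvac V) - vscale V (- of_int n gchoose Suc i) y"
    unfolding y coeff L0 by (simp only: scale_right_diff_distrib scale_right_distrib scale_scale scale_minus_left)
      simp
  finally show ?case .
qed

text \<open>Modulo \<open>O'\<close>, e^{zL(-1)} acts on weight k as (1+z)^{-k}, so skew symmetry
  becomes Y(x,z)u = (1+z)^{-n-n'} Y(u, -z/(1+z))x. In the residue against (1+z)^n z^{-1} the change
  of variable z -> -z/(1+z) produces the right product; here it appears as a binomial
  identity.\<close>

lemma left_right_graded_0:
  assumes x: "x \<in> trigr V T id g (n, 0, 0)" and u: "u \<in> trigr V T id g (n', 0, 0)"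
  shows "adj.left x u - adj.right x u \<in> adj.O'"
proof -
  obtain N :: int where N: "\<forall>k\<ge>N. vmode V u k x = 0" using truncation by blast
  \<comment> \<open>The modes below are indexed as j - 1, so the cutoff is one more than the
    truncation bound.\<close>
  define K where "K = nat (N + 1)"
  have K: "vmode V u k x = 0" if "k \<ge> int K - 1" for k
  proof -
    have "k \<ge> N" using that by (auto simp: K_def split: if_splits)
    then show ?thesis using N by blast
  qed
  have skew: "vmode V x (int j - 1) u
      = (\<Sum>i<K. vscale V ((- 1) ^ (i + j)) (vmode V (vmode V u (int (i + j) - 1) x) (- 1 - int i) (vvac V)))" for j
  proof -
    have "Sum_any (\<lambda>i. vscale V ((- 1) ^ i) (vmode V (vmode V u (int j - 1 + int i) x) (- 1 - int i) (vvac V)))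
        = (\<Sum>i<K. vscale V ((- 1) ^ i) (vmode V (vmode V u (int j - 1 + int i) x) (- 1 - int i) (vvac V)))"
      by (rule Sum_any_eq_sum) (simp add: K)
    moreover have "- ((- 1) powi (int j - 1)) = ((- 1) ^ j :: complex)"
      by (simp add: power_int_diff)
    ultimately show ?thesis
      unfolding skew_symmetry[of x "int j - 1" u]
      by (simp add: scale_sum_right power_add algebra_simps)
  qed
  have vanish: "vmode V x (int j - 1) u = 0" if "j \<ge> K" for j
    unfolding skew using that by (simp add: K)
  let ?y = "\<lambda>s. vmode V u (int s - 1) x"
  have left: "adj.left x u = (\<Sum>j<K. vscale V (of_int n gchoose j) (vmode V x (int j - 1) u))"
  proof -
    have "adj.left x u = res_binom (vscale V) (of_int n) (- 1) (\<lambda>k. vmode V x k u)"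
      unfolding left_graded_0[OF x] using res_binom_adjoint[of "vscale V" "of_int n" "-1" V x u] by simp
    also have "\<dots> = (\<Sum>j<K. vscale V (of_int n gchoose j) (vmode V x (- 1 + int j) u))"
      unfolding res_binom_def of_nat_eq_id id_def
      by (subst Sum_any_eq_sum[of K]) (use vanish in \<open>auto simp: add.commute\<close>)
    finally show ?thesis by simp
  qed
  have right: "adj.right x u = (\<Sum>s<K. vscale V (of_int n' - 1 gchoose s) (?y s))"
  proof -
    have "adj.right x u = res_binom (vscale V) (of_int n' - 1) (- 1) (\<lambda>k. vmode V u k x)"
      unfolding right_graded_0[OF u] using res_binom_adjoint[of "vscale V" "of_int n' - 1" "-1" V u x] by simp
    also have "\<dots> = (\<Sum>s<K. vscale V (of_int n' - 1 gchoose s) (vmode V u (- 1 + int s) x))"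
      unfolding res_binom_def of_nat_eq_id id_def
      by (subst Sum_any_eq_sum[of K]) (auto simp: K)
    finally show ?thesis by simp
  qed
  let ?d = "\<lambda>i j. vmode V (?y (i + j)) (- 1 - int i) (vvac V)"
  let ?c = "\<lambda>i j. - of_int (n + n' - int (i + j)) gchoose i :: complex"
  \<comment> \<open>Skew-symmetric expansion of the left product minus its reduction modulo
    \<open>O'\<close>; it remains to identify the reduced double sum.\<close>
  have "(\<Sum>j<K. vscale V (of_int n gchoose j) (\<Sum>i<K. vscale V ((- 1) ^ (i + j)) (?d i j - vscale V (?c i j) (?y (i + j)))))
      \<in> adj.O'"
  proof (intro subspace_sum subspace_scale O'_subspace)
    fix i j
    have "?y (i + j) \<in> trigr V T id g (n' + n - (int (i + j) - 1) - 1, (0 + 0) mod T, (0 + 0) mod T)"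
      by (rule adj.trigr_mode[OF u x])
    then have "?y (i + j) \<in> trigr V T id g (n + n' - int (i + j), 0, 0)"
      by (simp add: algebra_simps)
    then show "?d i j - vscale V (?c i j) (?y (i + j)) \<in> adj.O'"
      by (rule descendant_cong)
  qed
  also have "(\<Sum>j<K. vscale V (of_int n gchoose j) (\<Sum>i<K. vscale V ((- 1) ^ (i + j)) (?d i j - vscale V (?c i j) (?y (i + j)))))
     = adj.left x u - (\<Sum>j<K. \<Sum>i<K. vscale V ((of_int n gchoose j) * ((- 1) ^ (j + i) * ?c i j)) (?y (j + i)))"
    unfolding left skew
    by (simp add: scale_right_diff_distrib sum_subtractf scale_sum_right add.commute)
  also have "(\<Sum>j<K. \<Sum>i<K. vscale V ((of_int n gchoose j) * ((- 1) ^ (j + i) * ?c i j)) (?y (j + i))) = adj.right x u"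
  proof -
    let ?G = "\<lambda>j i. vscale V ((of_int n gchoose j) * ((- 1) ^ (j + i) * ?c i j)) (?y (j + i))"
    have "(\<Sum>j<K. \<Sum>i<K. ?G j i) = (\<Sum>(j, i)\<in>{..<K} \<times> {..<K}. ?G j i)"
      by (rule sum.cartesian_product)
    also have "\<dots> = (\<Sum>(j, i)\<in>{(j, i). j + i < K}. ?G j i)"
    proof (rule sum.mono_neutral_right)
      have "?y s \<noteq> 0 \<Longrightarrow> s < K" for s using K[of "int s - 1"] by (cases "s < K") auto
      then show "\<forall>p\<in>{..<K} \<times> {..<K} - {(j, i). j + i < K}. (case p of (j, i) \<Rightarrow> ?G j i) = 0"
        by (auto simp del: of_nat_add)
    qed auto
    also have "\<dots> = (\<Sum>s<K. \<Sum>j\<le>s. ?G j (s - j))"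
      by (rule sum.triangle_reindex)
    also have "\<dots> = (\<Sum>s<K. vscale V (of_int n' - 1 gchoose s) (?y s))"
    proof (rule sum.cong[OF refl])
      fix s
      have "(\<Sum>j\<le>s. ?G j (s - j))
          = (\<Sum>j\<le>s. vscale V ((- 1) ^ s * ((of_int n gchoose j) * ((of_nat s - of_int n - of_int n') gchoose (s - j)))) (?y s))"
        by (intro sum.cong refl) (auto simp: algebra_simps)
      also have "\<dots> = vscale V ((- 1) ^ s * (\<Sum>j=0..s. (of_int n gchoose j) * ((of_nat s - of_int n - of_int n') gchoose (s - j)))) (?y s)"
        by (simp add: scale_sum_left sum_distrib_left atLeast0AtMost)
      \<comment> \<open>Vandermonde gives (s - n' choose s); negating the upper index absorbs (-1)^s
        and gives (n' - 1 choose s).\<close>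
      also have "\<dots> = vscale V (of_int n' - 1 gchoose s) (?y s)"
        unfolding gbinomial_Vandermonde using gbinomial_negated_upper[of "of_int n' - 1 :: complex" s]
        by (simp add: algebra_simps)
      finally show "(\<Sum>j\<le>s. ?G j (s - j)) = vscale V (of_int n' - 1 gchoose s) (?y s)" .
    qed
    finally show ?thesis using right by simp
  qed
  finally show ?thesis .
qed

lemma left_right_cong: "adj.left x u - adj.right x u \<in> adj.O'"
proof (induction x rule: adj.homogeneous_induct)
  case (homogeneous n p q x)
  note x = this
  show ?case
  proof (induction u rule: adj.homogeneous_induct)
    case (add u v)
    from adj.M.subspace_add[OF adj.O'_subspace this] show ?case
      by (simp only: adj.product_add_left adj.product_add_right add_diff_add)
  next
    case (homogeneous n' p' q' u)
    note u = this
    \<comment> \<open>A factor with eigenvalue other than 1 lies in \<open>O'\<close>: the product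
      given by its own vertex operator is 0, and the other product lies in \<open>O'\<close> by
      stability.\<close>
    consider "x = 0" | "u = 0" | "q \<noteq> 0" "p = 0" | "q = 0" "q' \<noteq> 0" "p' = 0" | "q = 0" "q' = 0"
      using trigr_id(2)[OF x(3,1)] trigr_id(2)[OF u(3,1)] by blast
    then show ?case
    proof cases
      case 3
      have "adj.left x u = 0" using adj.left_homogeneous[OF x(3,1,2)] 3 x(2) by simp
      moreover have "adj.right x u \<in> adj.O'"
        by (rule adj.right_O'[OF nonzero_eigen_in_O'[OF x(3,1,2) 3(1)]])
      ultimately show ?thesis
        by (simp only: adj.M.subspace_diff[OF adj.O'_subspace adj.M.subspace_0[OF adj.O'_subspace]])
    next
      case 4
      have "adj.right x u = 0" using adj.right_homogeneous[OF u(3,1,2)] 4 by simp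
      moreover have "adj.left x u \<in> adj.O'"
        by (rule adj.left_O'[OF nonzero_eigen_in_O'[OF u(3,1,2) 4(2)]])
      ultimately show ?thesis by (simp only: diff_0_right)
    next
      case 5
      then have "x \<in> trigr V T id g (n, p, 0)" "u \<in> trigr V T id g (n', p', 0)"
        using x(3) u(3) by simp_all
      then show ?thesis
        by (rule left_right_graded_0[OF trigr_graded_0[OF _ x(1)] trigr_graded_0[OF _ u(1)]])
    qed (simp_all only: adj.product_0_left adj.product_0_right diff_self adj.M.subspace_0[OF adj.O'_subspace])
  qed (simp only: adj.product_0_left adj.product_0_right diff_self adj.M.subspace_0[OF adj.O'_subspace])
next
  case (add u v)
  from adj.M.subspace_add[OF adj.O'_subspace this] show ?case
    by (simp only: adj.product_add_left adj.product_add_right add_diff_add)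
qed (simp only: adj.product_0_left adj.product_0_right diff_self adj.M.subspace_0[OF adj.O'_subspace])

lemma zhu_O_subspace: "subspace (zhu_O V T g)"
  using adj.O'_subspace by (simp add: zhu_O_eq)

lemma zhu_star_left_ideal: "x \<in> zhu_O V T g \<Longrightarrow> zhu_star V T g u x \<in> zhu_O V T g"
  unfolding zhu_O_eq zhu_star_eq by (rule adj.left_O')

text \<open>By \<open>left_right_cong\<close> the product may be computed as the right product by u
  on x, which preserves \<open>O'\<close>.\<close>

lemma zhu_star_right_ideal:
  assumes "x \<in> zhu_O V T g" shows "zhu_star V T g x u \<in> zhu_O V T g"
proof -
  have "adj.right x u \<in> adj.O'" using assms adj.right_O' by (simp add: zhu_O_eq)
  from adj.M.subspace_add[OF adj.O'_subspace left_right_cong[of x u] this] show ?thesis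
    by (simp add: zhu_O_eq zhu_star_eq)
qed

text \<open>
  Trading left multiplications by elements for right ones, associativity becomes the compatibility
  of the left and right products.
\<close>

lemma zhu_star_assoc:
  "zhu_star V T g (zhu_star V T g u v) w - zhu_star V T g u (zhu_star V T g v w) \<in> zhu_O V T g"
proof -
  note add = adj.M.subspace_add[OF adj.O'_subspace] and diff = adj.M.subspace_diff[OF adj.O'_subspace]
  have "adj.left u (adj.left v w - adj.right v w) \<in> adj.O'"
    by (rule adj.left_O'[OF left_right_cong])
  then have "adj.left u (adj.left v w) - adj.left u (adj.right v w) \<in> adj.O'"
    by (simp add: adj.linear_diff[simplified, OF adj.linear_left_right[simplified]])
  from diff[OF left_right_cong[of "adj.left u v" w] add[OF this adj.left_right_assoc[of u v w]]]
  show ?thesis by (simp add: zhu_O_eq zhu_star_eq)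
qed

lemma zhu_star_vac_left: "zhu_star V T g (vvac V) v = v"
  unfolding zhu_star_eq by (rule adj.left_vac)

lemma zhu_star_vac_right: "zhu_star V T g v (vvac V) - v \<in> zhu_O V T g"
  using left_right_cong[of v "vvac V"] unfolding zhu_O_eq zhu_star_eq adj.right_vac .

lemma linear_zhu_star_right: "Vector_Spaces.linear (vscale V) (vscale V) (\<lambda>v. zhu_star V T g u v)"
  unfolding zhu_star_eq using adj.linear_left_right by simp

end


section \<open>Quotients\<close>

lemma cring_complex_ring: "cring complex_ring"
proof (rule cringI)
  show "abelian_group complex_ring"
    by (rule abelian_groupI) (auto simp: complex_ring_def intro: exI[of _ "- _"] ab_left_minus)
  show "Group.comm_monoid complex_ring"
    by (rule comm_monoidI) (auto simp: complex_ring_def)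
qed (simp add: complex_ring_def distrib_right)

context complex_space
begin

lemma coset_eq_iff:
  assumes "subspace N"
  shows "x +o N = y +o N \<longleftrightarrow> x - y \<in> N"
proof
  assume eq: "x +o N = y +o N"
  have "x + 0 \<in> x +o N" using subspace_0[OF assms] by (rule set_plus_intro2)
  then show "x - y \<in> N" unfolding eq by (simp add: set_minus_plus)
next
  assume xy: "x - y \<in> N"
  have "a \<in> y +o N" if "a \<in> x +o N" "x - y \<in> N" for a x y
  proof -
    have "(a - x) + (x - y) \<in> N"
      by (rule subspace_add[OF assms set_plus_imp_minus[OF that(1)] that(2)])
    then show ?thesis by (simp add: set_minus_imp_plus)
  qed
  moreover have "y - x \<in> N" using subspace_neg[OF assms xy] by simp
  ultimately show "x +o N = y +o N" using xy by blast
qed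

lemma coset_add:
  assumes "subspace N"
  shows "(x +o N) + (y +o N) = (x + y) +o N"
proof -
  have "N + N = N"
    using subspace_add[OF assms] subspace_0[OF assms] set_zero_plus2[of N N] by (auto elim!: set_plus_elim)
  then show ?thesis by (simp add: set_plus_rearrange)
qed

lemma coset_scale:
  assumes "subspace N"
  shows "(\<Union>y\<in>x +o N. scale c y +o N) = scale c x +o N"
proof -
  have "scale c y +o N = scale c x +o N" if "y \<in> x +o N" for y
    using that subspace_scale[OF assms, of "y - x" c]
    by (simp add: coset_eq_iff[OF assms] set_minus_plus scale_right_diff_distrib)
  moreover have "x \<in> x +o N" using set_plus_intro2[OF subspace_0[OF assms], of x] by simp
  ultimately show ?thesis by blast
qed

text \<open>Stated through the fields of an arbitrary record so that it covers both
  \<open>quotient_space\<close> and \<open>quotient_algebra\<close>, which differ in the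
  multiplicative fields.\<close>

lemma module_quotient:
  fixes Q :: "(complex, 'a set, 'b) module_scheme"
  assumes N: "subspace N" and carrier: "carrier Q = {x +o N | x. True}" and zero: "ring.zero Q = 0 +o N"
    and add: "add Q = (\<lambda>X Y. X + Y)" and smult: "smult Q = (\<lambda>c X. \<Union>x\<in>X. scale c x +o N)"
  shows "Module.module complex_ring Q"
proof (rule Module.moduleI[OF cring_complex_ring])
  have scale: "c \<odot>\<^bsub>Q\<^esub> (x +o N) = scale c x +o N" for c x
    by (simp only: smult coset_scale[OF N])
  note simps = carrier zero add scale coset_add[OF N]
  have inv: "\<exists>y\<in>carrier Q. y \<oplus>\<^bsub>Q\<^esub> X = \<zero>\<^bsub>Q\<^esub>" if "X \<in> carrier Q" for X
  proof -
    obtain x where "X = x +o N" using \<open>X \<in> carrier Q\<close> by (auto simp: carrier)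
    then have "(- x +o N) \<oplus>\<^bsub>Q\<^esub> X = \<zero>\<^bsub>Q\<^esub>" by (simp add: simps)
    then show ?thesis by (auto simp: carrier)
  qed
  show "abelian_group Q"
    by (rule abelian_groupI[OF _ _ _ _ _ inv]) (auto simp: simps add_ac simp del: set_zero_plus)
  show "a \<odot>\<^bsub>Q\<^esub> X \<in> carrier Q" if "X \<in> carrier Q" for a X
    using that by (auto simp: simps)
  show "(a \<oplus>\<^bsub>complex_ring\<^esub> b) \<odot>\<^bsub>Q\<^esub> X = a \<odot>\<^bsub>Q\<^esub> X \<oplus>\<^bsub>Q\<^esub> b \<odot>\<^bsub>Q\<^esub> X" if "X \<in> carrier Q" for a b X
    using that by (auto simp: simps complex_ring_def scale_left_distrib)
  show "a \<odot>\<^bsub>Q\<^esub> (X \<oplus>\<^bsub>Q\<^esub> Y) = a \<odot>\<^bsub>Q\<^esub> X \<oplus>\<^bsub>Q\<^esub> a \<odot>\<^bsub>Q\<^esub> Y" if "X \<in> carrier Q" "Y \<in> carrier Q" for a X Y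
    using that by (auto simp: simps scale_right_distrib)
  show "(a \<otimes>\<^bsub>complex_ring\<^esub> b) \<odot>\<^bsub>Q\<^esub> X = a \<odot>\<^bsub>Q\<^esub> (b \<odot>\<^bsub>Q\<^esub> X)" if "X \<in> carrier Q" for a b X
    using that by (auto simp: simps complex_ring_def)
  show "\<one>\<^bsub>complex_ring\<^esub> \<odot>\<^bsub>Q\<^esub> X = X" if "X \<in> carrier Q" for X
    using that by (auto simp: simps complex_ring_def)
qed

end

text \<open>Changing x within N1 and y within N2 changes f x y by elements of N3, so the union in
  \<open>induced_op\<close> is one of equal cosets.\<close>

lemma induced_op_coset:
  assumes "complex_space s1" "complex_space s2" "complex_space s3"
    and N: "module.subspace s1 N1" "module.subspace s2 N2" "module.subspace s3 N3"
    and f: "\<And>y. Vector_Spaces.linear s1 s3 (\<lambda>x. f x y)" "\<And>x. Vector_Spaces.linear s2 s3 (f x)"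
    and mem: "\<And>a y. a \<in> N1 \<Longrightarrow> f a y \<in> N3" "\<And>x b. b \<in> N2 \<Longrightarrow> f x b \<in> N3"
  shows "induced_op N3 f (x +o N1) (y +o N2) = f x y +o N3"
proof -
  interpret V1: complex_space s1 by fact
  interpret V2: complex_space s2 by fact
  interpret V3: complex_space s3 by fact
  have add: "f (u + v) w = f u w + f v w" "f u (w + w') = f u w + f u w'" for u v w w'
    using f unfolding Vector_Spaces.linear_iff by blast+
  have "f (x + a) (y + b) +o N3 = f x y +o N3" if "a \<in> N1" "b \<in> N2" for a b
    using that mem V3.subspace_add[OF N(3)] by (simp add: V3.coset_eq_iff[OF N(3)] add algebra_simps)
  then have "f x' y' +o N3 = f x y +o N3" if "x' \<in> x +o N1" "y' \<in> y +o N2" for x' y'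
    using that unfolding elt_set_plus_def by blast
  moreover have "x \<in> x +o N1" "y \<in> y +o N2"
    using set_plus_intro2[OF V1.subspace_0[OF N(1)], of x] set_plus_intro2[OF V2.subspace_0[OF N(2)], of y] by simp_all
  ultimately show ?thesis unfolding induced_op_def by blast
qed

text \<open>The laws are required only modulo I, since that is how the Zhu product satisfies
  them.\<close>

locale algebra_modulo = complex_space s
  for s :: "complex \<Rightarrow> 'a::ab_group_add \<Rightarrow> 'a" +
  fixes I :: "'a set" and m :: "'a \<Rightarrow> 'a \<Rightarrow> 'a" and e :: 'a
  assumes I_subspace: "subspace I"
    and m_linear: "\<And>y. Vector_Spaces.linear s s (\<lambda>x. m x y)" "\<And>x. Vector_Spaces.linear s s (m x)"
    and ideal: "\<And>a y. a \<in> I \<Longrightarrow> m a y \<in> I" "\<And>x b. b \<in> I \<Longrightarrow> m x b \<in> I"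
    and assoc: "\<And>x y z. m (m x y) z - m x (m y z) \<in> I"
    and unit: "\<And>x. m e x - x \<in> I" "\<And>x. m x e - x \<in> I"
begin

abbreviation "Q \<equiv> quotient_algebra s I m e"

lemma quotient_simps:
  "carrier Q = {x +o I | x. True}"
  "(x +o I) \<oplus>\<^bsub>Q\<^esub> (y +o I) = (x + y) +o I"
  "(x +o I) \<otimes>\<^bsub>Q\<^esub> (y +o I) = m x y +o I"
  "\<one>\<^bsub>Q\<^esub> = e +o I"
  "c \<odot>\<^bsub>Q\<^esub> (x +o I) = s c x +o I"
  using induced_op_coset[OF complex_space_axioms complex_space_axioms complex_space_axioms
      I_subspace I_subspace I_subspace m_linear ideal, of x y]
  by (auto simp: quotient_algebra_def quotient_space_def coset_add[OF I_subspace] coset_scale[OF I_subspace])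

lemma m_bilinear:
  "m (x + x') y = m x y + m x' y" "m x (y + y') = m x y + m x y'"
  "m (s c x) y = s c (m x y)" "m x (s c y) = s c (m x y)"
  using m_linear unfolding Vector_Spaces.linear_iff by blast+

lemma assoc_algebra_quotient: "assoc_algebra complex_ring Q"
proof -
  have module: "Module.module complex_ring Q"
    by (rule module_quotient[OF I_subspace]) (simp_all add: quotient_algebra_def quotient_space_def)
  have "ring Q"
  proof (rule ringI)
    show "abelian_group Q" using module by (simp add: Module.module_def)
    have "m (m x y) z +o I = m x (m y z) +o I" "m e x +o I = x +o I" "m x e +o I = x +o I" for x y z
      by (simp_all add: coset_eq_iff[OF I_subspace] assoc unit)
    then show "monoid Q"
      by (intro monoidI) (auto simp: quotient_simps)
  qed (auto simp: quotient_simps m_bilinear)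
  with module show ?thesis
    by (intro assoc_algebra.intro assoc_algebra_axioms.intro) (auto simp: quotient_simps m_bilinear)
qed

end

locale bimodule_modulo =
  A: algebra_modulo sA IA mA eA + B: algebra_modulo sB IB mB eB + X: complex_space sX
  for sA :: "complex \<Rightarrow> 'a::ab_group_add \<Rightarrow> 'a" and IA mA eA
    and sB :: "complex \<Rightarrow> 'b::ab_group_add \<Rightarrow> 'b" and IB mB eB
    and sX :: "complex \<Rightarrow> 'c::ab_group_add \<Rightarrow> 'c" +
  fixes N :: "'c set" and l :: "'a \<Rightarrow> 'c \<Rightarrow> 'c" and r :: "'c \<Rightarrow> 'b \<Rightarrow> 'c"
  assumes N_subspace: "X.subspace N"
    and l_linear: "\<And>x. Vector_Spaces.linear sA sX (\<lambda>a. l a x)" "\<And>a. Vector_Spaces.linear sX sX (l a)"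
    and r_linear: "\<And>b. Vector_Spaces.linear sX sX (\<lambda>x. r x b)" "\<And>x. Vector_Spaces.linear sB sX (r x)"
    and l_mem: "\<And>a x. a \<in> IA \<Longrightarrow> l a x \<in> N" "\<And>a x. x \<in> N \<Longrightarrow> l a x \<in> N"
    and r_mem: "\<And>x b. x \<in> N \<Longrightarrow> r x b \<in> N" "\<And>x b. b \<in> IB \<Longrightarrow> r x b \<in> N"
    and l_assoc: "\<And>a a' x. l (mA a a') x - l a (l a' x) \<in> N"
    and r_assoc: "\<And>b b' x. r x (mB b b') - r (r x b) b' \<in> N"
    and l_r: "\<And>a b x. r (l a x) b - l a (r x b) \<in> N"
    and l_unit: "\<And>x. l eA x - x \<in> N" and r_unit: "\<And>x. r x eB - x \<in> N"
begin

lemma induced_left: "induced_op N l (a +o IA) (x +o N) = l a x +o N"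
  by (rule induced_op_coset[OF A.complex_space_axioms X.complex_space_axioms X.complex_space_axioms
      A.I_subspace N_subspace N_subspace l_linear l_mem])

lemma induced_right: "induced_op N r (x +o N) (b +o IB) = r x b +o N"
  by (rule induced_op_coset[OF X.complex_space_axioms B.complex_space_axioms X.complex_space_axioms
      N_subspace B.I_subspace N_subspace r_linear r_mem])

lemma l_bilinear:
  "l (a + a') x = l a x + l a' x" "l a (x + x') = l a x + l a x'"
  "l (sA c a) x = sX c (l a x)" "l a (sX c x) = sX c (l a x)"
  using l_linear unfolding Vector_Spaces.linear_iff by blast+

lemma r_bilinear:
  "r (x + x') b = r x b + r x' b" "r x (b + b') = r x b + r x b'"
  "r (sX c x) b = sX c (r x b)" "r x (sB c b) = sX c (r x b)"
  using r_linear unfolding Vector_Spaces.linear_iff by blast+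

lemma space_simps:
  "carrier (quotient_space sX N) = {x +o N | x. True}"
  "(x +o N) \<oplus>\<^bsub>quotient_space sX N\<^esub> (y +o N) = (x + y) +o N"
  "c \<odot>\<^bsub>quotient_space sX N\<^esub> (x +o N) = sX c x +o N"
  by (simp_all add: quotient_space_def X.coset_add[OF N_subspace] X.coset_scale[OF N_subspace])

lemma algebra_bimodule_quotient:
  "algebra_bimodule complex_ring A.Q B.Q (quotient_space sX N) (induced_op N l) (induced_op N r)"
proof -
  have "Module.module complex_ring (quotient_space sX N)"
    by (rule X.module_quotient[OF N_subspace]) (simp_all add: quotient_space_def)
  moreover have "l (mA a a') x +o N = l a (l a' x) +o N" "r x (mB b b') +o N = r (r x b) b' +o N"
    "r (l a x) b +o N = l a (r x b) +o N" "l eA x +o N = x +o N" "r x eB +o N = x +o N" for a a' b b' x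
    by (simp_all add: X.coset_eq_iff[OF N_subspace] l_assoc r_assoc l_r l_unit r_unit)
  ultimately show ?thesis
    using A.assoc_algebra_quotient B.assoc_algebra_quotient
    by (intro algebra_bimodule.intro algebra_bimodule_axioms.intro)
      (auto simp: A.quotient_simps B.quotient_simps space_simps induced_left induced_right
        l_bilinear r_bilinear)
qed

end

section \<open>The bimodule\<close>

locale twisted_bimodule = twisted_module_pair V T g1 g2 M
  for V :: "'v::ab_group_add voa" and T :: nat and g1 g2 :: "'v \<Rightarrow> 'v"
    and M :: "('v, 'm::ab_group_add) voa_module"
begin

sublocale L: twisted_zhu V T "g1 \<circ> g2"
  by (rule twisted_zhu.intro, rule comp_automorphism)

sublocale R: twisted_zhu V T g2 ..

abbreviation O'' where "O'' \<equiv> bimod_O'' V T g1 g2 M"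
abbreviation OM where "OM \<equiv> bimod_O V T g1 g2 M"
abbreviation star_L (infixl \<open>\<star>\<^sub>L\<close> 70) where "u \<star>\<^sub>L v \<equiv> zhu_star V T (g1 \<circ> g2) u v"
abbreviation star_R (infixl \<open>\<star>\<^sub>R\<close> 70) where "u \<star>\<^sub>R v \<equiv> zhu_star V T g2 u v"

lemma O''_subspace: "M.subspace O''"
  unfolding bimod_O''_def by (rule M.subspace_span)

lemma OM_subspace: "M.subspace OM"
proof (rule M.subspaceI)
  show "0 \<in> OM"
    using M.subspace_0[OF O'_subspace] M.subspace_0[OF O''_subspace] set_plus_intro[of 0 O' 0 O'']
    by (simp add: bimod_O_def)
  show "x + y \<in> OM" if xy: "x \<in> OM" "y \<in> OM" for x y
  proof -
    obtain a b c d where "x = a + b" "a \<in> O'" "b \<in> O''" "y = c + d" "c \<in> O'" "d \<in> O''"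
      using xy by (auto simp: bimod_O_def elim!: set_plus_elim)
    then have "x + y = (a + c) + (b + d)" "a + c \<in> O'" "b + d \<in> O''"
      using M.subspace_add O'_subspace O''_subspace by (auto simp: algebra_simps)
    then show ?thesis by (auto simp: bimod_O_def)
  qed
  show "mscale M c x \<in> OM" if x: "x \<in> OM" for c x
  proof -
    obtain a b where "x = a + b" "a \<in> O'" "b \<in> O''"
      using x by (auto simp: bimod_O_def elim!: set_plus_elim)
    then have "mscale M c x = mscale M c a + mscale M c b" "mscale M c a \<in> O'" "mscale M c b \<in> O''"
      using M.subspace_scale O'_subspace O''_subspace by (auto simp: M.scale_right_distrib)
    then show ?thesis by (auto simp: bimod_O_def)
  qed
qed

lemma O'_subset: "O' \<subseteq> OM"
  using set_zero_plus2[OF M.subspace_0[OF O''_subspace], of O'] by (simp add: bimod_O_def add.commute)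

lemma O''_subset: "O'' \<subseteq> OM"
  using set_zero_plus2[OF M.subspace_0[OF O'_subspace], of O''] by (simp add: bimod_O_def)

section \<open>Stability of \<open>OM\<close> under both products\<close>

definition cong_OM (infix \<open>\<approx>\<close> 50) where "x \<approx> y \<longleftrightarrow> x - y \<in> OM"

lemma cong_sym: "x \<approx> y \<Longrightarrow> y \<approx> x"
  using M.subspace_neg[OF OM_subspace, of "x - y"] by (simp add: cong_OM_def)

lemma cong_trans [trans]: "x \<approx> y \<Longrightarrow> y \<approx> z \<Longrightarrow> x \<approx> z"
  using M.subspace_add[OF OM_subspace, of "x - y" "y - z"] by (simp add: cong_OM_def)

lemma left_diff: "u \<rhd> (x - y) = u \<rhd> x - u \<rhd> y" "(a - b) \<rhd> x = a \<rhd> x - b \<rhd> x"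
  and right_diff: "(x - y) \<lhd>\<^sub>M u = x \<lhd>\<^sub>M u - y \<lhd>\<^sub>M u" "x \<lhd>\<^sub>M (a - b) = x \<lhd>\<^sub>M a - x \<lhd>\<^sub>M b"
proof -
  interpret MM: complex_space_pair "mscale M" "mscale M" ..
  show "u \<rhd> (x - y) = u \<rhd> x - u \<rhd> y" "(x - y) \<lhd>\<^sub>M u = x \<lhd>\<^sub>M u - y \<lhd>\<^sub>M u"
    by (rule MM.linear_diff[OF linear_left_right] MM.linear_diff[OF linear_right_left])+
  show "(a - b) \<rhd> x = a \<rhd> x - b \<rhd> x" "x \<lhd>\<^sub>M (a - b) = x \<lhd>\<^sub>M a - x \<lhd>\<^sub>M b"
    by (rule linear_diff[OF linear_left] linear_diff[OF linear_right])+
qed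

text \<open>No computation in M is involved: these are the generators divided out in
  \<open>O''\<close>.\<close>

lemma left_mult: "(u \<star>\<^sub>L v) \<rhd> w \<approx> u \<rhd> (v \<rhd> w)"
  and right_mult: "w \<lhd>\<^sub>M (v \<star>\<^sub>R u) \<approx> (w \<lhd>\<^sub>M v) \<lhd>\<^sub>M u"
  and left_zhu_O: "a \<in> zhu_O V T (g1 \<circ> g2) \<Longrightarrow> a \<rhd> w \<in> OM"
  and right_zhu_O: "b \<in> zhu_O V T g2 \<Longrightarrow> w \<lhd>\<^sub>M b \<in> OM"
  unfolding cong_OM_def by (rule subsetD[OF O''_subset], unfold bimod_O''_def, rule M.span_base, blast)+

text \<open>In contrast to the module laws, compatibility of the two actions comes from
  \<open>O'\<close> alone.\<close>

lemma left_right: "u \<rhd> (w \<lhd>\<^sub>M v) \<approx> (u \<rhd> w) \<lhd>\<^sub>M v"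
  unfolding cong_OM_def by (rule subsetD[OF O'_subset left_right_assoc])

lemma left_cong: "a - b \<in> zhu_O V T (g1 \<circ> g2) \<Longrightarrow> a \<rhd> w \<approx> b \<rhd> w"
  and right_cong: "a - b \<in> zhu_O V T g2 \<Longrightarrow> w \<lhd>\<^sub>M a \<approx> w \<lhd>\<^sub>M b"
  using left_zhu_O[of "a - b"] right_zhu_O[of "a - b"]
  by (simp_all add: cong_OM_def left_diff right_diff)

text \<open>At this stage only differences in \<open>O'\<close> may be multiplied; for differences
  in \<open>OM\<close> this is what \<open>left_OM\<close> and \<open>right_OM\<close> are to
  prove.\<close>

lemma left_O'_cong: "x - y \<in> O' \<Longrightarrow> u \<rhd> x \<approx> u \<rhd> y"
  and right_O'_cong: "x - y \<in> O' \<Longrightarrow> x \<lhd>\<^sub>M u \<approx> y \<lhd>\<^sub>M u"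
  using left_O'[of "x - y" u] right_O'[of "x - y" u] O'_subset
  by (auto simp: cong_OM_def left_diff right_diff)

lemma left_OM_mem: "x \<approx> y \<Longrightarrow> y \<in> OM \<Longrightarrow> x \<in> OM"
  using M.subspace_add[OF OM_subspace, of "x - y" y] by (simp add: cong_OM_def)

lemma O''_induct [consumes 1, case_names assoc_left assoc_right left_zhu right_zhu subspace]:
  assumes "x \<in> O''"
    and "\<And>u v w. P ((u \<star>\<^sub>L v) \<rhd> w - u \<rhd> (v \<rhd> w))"
    and "\<And>u v w. P (w \<lhd>\<^sub>M (v \<star>\<^sub>R u) - (w \<lhd>\<^sub>M v) \<lhd>\<^sub>M u)"
    and "\<And>a w. a \<in> zhu_O V T (g1 \<circ> g2) \<Longrightarrow> P (a \<rhd> w)"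
    and "\<And>b w. b \<in> zhu_O V T g2 \<Longrightarrow> P (w \<lhd>\<^sub>M b)"
    and "M.subspace {x. P x}"
  shows "P x"
  using assms(1) unfolding bimod_O''_def
  by (rule M.span_induct) (use assms(2-) in blast)+

lemma left_OM:
  assumes "x \<in> OM" shows "u \<rhd> x \<in> OM"
proof -
  have "u \<rhd> x \<in> OM" if "x \<in> O''" for x
    using that
  proof (induction rule: O''_induct)
    case (assoc_left a b w)
    have "u \<rhd> ((a \<star>\<^sub>L b) \<rhd> w) \<approx> (u \<star>\<^sub>L (a \<star>\<^sub>L b)) \<rhd> w" by (rule cong_sym[OF left_mult])
    \<comment> \<open>Associativity of the Zhu algebra enters in the algebra argument, where the
      congruence is modulo \<open>zhu_O\<close>.\<close>
    also have "\<dots> \<approx> ((u \<star>\<^sub>L a) \<star>\<^sub>L b) \<rhd> w"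
      by (rule cong_sym[OF left_cong[OF L.zhu_star_assoc]])
    also have "\<dots> \<approx> (u \<star>\<^sub>L a) \<rhd> (b \<rhd> w)" by (rule left_mult)
    also have "\<dots> \<approx> u \<rhd> (a \<rhd> (b \<rhd> w))" by (rule left_mult)
    finally show ?case by (simp add: cong_OM_def left_diff)
  next
    case (assoc_right c v w)
    have "u \<rhd> (w \<lhd>\<^sub>M (v \<star>\<^sub>R c)) \<approx> (u \<rhd> w) \<lhd>\<^sub>M (v \<star>\<^sub>R c)" by (rule left_right)
    also have "\<dots> \<approx> ((u \<rhd> w) \<lhd>\<^sub>M v) \<lhd>\<^sub>M c" by (rule right_mult)
    \<comment> \<open>The right product by c is applied to a difference that lies in
      \<open>O'\<close>, so stability of \<open>OM\<close> is not presupposed.\<close>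
    also have "\<dots> \<approx> (u \<rhd> (w \<lhd>\<^sub>M v)) \<lhd>\<^sub>M c"
      by (rule cong_sym[OF right_O'_cong[OF left_right_assoc]])
    also have "\<dots> \<approx> u \<rhd> ((w \<lhd>\<^sub>M v) \<lhd>\<^sub>M c)" by (rule cong_sym[OF left_right])
    finally show ?case by (simp add: cong_OM_def left_diff)
  next
    case (left_zhu a w)
    \<comment> \<open>Absorb u into the algebra: its product with a stays in the ideal, and the
      ideal acts into \<open>OM\<close>.\<close>
    then show ?case
      by (intro left_OM_mem[OF cong_sym[OF left_mult]] left_zhu_O L.zhu_star_left_ideal)
  next
    case (right_zhu b w)
    then show ?case
      by (intro left_OM_mem[OF left_right] right_zhu_O)
  next
    case subspace
    show ?case
      by (rule M.subspaceI) (auto simp: product_0_right product_add_right product_scale_right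
          intro: M.subspace_0[OF OM_subspace] M.subspace_add[OF OM_subspace] M.subspace_scale[OF OM_subspace])
  qed
  moreover obtain a b where "x = a + b" "a \<in> O'" "b \<in> O''"
    using assms by (auto simp: bimod_O_def elim!: set_plus_elim)
  ultimately show ?thesis
    using left_O'[of a u] O'_subset M.subspace_add[OF OM_subspace] by (auto simp: product_add_right)
qed

lemma right_OM:
  assumes "x \<in> OM" shows "x \<lhd>\<^sub>M u \<in> OM"
proof -
  have "x \<lhd>\<^sub>M u \<in> OM" if "x \<in> O''" for x
    using that
  proof (induction rule: O''_induct)
    case (assoc_left a b w)
    have "((a \<star>\<^sub>L b) \<rhd> w) \<lhd>\<^sub>M u \<approx> (a \<star>\<^sub>L b) \<rhd> (w \<lhd>\<^sub>M u)" by (rule cong_sym[OF left_right])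
    also have "\<dots> \<approx> a \<rhd> (b \<rhd> (w \<lhd>\<^sub>M u))" by (rule left_mult)
    also have "\<dots> \<approx> a \<rhd> ((b \<rhd> w) \<lhd>\<^sub>M u)" by (rule left_O'_cong[OF left_right_assoc])
    also have "\<dots> \<approx> (a \<rhd> (b \<rhd> w)) \<lhd>\<^sub>M u" by (rule left_right)
    finally show ?case by (simp add: cong_OM_def right_diff)
  next
    case (assoc_right c v w)
    have "(w \<lhd>\<^sub>M (v \<star>\<^sub>R c)) \<lhd>\<^sub>M u \<approx> w \<lhd>\<^sub>M ((v \<star>\<^sub>R c) \<star>\<^sub>R u)" by (rule cong_sym[OF right_mult])
    also have "\<dots> \<approx> w \<lhd>\<^sub>M (v \<star>\<^sub>R (c \<star>\<^sub>R u))" by (rule right_cong[OF R.zhu_star_assoc])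
    also have "\<dots> \<approx> (w \<lhd>\<^sub>M v) \<lhd>\<^sub>M (c \<star>\<^sub>R u)" by (rule right_mult)
    also have "\<dots> \<approx> ((w \<lhd>\<^sub>M v) \<lhd>\<^sub>M c) \<lhd>\<^sub>M u" by (rule right_mult)
    finally show ?case by (simp add: cong_OM_def right_diff)
  next
    case (left_zhu a w)
    then show ?case
      by (intro left_OM_mem[OF cong_sym[OF left_right]] left_zhu_O)
  next
    case (right_zhu b w)
    then show ?case
      by (intro left_OM_mem[OF cong_sym[OF right_mult]] right_zhu_O R.zhu_star_right_ideal)
  next
    case subspace
    show ?case
      by (rule M.subspaceI) (auto simp: product_0_right product_add_right product_scale_right
          intro: M.subspace_0[OF OM_subspace] M.subspace_add[OF OM_subspace] M.subspace_scale[OF OM_subspace])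
  qed
  moreover obtain a b where "x = a + b" "a \<in> O'" "b \<in> O''"
    using assms by (auto simp: bimod_O_def elim!: set_plus_elim)
  ultimately show ?thesis
    using right_O'[of a u] O'_subset M.subspace_add[OF OM_subspace] by (auto simp: product_add_right)
qed

end

lemma (in twisted_zhu) algebra_modulo_zhu:
  "algebra_modulo (vscale V) (zhu_O V T g) (zhu_star V T g) (vvac V)"
proof (intro algebra_modulo.intro algebra_modulo_axioms.intro)
  show "subspace (zhu_O V T g)" by (rule zhu_O_subspace)
  show "zhu_star V T g (vvac V) x - x \<in> zhu_O V T g" for x
    using subspace_0[OF zhu_O_subspace] by (simp add: zhu_star_vac_left)
qed (rule complex_space_axioms zhu_star_right_ideal zhu_star_left_ideal zhu_star_assoc zhu_star_vac_right
    linear_zhu_star linear_zhu_star_right; assumption?)+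

context twisted_bimodule
begin

sublocale bimodule_modulo
  "vscale V" "zhu_O V T (g1 \<circ> g2)" "zhu_star V T (g1 \<circ> g2)" "vvac V"
  "vscale V" "zhu_O V T g2" "zhu_star V T g2" "vvac V"
  "mscale M" OM "bimod_left V T g1 g2 M" "bimod_right V T g1 g2 M"
proof (intro bimodule_modulo.intro bimodule_modulo_axioms.intro)
  show "algebra_modulo (vscale V) (zhu_O V T (g1 \<circ> g2)) (zhu_star V T (g1 \<circ> g2)) (vvac V)"
    by (rule L.algebra_modulo_zhu)
  show "algebra_modulo (vscale V) (zhu_O V T g2) (zhu_star V T g2) (vvac V)"
    by (rule R.algebra_modulo_zhu)
  show "complex_space (mscale M)" by (rule M.complex_space_axioms)
  show "M.subspace OM" by (rule OM_subspace)
  show "(u \<rhd> w) \<lhd>\<^sub>M v - u \<rhd> (w \<lhd>\<^sub>M v) \<in> OM" for u v w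
    using cong_sym[OF left_right] by (simp add: cong_OM_def)
  show "(u \<star>\<^sub>L v) \<rhd> w - u \<rhd> (v \<rhd> w) \<in> OM" for u v w
    using left_mult by (simp add: cong_OM_def)
  show "w \<lhd>\<^sub>M (v \<star>\<^sub>R u) - (w \<lhd>\<^sub>M v) \<lhd>\<^sub>M u \<in> OM" for u v w
    using right_mult by (simp add: cong_OM_def)
  show "vvac V \<rhd> w - w \<in> OM" "w \<lhd>\<^sub>M vvac V - w \<in> OM" for w
    using M.subspace_0[OF OM_subspace] by (simp_all add: left_vac right_vac)
qed (rule linear_left linear_left_right linear_right linear_right_left
    left_zhu_O left_OM right_OM right_zhu_O; assumption?)+

end


theorem theorem3p7:
  fixes V :: "'v::ab_group_add voa"
    and T :: nat
    and g1 g2 :: "'v \<Rightarrow> 'v"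
    and M :: "('v, 'm::ab_group_add) voa_module"
  assumes "vertex_operator_algebra V"
    and "T \<ge> 1"
    and "voa_automorphism V g1" and "voa_automorphism V g2"
    and "g1 \<circ> g2 = g2 \<circ> g1"
    and "g1 ^^ T = id" and "g2 ^^ T = id"
    and "twisted_module V T g1 M"
    and "generated_in_lowest_degree V T M"
  shows "\<exists>lact ract.
    (\<forall>u w. lact (u +o zhu_O V T (g1 \<circ> g2)) (w +o bimod_O V T g1 g2 M)
             = bimod_left V T g1 g2 M u w +o bimod_O V T g1 g2 M) \<and>
    (\<forall>w u. ract (w +o bimod_O V T g1 g2 M) (u +o zhu_O V T g2)
             = bimod_right V T g1 g2 M w u +o bimod_O V T g1 g2 M) \<and>
    algebra_bimodule complex_ring
      (zhu_algebra V T (g1 \<circ> g2)) (zhu_algebra V T g2) (bimod_quotient V T g1 g2 M) lact ract"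
proof -
  interpret twisted_module V T g1 M by fact
  interpret G2: voa_finite_automorphism V T g2
    by unfold_locales (fact assms)+
  interpret twisted_bimodule V T g1 g2 M
    by unfold_locales (fact assms)
  show ?thesis
  \<comment> \<open>The actions are the induced maps on cosets; the two equations give their values
    on representatives and so determine them on the carriers.\<close>
  proof (intro exI conjI allI)
    show "induced_op (bimod_O V T g1 g2 M) (bimod_left V T g1 g2 M)
        (u +o zhu_O V T (g1 \<circ> g2)) (w +o bimod_O V T g1 g2 M)
      = bimod_left V T g1 g2 M u w +o bimod_O V T g1 g2 M" for u w
      by (rule induced_left)
    show "induced_op (bimod_O V T g1 g2 M) (bimod_right V T g1 g2 M)
        (w +o bimod_O V T g1 g2 M) (u +o zhu_O V T g2)
      = bimod_right V T g1 g2 M w u +o bimod_O V T g1 g2 M" for u w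
      by (rule induced_right)
    show "algebra_bimodule complex_ring (zhu_algebra V T (g1 \<circ> g2)) (zhu_algebra V T g2)
        (bimod_quotient V T g1 g2 M)
        (induced_op (bimod_O V T g1 g2 M) (bimod_left V T g1 g2 M))
        (induced_op (bimod_O V T g1 g2 M) (bimod_right V T g1 g2 M))"
      unfolding zhu_algebra_def bimod_quotient_def by (rule algebra_bimodule_quotient)
  qed
qed

end
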